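(* Let $a_1,a_2:[0,1]\to\mathbb R$ and $b_{ij}:[0,1]\to\mathbb C$ ($i,j\in\{1,2\}$) be functions in $L_1[0,1]$ such that, for some $\varepsilon>0$, $a_1(x)>0$, $a_2(x)<0$ and $a_1(x)-a_2(x)\ge\varepsilon$ on $[0,1]$. Consider the system $$\begin{pmatrix} y_1\\ y_2\end{pmatrix}'-\begin{pmatrix} b_{11}&b_{12}\\ b_{21}&b_{22}\end{pmatrix}\begin{pmatrix} y_1\\ y_2\end{pmatrix}=\lambda\begin{pmatrix} a_1&0\\0&a_2\end{pmatrix}\begin{pmatrix} y_1\\ y_2\end{pmatrix},\qquad x\in[0,1].\qquad( * )$$ Let $\kappa\in\mathbb R$ be arbitrary and let $\Pi_\kappa^+=\{\lambda\in\mathbb C:\ \operatorname{Re}\lambda>-\kappa\}$, $\Pi_\kappa^-=\{\lambda\in\mathbb C:\ \operatorname{Re}\lambda<\kappa\}$. (1) There exists a fundamental matrix $Y(x,\lambda)$ of $( * )$ having the representation $$Y(x,\lambda)=M(x)\bigl(I+R(x,\lambda)\bigr)E(x,\lambda),$$ where $R(x,\lambda)=(r_{ij}(x,\lambda))$ is a matrix function holomorphic in $\lambda$ in the half-plane $\Pi_\kappa^+$ for sufficiently large $|\lambda|$, and its entries satisfy, with some constant $C_0$ independent of $\lambda$, $$\|r_{ij}(\cdot,\lambda)\|_{C[0,1]}\le C_0\,\Upsilon(\lambda),\qquad i,j\in\{1,2\},$$ for $\lambda\in\Pi_\kappa^+$ with $|\lambda|$ sufficiently large. (2) If in addition, for some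 fixed integer $n\ge1$, $a_1,a_2,b_{12},b_{21}\in W_1^n[0,1]$ and $b_{11},b_{22}\in W_1^{n-1}[0,1]$, then the fundamental matrix $Y(x,\lambda)$ can be chosen so that $R(x,\lambda)$ admits the representation $$R(x,\lambda)=\frac{R^1(x)}{\lambda}+\dots+\frac{R^n(x)}{\lambda^n}+o(1)\lambda^{-n},$$ where the entries of the matrix $o(1)$ tend to $0$ uniformly in $x\in[0,1]$ as $\lambda\to\infty$, $\lambda\in\Pi_\kappa^+$. The matrix functions $R^m=\begin{pmatrix} r_{11}^m&r_{12}^m\\ r_{21}^m&r_{22}^m\end{pmatrix}$, $1\le m\le n$, are given by $$r_{11}^1=I_1\frac{b_{21}b}{a},\qquad r_{21}^1=\frac{b_{21}b}{a},\qquad r_{12}^1=-\frac{b_{12}b^{-1}}{a},\qquad r_{22}^1=-I_2\frac{b_{12}b^{-1}}{a},$$ $$r_{11}^{m+1}=I_1r_{21}^{m+1},\qquad r_{21}^{m+1}=(-D+J_1)^m r_{21}^1,\qquad r_{12}^{m+1}=(D+J_2)^m r_{12}^1,\qquad r_{22}^{m+1}=I_2r_{12}^{m+1}.$$ (3) The analogous statement holds with $\Pi_\kappa^+$ replaced by $\Pi_\kappa^-$: both (1) (with $\Upsilon$ replaced by $\Upsilon^-$) and (2) (with the same formulas for $R^m$) hold with $\Pi_\kappa^-$ in place of $\Pi_\kappa^+$.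
   Context: A fundamental matrix of $( * )$ is a matrix $Y(x,\lambda)=(y_{ij}(x,\lambda))_{i,j=1}^2$, defined for $x\in[0,1]$ and $\lambda$ in the region under consideration with $|\lambda|>\lambda_0$ for some $\lambda_0$, whose columns are linearly independent solutions of $( * )$ (absolutely continuous in $x$, equation satisfied a.e.) for each fixed $\lambda$. $W_1^k[0,1]$ is the Sobolev space of functions $y$ with $y^{(s)}$ absolutely continuous for $s\le k-1$ and $y^{(k)}\in L_1[0,1]$ ($W_1^0=L_1$). $I$ is the $2\times2$ identity matrix. Notation: $$M(x)=\begin{pmatrix} e^{\int_0^x b_{11}(t)dt}&0\\0&e^{\int_0^x b_{22}(t)dt}\end{pmatrix},\qquad E(x,\lambda)=\begin{pmatrix} e^{\lambda\int_0^x a_1(t)dt}&0\\0&e^{\lambda\int_0^x a_2(t)dt}\end{pmatrix},$$ $$a(x)=a_1(x)-a_2(x),\qquad b(x)=e^{\int_0^x (b_{11}(t)-b_{22}(t))dt},\qquad \rho(x)=\int_0^x a(t)\,dt,$$ $$q_{12}=b_{12}b^{-1},\qquad q_{21}=b_{21}b\qquad(b^{-1}=1/b).$$ Operators acting on functions on $[0,1]$: $$(I_1f)(x)=-\int_x^1 b_{12}(t)b^{-1}(t)f(t)\,dt,\qquad (I_2f)(x)=\int_0^x b_{21}(t)b(t)f(t)\,dt,$$ $$(Df)(x)=\frac1{a(x)}f'(x),\qquad J_1=\frac{b_{21}b}{a}I_1,\qquad J_2=-\frac{b_{12}b^{-1}}{a}I_2.$$ For $s,x\in[0,1]$ and $\lambda\in\mathbb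 C$ put $$v_{11}(s,x,\lambda)=-\int_{\max\{x,s\}}^1 q_{12}(t)e^{-\lambda[\rho(t)-\rho(s)]}dt,\qquad v_{12}(s,x,\lambda)=-\int_{\max\{x,s\}}^1 q_{12}(t)e^{\lambda[\rho(x)-\rho(t)]}dt,$$ $$v_{21}(s,x,\lambda)=-\int_0^{\min\{x,s\}} q_{21}(t)e^{-\lambda[\rho(x)-\rho(t)]}dt,\qquad v_{22}(s,x,\lambda)=-\int_0^{\min\{x,s\}} q_{21}(t)e^{\lambda[\rho(t)-\rho(s)]}dt,$$ and $\Upsilon(\lambda)=\max_{i,j,s,x}|v_{ij}(s,x,\lambda)|$, the maximum being over $i,j\in\{1,2\}$, $s,x\in[0,1]$. The analogue $\Upsilon^-$ for the half-plane $\Pi_\kappa^-$ is obtained from $\Upsilon$ by interchanging the indices $1\leftrightarrow2$ of the system and replacing $\lambda$ by $-\lambda$: $\Upsilon^-(\lambda)$ is the maximum over $s,x\in[0,1]$ of the absolute values of the four integrals $$\int_{\max\{x,s\}}^1 q_{21}(t)e^{\lambda[\rho(t)-\rho(s)]}dt,\quad \int_{\max\{x,s\}}^1 q_{21}(t)e^{-\lambda[\rho(x)-\rho(t)]}dt,$$ $$\int_0^{\min\{x,s\}} q_{12}(t)e^{\lambda[\rho(x)-\rho(t)]}dt,\quad \int_0^{\min\{x,s\}} q_{12}(t)e^{-\lambda[\rho(t)-\rho(s)]}dt.$$ *)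

theory Defs
  imports "HOL-Analysis.Analysis"
begin

section \<open>Function spaces on the unit interval\<close>

text \<open>
  Absolute continuity of a function of a real variable, in the epsilon-delta form; the finite
  families of non-overlapping closed subintervals are the library's divisions. (The library constant
  \<open>absolutely_continuous\<close> concerns measures.)
\<close>

definition absolutely_continuous_on :: "real set \<Rightarrow> (real \<Rightarrow> 'a::metric_space) \<Rightarrow> bool" where
  "absolutely_continuous_on S f \<longleftrightarrow>
    (\<forall>e>0. \<exists>d>0. \<forall>D. D division_of \<Union>D \<and> \<Union>D \<subseteq> S \<and> (\<Sum>k\<in>D. Sup k - Inf k) < d
        \<longrightarrow> (\<Sum>k\<in>D. dist (f (Inf k)) (f (Sup k))) < e)"

text \<open>
  The Sobolev space \<open>W\<^sub>1\<^sup>k[0,1]\<close>; \<open>F s\<close> is the derivative of order \<open>s\<close>, which is classical (one-sided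
  at the endpoints) for \<open>s < k\<close> and exists almost everywhere for \<open>s = k\<close>. For \<open>k = 0\<close> this is
  \<open>L\<^sub>1[0,1]\<close>.
\<close>

definition sobolev_W1 :: "nat \<Rightarrow> (real \<Rightarrow> 'a::euclidean_space) \<Rightarrow> bool" where
  "sobolev_W1 k f \<longleftrightarrow>
    (\<exists>F :: nat \<Rightarrow> real \<Rightarrow> 'a.
        (\<forall>x\<in>{0..1}. F 0 x = f x) \<and>
        (\<forall>s<k. absolutely_continuous_on {0..1} (F s)) \<and>
        (\<forall>s. Suc s < k \<longrightarrow>
            (\<forall>x\<in>{0..1}. (F s has_vector_derivative F (Suc s) x) (at x within {0..1}))) \<and>
        (\<forall>s. Suc s = k \<longrightarrow>
            (AE x in lebesgue_on {0..1}.
               (F s has_vector_derivative F (Suc s) x) (at x within {0..1}))) \<and>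
        F k absolutely_integrable_on {0..1})"


section \<open>The system and its fundamental matrices\<close>

text \<open>
  The coefficients are indexed by the two-element type \<open>2\<close>, whose elements are \<open>1\<close> and \<open>2\<close>:
  \<open>a i\<close> is \<open>a\<^sub>i\<close> and \<open>b i j\<close> is \<open>b\<^sub>i\<^sub>j\<close>. The spectral parameter is written \<open>\<mu>\<close>. All integrals below
  are \<open>integral\<close>; they are applied to absolutely integrable functions only, where this is the
  Lebesgue integral.
\<close>

definition diag2 :: "(2 \<Rightarrow> complex) \<Rightarrow> complex^2^2" where
  "diag2 d = (\<chi> i j. if i = j then d i else 0)"

definition is_solution ::
  "(2 \<Rightarrow> real \<Rightarrow> real) \<Rightarrow> (2 \<Rightarrow> 2 \<Rightarrow> real \<Rightarrow> complex) \<Rightarrow> complex \<Rightarrow> (real \<Rightarrow> complex^2) \<Rightarrow> bool" where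
  "is_solution a b \<mu> y \<longleftrightarrow>
     absolutely_continuous_on {0..1} y \<and>
     (AE x in lebesgue_on {0..1}.
        \<exists>y'. (y has_vector_derivative y') (at x within {0..1}) \<and>
             y' - (\<chi> i j. b i j x) *v y x = \<mu> *s (diag2 (\<lambda>i. of_real (a i x)) *v y x))"

text \<open>Linear independence of the columns is that of vector functions on \<open>[0,1]\<close>, over the
  complex numbers.\<close>

definition fundamental_matrix ::
  "(2 \<Rightarrow> real \<Rightarrow> real) \<Rightarrow> (2 \<Rightarrow> 2 \<Rightarrow> real \<Rightarrow> complex) \<Rightarrow> complex set
    \<Rightarrow> (real \<Rightarrow> complex \<Rightarrow> complex^2^2) \<Rightarrow> bool" where
  "fundamental_matrix a b \<Omega> Y \<longleftrightarrow>
     (\<forall>\<mu>\<in>\<Omega>.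
        (\<forall>j. is_solution a b \<mu> (\<lambda>x. column j (Y x \<mu>))) \<and>
        (\<forall>c :: 2 \<Rightarrow> complex.
           (\<forall>x\<in>{0..1}. (\<Sum>j\<in>UNIV. c j *s column j (Y x \<mu>)) = 0) \<longrightarrow> (\<forall>j. c j = 0)))"


section \<open>Auxiliary functions\<close>

definition matM :: "(2 \<Rightarrow> 2 \<Rightarrow> real \<Rightarrow> complex) \<Rightarrow> real \<Rightarrow> complex^2^2" where
  "matM b x = diag2 (\<lambda>i. exp (integral {0..x} (b i i)))"

definition matE :: "(2 \<Rightarrow> real \<Rightarrow> real) \<Rightarrow> real \<Rightarrow> complex \<Rightarrow> complex^2^2" where
  "matE a x \<mu> = diag2 (\<lambda>i. exp (\<mu> * of_real (integral {0..x} (a i))))"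

definition adiff :: "(2 \<Rightarrow> real \<Rightarrow> real) \<Rightarrow> real \<Rightarrow> real" where
  "adiff a x = a 1 x - a 2 x"

definition bexp :: "(2 \<Rightarrow> 2 \<Rightarrow> real \<Rightarrow> complex) \<Rightarrow> real \<Rightarrow> complex" where
  "bexp b x = exp (integral {0..x} (\<lambda>t. b 1 1 t - b 2 2 t))"

definition rho :: "(2 \<Rightarrow> real \<Rightarrow> real) \<Rightarrow> real \<Rightarrow> real" where
  "rho a x = integral {0..x} (adiff a)"

definition q12 :: "(2 \<Rightarrow> 2 \<Rightarrow> real \<Rightarrow> complex) \<Rightarrow> real \<Rightarrow> complex" where
  "q12 b x = b 1 2 x * inverse (bexp b x)"

definition q21 :: "(2 \<Rightarrow> 2 \<Rightarrow> real \<Rightarrow> complex) \<Rightarrow> real \<Rightarrow> complex" where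
  "q21 b x = b 2 1 x * bexp b x"


section \<open>The half-planes and the control functions\<close>

definition half_plane_plus :: "real \<Rightarrow> complex set" where
  "half_plane_plus \<kappa> = {\<mu>. Re \<mu> > - \<kappa>}"

definition half_plane_minus :: "real \<Rightarrow> complex set" where
  "half_plane_minus \<kappa> = {\<mu>. Re \<mu> < \<kappa>}"

context
  fixes a :: "2 \<Rightarrow> real \<Rightarrow> real" and b :: "2 \<Rightarrow> 2 \<Rightarrow> real \<Rightarrow> complex"
begin

definition v11 :: "real \<Rightarrow> real \<Rightarrow> complex \<Rightarrow> complex" where
  "v11 s x \<mu> = - integral {max x s..1} (\<lambda>t. q12 b t * exp (- \<mu> * of_real (rho a t - rho a s)))"

definition v12 :: "real \<Rightarrow> real \<Rightarrow> complex \<Rightarrow> complex" where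
  "v12 s x \<mu> = - integral {max x s..1} (\<lambda>t. q12 b t * exp (\<mu> * of_real (rho a x - rho a t)))"

definition v21 :: "real \<Rightarrow> real \<Rightarrow> complex \<Rightarrow> complex" where
  "v21 s x \<mu> = - integral {0..min x s} (\<lambda>t. q21 b t * exp (- \<mu> * of_real (rho a x - rho a t)))"

definition v22 :: "real \<Rightarrow> real \<Rightarrow> complex \<Rightarrow> complex" where
  "v22 s x \<mu> = - integral {0..min x s} (\<lambda>t. q21 b t * exp (\<mu> * of_real (rho a t - rho a s)))"

text \<open>The suprema are maxima, since the integrals depend continuously on \<open>(s, x)\<close>.\<close>

definition Upsilon_plus :: "complex \<Rightarrow> real" where
  "Upsilon_plus \<mu> =
     (SUP (s, x)\<in>{0..1} \<times> {0..1}.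
        Max {cmod (v11 s x \<mu>), cmod (v12 s x \<mu>), cmod (v21 s x \<mu>), cmod (v22 s x \<mu>)})"

definition Upsilon_minus :: "complex \<Rightarrow> real" where
  "Upsilon_minus \<mu> =
     (SUP (s, x)\<in>{0..1} \<times> {0..1}.
        Max {cmod (integral {max x s..1} (\<lambda>t. q21 b t * exp (\<mu> * of_real (rho a t - rho a s)))),
             cmod (integral {max x s..1} (\<lambda>t. q21 b t * exp (- \<mu> * of_real (rho a x - rho a t)))),
             cmod (integral {0..min x s} (\<lambda>t. q12 b t * exp (\<mu> * of_real (rho a x - rho a t)))),
             cmod (integral {0..min x s} (\<lambda>t. q12 b t * exp (- \<mu> * of_real (rho a t - rho a s))))})"


section \<open>The coefficients of the expansion\<close>

definition op_I1 :: "(real \<Rightarrow> complex) \<Rightarrow> real \<Rightarrow> complex" where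
  "op_I1 f x = - integral {x..1} (\<lambda>t. b 1 2 t * inverse (bexp b t) * f t)"

definition op_I2 :: "(real \<Rightarrow> complex) \<Rightarrow> real \<Rightarrow> complex" where
  "op_I2 f x = integral {0..x} (\<lambda>t. b 2 1 t * bexp b t * f t)"

definition op_D :: "(real \<Rightarrow> complex) \<Rightarrow> real \<Rightarrow> complex" where
  "op_D f x = 1 / of_real (adiff a x) * vector_derivative f (at x within {0..1})"

definition op_J1 :: "(real \<Rightarrow> complex) \<Rightarrow> real \<Rightarrow> complex" where
  "op_J1 f x = b 2 1 x * bexp b x / of_real (adiff a x) * op_I1 f x"

definition op_J2 :: "(real \<Rightarrow> complex) \<Rightarrow> real \<Rightarrow> complex" where
  "op_J2 f x = - (b 1 2 x * inverse (bexp b x) / of_real (adiff a x)) * op_I2 f x"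

text \<open>\<open>coef21 m\<close> and \<open>coef12 m\<close> are \<open>r\<^sub>2\<^sub>1\<close> and \<open>r\<^sub>1\<^sub>2\<close> with upper index \<open>m + 1\<close>.\<close>

definition coef21 :: "nat \<Rightarrow> real \<Rightarrow> complex" where
  "coef21 m = ((\<lambda>f x. - op_D f x + op_J1 f x) ^^ m)
                (\<lambda>x. b 2 1 x * bexp b x / of_real (adiff a x))"

definition coef12 :: "nat \<Rightarrow> real \<Rightarrow> complex" where
  "coef12 m = ((\<lambda>f x. op_D f x + op_J2 f x) ^^ m)
                (\<lambda>x. - (b 1 2 x * inverse (bexp b x) / of_real (adiff a x)))"

definition coef_matrix :: "nat \<Rightarrow> real \<Rightarrow> complex^2^2" where
  "coef_matrix m x =
     vector [vector [op_I1 (coef21 (m - 1)) x, coef12 (m - 1) x],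
             vector [coef21 (m - 1) x, op_I2 (coef12 (m - 1)) x]]"


section \<open>The two assertions about a fundamental matrix\<close>

text \<open>
  In \<open>has_representation \<Omega> \<Upsilon> Y R\<close>, ``for sufficiently large \<open>|\<mu>|\<close>'' is expressed by one common radius
  \<open>\<mu>0\<close>, uniform in \<open>x\<close>; the supremum over \<open>x\<close> is the norm of \<open>C[0,1]\<close>.
\<close>

definition has_representation ::
  "complex set \<Rightarrow> (complex \<Rightarrow> real) \<Rightarrow> (real \<Rightarrow> complex \<Rightarrow> complex^2^2)
    \<Rightarrow> (real \<Rightarrow> complex \<Rightarrow> complex^2^2) \<Rightarrow> bool" where
  "has_representation \<Omega> \<Upsilon> Y R \<longleftrightarrow>
     (\<exists>\<mu>0 C0 :: real.
        fundamental_matrix a b {\<mu>\<in>\<Omega>. cmod \<mu> > \<mu>0} Y \<and>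
        (\<forall>\<mu>\<in>\<Omega>. cmod \<mu> > \<mu>0 \<longrightarrow>
           (\<forall>x\<in>{0..1}. Y x \<mu> = matM b x ** (mat 1 + R x \<mu>) ** matE a x \<mu>)) \<and>
        (\<forall>x\<in>{0..1}. \<forall>i j. (\<lambda>\<mu>. R x \<mu> $ i $ j) holomorphic_on {\<mu>\<in>\<Omega>. cmod \<mu> > \<mu>0}) \<and>
        (\<forall>\<mu>\<in>\<Omega>. cmod \<mu> > \<mu>0 \<longrightarrow>
           (\<forall>i j. continuous_on {0..1} (\<lambda>x. R x \<mu> $ i $ j) \<and>
                  (SUP x\<in>{0..1}. cmod (R x \<mu> $ i $ j)) \<le> C0 * \<Upsilon> \<mu>)))"

definition has_expansion ::
  "complex set \<Rightarrow> nat \<Rightarrow> (real \<Rightarrow> complex \<Rightarrow> complex^2^2) \<Rightarrow> bool" where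
  "has_expansion \<Omega> n R \<longleftrightarrow>
     (\<forall>i j. uniform_limit {0..1}
        (\<lambda>\<mu> x. \<mu> ^ n * (R x \<mu> $ i $ j - (\<Sum>m=1..n. coef_matrix m x $ i $ j / \<mu> ^ m)))
        (\<lambda>x. 0) (inf at_infinity (principal \<Omega>)))"

end

definition smooth_coefficients ::
  "nat \<Rightarrow> (2 \<Rightarrow> real \<Rightarrow> real) \<Rightarrow> (2 \<Rightarrow> 2 \<Rightarrow> real \<Rightarrow> complex) \<Rightarrow> bool" where
  "smooth_coefficients n a b \<longleftrightarrow>
     sobolev_W1 n (a 1) \<and> sobolev_W1 n (a 2) \<and> sobolev_W1 n (b 1 2) \<and> sobolev_W1 n (b 2 1) \<and>
     sobolev_W1 (n - 1) (b 1 1) \<and> sobolev_W1 (n - 1) (b 2 2)"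

end

theory Submission
  imports Defs "HOL-Complex_Analysis.Complex_Analysis"
begin

text \<open>
  The substitution \<open>Y = M (I + R) E\<close> decouples the columns of \<open>R\<close>. In each column the diagonal entry \<open>u\<close> and
  the other entry \<open>v\<close> satisfy
  \<open>u' = p v\<close> and \<open>v' = q (1 + u) - z \<alpha> v\<close>,
  where \<open>z\<close> is the spectral parameter and \<open>(p, q, \<alpha>)\<close> is \<open>(q12, q21, a)\<close> in the first column and
  \<open>(q21, q12, - a)\<close> in the second one. So \<open>u\<close> is slow and \<open>v\<close> is driven by a rapidly varying exponential.
  The equation for \<open>v\<close> is solved from the end \<open>c\<close> of \<open>[0,1]\<close> from which that exponential is bounded in the
  half-plane under consideration; this defines the operator \<open>fast z\<close>. The equation for \<open>u\<close> is solved from the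
  point \<open>d\<close> used in \<open>I\<^sub>1\<close> or \<open>I\<^sub>2\<close>.

  Everything rests on a uniform Riemann-Lebesgue lemma: \<open>fast z g\<close> tends to 0 uniformly on \<open>[0,1]\<close> for every
  integrable \<open>g\<close> (\<open>fast_tendsto_0\<close>). It holds because functions \<open>\<alpha> \<phi>\<close> with smooth \<open>\<phi>\<close> are dense
  (\<open>weighted_smooth_dense\<close>), and for them an integration by parts gains \<open>1 / z\<close>. Eliminating \<open>u\<close> leaves the fixed
  point equation \<open>v = fast z g + feedback z v\<close> with \<open>g = q\<close>; an integration by parts bounds the norm of
  \<open>feedback z\<close> by a multiple of the supremum of \<open>fast z q\<close> (\<open>feedback_by_parts\<close>), so for large \<open>z\<close> a Neumann
  series solves it, holomorphically in \<open>z\<close> and with \<open>\<bar>v\<bar> \<le> 2 sup \<bar>fast z q\<bar>\<close> (\<open>coupled_solution_exists\<close>).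
  Up to sign the values of \<open>fast z q\<close> are among the integrals whose supremum is \<open>\<Upsilon>\<close>, which gives the first
  part of the theorem.

  For smooth coefficients the formal series in \<open>1 / z\<close>, truncated after \<open>n\<close> terms, leaves a residual \<open>z\<^sup>-\<^sup>n g\<close> with
  an integrable \<open>g\<close> that does not depend on \<open>z\<close> (\<open>formal_residual\<close>). The correction is \<open>z\<^sup>-\<^sup>n\<close> times a
  solution of the same coupled system and therefore \<open>o(z\<^sup>-\<^sup>n)\<close> (\<open>column_pair_expansion\<close>). This solution is
  \<open>O(1 / z)\<close>, and the required bound by \<open>\<Upsilon>\<close> follows since \<open>\<Upsilon>\<close> is itself at least of order \<open>1 / \<bar>z\<bar>\<close>
  (\<open>fast_lower_bound\<close>), except when both off-diagonal coefficients vanish and \<open>R = 0\<close> is a solution.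

  Absolutely continuous functions are handled through the relation \<open>has_L1_derivative\<close>. Its calculus is derived
  from the two halves of the fundamental theorem of calculus for absolutely continuous functions.
\<close>

section \<open>Absolute continuity and the fundamental theorem of calculus\<close>

text \<open>
  One statement covers sums, products and compositions with Lipschitz maps: in each of these cases the
  increments of \<open>h\<close> are controlled by the increments of two absolutely continuous functions.
\<close>

lemma absolutely_continuous_on_dominated:
  assumes f: "absolutely_continuous_on S f" and g: "absolutely_continuous_on S g"
    and dom: "\<And>u v. u \<in> S \<Longrightarrow> v \<in> S \<Longrightarrow> dist (h u) (h v) \<le> K * (dist (f u) (f v) + dist (g u) (g v))"
  shows "absolutely_continuous_on S h"
  unfolding absolutely_continuous_on_def
proof (intro allI impI)
  fix e :: real assume "e > 0"
  define L where "L = max K 1"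
  have L: "L \<ge> 1" "K \<le> L" by (auto simp: L_def)
  define e' where "e' = e / (2 * L)"
  have e': "e' > 0" using \<open>e > 0\<close> L by (auto simp: e'_def)
  from f[unfolded absolutely_continuous_on_def, rule_format, OF e'] obtain d1 where d1: "d1 > 0"
    "\<And>D. D division_of \<Union>D \<and> \<Union>D \<subseteq> S \<and> (\<Sum>k\<in>D. Sup k - Inf k) < d1
        \<Longrightarrow> (\<Sum>k\<in>D. dist (f (Inf k)) (f (Sup k))) < e'" by blast
  from g[unfolded absolutely_continuous_on_def, rule_format, OF e'] obtain d2 where d2: "d2 > 0"
    "\<And>D. D division_of \<Union>D \<and> \<Union>D \<subseteq> S \<and> (\<Sum>k\<in>D. Sup k - Inf k) < d2
        \<Longrightarrow> (\<Sum>k\<in>D. dist (g (Inf k)) (g (Sup k))) < e'" by blast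
  show "\<exists>d>0. \<forall>D. D division_of \<Union>D \<and> \<Union>D \<subseteq> S \<and> (\<Sum>k\<in>D. Sup k - Inf k) < d
        \<longrightarrow> (\<Sum>k\<in>D. dist (h (Inf k)) (h (Sup k))) < e"
  proof (intro exI[of _ "min d1 d2"] conjI allI impI)
    show "min d1 d2 > 0" using d1 d2 by auto
    fix D assume D: "D division_of \<Union>D \<and> \<Union>D \<subseteq> S \<and> (\<Sum>k\<in>D. Sup k - Inf k) < min d1 d2"
    have "(\<Sum>k\<in>D. dist (h (Inf k)) (h (Sup k))) \<le> 
       (\<Sum>k\<in>D. L * (dist (f (Inf k)) (f (Sup k)) + dist (g (Inf k)) (g (Sup k))))"
    proof (rule sum_mono)
      fix k assume k: "k \<in> D"
      then obtain u v where uv: "k = cbox u v" "k \<noteq> {}"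
        using D division_ofD(3,4) by metis
      have "u \<le> v" using uv by auto
      then have "Inf k \<in> k" "Sup k \<in> k" using uv by (auto simp: interval_bounds_real)
      moreover have "k \<subseteq> S" using D k by blast
      ultimately have "dist (h (Inf k)) (h (Sup k)) \<le> K * (dist (f (Inf k)) (f (Sup k)) + dist (g (Inf k)) (g (Sup k)))"
        using dom by blast
      also have "\<dots> \<le> L * (dist (f (Inf k)) (f (Sup k)) + dist (g (Inf k)) (g (Sup k)))"
        using L by (intro mult_right_mono) auto
      finally show "dist (h (Inf k)) (h (Sup k)) \<le> \<dots>" .
    qed
    also have "\<dots> = L * ((\<Sum>k\<in>D. dist (f (Inf k)) (f (Sup k))) + (\<Sum>k\<in>D. dist (g (Inf k)) (g (Sup k))))"
      by (simp add: sum_distrib_left sum.distrib distrib_left)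
    also have "\<dots> < L * (e' + e')"
      using d1(2)[of D] d2(2)[of D] D L by (intro mult_strict_left_mono add_strict_mono) auto
    also have "\<dots> = e" using L by (auto simp: e'_def)
    finally show "(\<Sum>k\<in>D. dist (h (Inf k)) (h (Sup k))) < e" .
  qed
qed

lemma absolutely_continuous_on_imp_continuous_on:
  fixes f :: "real \<Rightarrow> 'a::metric_space"
  assumes f: "absolutely_continuous_on {a..b} f"
  shows "continuous_on {a..b} f"
  unfolding continuous_on_iff
proof (intro ballI allI impI)
  fix x and e :: real assume x: "x \<in> {a..b}" and "e > 0"
  from f[unfolded absolutely_continuous_on_def, rule_format, OF \<open>e > 0\<close>] obtain d where d: "d > 0"
    "\<And>D. D division_of \<Union>D \<and> \<Union>D \<subseteq> {a..b} \<and> (\<Sum>k\<in>D. Sup k - Inf k) < d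
        \<Longrightarrow> (\<Sum>k\<in>D. dist (f (Inf k)) (f (Sup k))) < e" by blast
  have *: "dist (f u) (f v) < e" if "u \<in> {a..b}" "v \<in> {a..b}" "u \<le> v" "v - u < d" for u v
    using d(2)[of "{cbox u v}"] that division_of_self[of u v] by (auto simp: interval_bounds_real)
  show "\<exists>d>0. \<forall>x'\<in>{a..b}. dist x' x < d \<longrightarrow> dist (f x') (f x) < e"
  proof (intro exI[of _ d] conjI ballI impI d(1))
    fix y assume "y \<in> {a..b}" "dist y x < d"
    then show "dist (f y) (f x) < e"
      using *[of x y] *[of y x] x by (cases "x \<le> y") (auto simp: dist_real_def dist_commute)
  qed
qed

text \<open>
  Truncating \<open>norm \<circ> f\<close> at a height \<open>n\<close> leaves a remainder of small total integral, and the truncated part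
  contributes at most \<open>n\<close> times the total length of the intervals.
\<close>

lemma absolutely_continuous_on_integral:
  fixes f :: "real \<Rightarrow> 'a::euclidean_space"
  assumes f: "f absolutely_integrable_on {a..b}"
  shows "absolutely_continuous_on {a..b} (\<lambda>x. integral {a..x} f)"
  unfolding absolutely_continuous_on_def
proof (intro allI impI)
  fix e :: real assume "e > 0"
  have nf: "(\<lambda>x. norm (f x)) integrable_on {a..b}" "f integrable_on {a..b}"
    using f by (auto simp: absolutely_integrable_on_def)
  have nfa: "(\<lambda>x. norm (f x)) absolutely_integrable_on {a..b}"
    using f by (rule absolutely_integrable_norm[unfolded o_def])
  define g where "g = (\<lambda>n::nat. \<lambda>x. min (norm (f x)) (real n))"
  have gabs: "g n absolutely_integrable_on {a..b}" for n
    unfolding g_def by (intro absolutely_integrable_min_1 nfa) auto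
  then have gi: "g n integrable_on {a..b}" for n by (auto simp: absolutely_integrable_on_def)
  have lim: "(\<lambda>n. g n x) \<longlonglongrightarrow> norm (f x)" for x
  proof (rule tendsto_eventually)
    obtain N :: nat where "norm (f x) \<le> N" using real_arch_simple by blast
    then show "\<forall>\<^sub>F n in sequentially. g n x = norm (f x)"
      unfolding eventually_sequentially g_def by (intro exI[of _ N]) (auto simp: min_def)
  qed
  have "(\<lambda>n. integral {a..b} (g n)) \<longlonglongrightarrow> integral {a..b} (\<lambda>x. norm (f x))"
    by (rule dominated_convergence(2)[OF gi nf(1) _ lim]) (auto simp: g_def)
  from LIMSEQ_D[OF this, of "e/2"] \<open>e > 0\<close> obtain n where
    n: "norm (integral {a..b} (g n) - integral {a..b} (\<lambda>x. norm (f x))) < e/2" by auto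
  show "\<exists>d>0. \<forall>D. D division_of \<Union>D \<and> \<Union>D \<subseteq> {a..b} \<and> (\<Sum>k\<in>D. Sup k - Inf k) < d
        \<longrightarrow> (\<Sum>k\<in>D. dist (integral {a..Inf k} f) (integral {a..Sup k} f)) < e"
  proof (intro exI[of _ "e / (2 * (real n + 1))"] conjI allI impI)
    show "e / (2 * (real n + 1)) > 0" using \<open>e > 0\<close> by auto
    fix D assume D: "D division_of \<Union>D \<and> \<Union>D \<subseteq> {a..b} \<and> (\<Sum>k\<in>D. Sup k - Inf k) < e / (2 * (real n + 1))"
    let ?h = "\<lambda>x. norm (f x) - g n x"
    have hi: "?h integrable_on {a..b}" by (intro integrable_diff nf gi)
    have h0: "?h x \<ge> 0" for x by (auto simp: g_def)
    have hU: "?h integrable_on \<Union>D"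
      using hi D by (metis integrable_on_subdivision)
    have "(\<Sum>k\<in>D. dist (integral {a..Inf k} f) (integral {a..Sup k} f)) \<le>
       (\<Sum>k\<in>D. integral k ?h + real n * (Sup k - Inf k))"
    proof (rule sum_mono)
      fix k assume k: "k \<in> D"
      then obtain u v where uv: "k = cbox u v" "k \<noteq> {}"
        using D division_ofD(3,4) by metis
      have le: "u \<le> v" using uv by auto
      have ks: "{u..v} \<subseteq> {a..b}" using D k uv(1) by (metis Sup_upper box_real(2) order_trans)
      then have ab: "a \<le> u" "v \<le> b" using le by auto
      have sub: "{a..v} \<subseteq> {a..b}" using ab by auto
      note fi = integrable_on_subinterval[OF nf(2) sub] integrable_on_subinterval[OF nf(2) ks]
        integrable_on_subinterval[OF gi[of n] ks] integrable_on_subinterval[OF hi ks]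
        integrable_on_subinterval[OF nf(1) ks]
      have "integral {a..v} f = integral {a..u} f + integral {u..v} f"
        using Henstock_Kurzweil_Integration.integral_combine[OF ab(1) le fi(1)] by simp
      then have "dist (integral {a..u} f) (integral {a..v} f) = norm (integral {u..v} f)"
        by (simp add: dist_norm)
      also have "\<dots> \<le> integral {u..v} (\<lambda>x. norm (f x))"
        by (rule integral_norm_bound_integral) (use fi in auto)
      also have "\<dots> = integral {u..v} ?h + integral {u..v} (g n)"
        using integral_diff[OF fi(5) fi(3)] by simp
      also have "integral {u..v} (g n) \<le> integral {u..v} (\<lambda>x. real n)"
        by (rule integral_le) (use fi in \<open>auto simp: g_def\<close>)
      finally show "dist (integral {a..Inf k} f) (integral {a..Sup k} f) \<le> integral k ?h + real n * (Sup k - Inf k)"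
        using le by (simp add: uv interval_bounds_real mult.commute)
    qed
    also have "\<dots> = (\<Sum>k\<in>D. integral k ?h) + real n * (\<Sum>k\<in>D. Sup k - Inf k)"
      by (simp add: sum.distrib sum_distrib_left)
    also have "(\<Sum>k\<in>D. integral k ?h) = integral (\<Union>D) ?h"
      by (rule integral_combine_division_topdown[OF hU conjunct1[OF D], symmetric])
    also have "\<dots> \<le> integral {a..b} ?h"
      by (rule integral_subset_le) (use D hi hU h0 in auto)
    also have "\<dots> = integral {a..b} (\<lambda>x. norm (f x)) - integral {a..b} (g n)"
      by (rule integral_diff[OF nf(1) gi])
    also have "\<dots> < e / 2" using n by (simp add: abs_if split: if_splits)
    also have "real n * (\<Sum>k\<in>D. Sup k - Inf k) \<le> real n * (e / (2 * (real n + 1)))"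
      using D by (intro mult_left_mono) auto
    also have "\<dots> \<le> e / 2" using \<open>e > 0\<close> by (simp add: field_simps)
    finally show "(\<Sum>k\<in>D. dist (integral {a..Inf k} f) (integral {a..Sup k} f)) < e" by simp
  qed
qed

text \<open>
  Off the exceptional null set \<open>N\<close> the gauge comes from differentiability, as in the classical fundamental
  theorem. On \<open>N\<close> the integrand is replaced by 0, and the intervals with tags in \<open>N\<close> are confined to an open
  set whose measure is below the tolerance of absolute continuity, so that the increments of \<open>F\<close> over
  them have a small sum.
\<close>

lemma has_integral_AE_derivative:
  fixes F :: "real \<Rightarrow> 'a::euclidean_space"
  assumes "a \<le> b" and AC: "absolutely_continuous_on {a..b} F"
    and der: "AE x in lebesgue_on {a..b}. (F has_vector_derivative f x) (at x within {a..b})"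
  shows "(f has_integral (F b - F a)) {a..b}"
proof -
  have "AE x in lebesgue. x \<in> {a..b} \<longrightarrow> (F has_vector_derivative f x) (at x within {a..b})"
    using der by (subst (asm) AE_restrict_space_iff) auto
  then obtain N where N: "negligible N" "{x. \<not> (x \<in> {a..b} \<longrightarrow> (F has_vector_derivative f x) (at x within {a..b}))} \<subseteq> N"
    unfolding eventually_ae_filter_negligible by blast
  have vecd: "(F has_vector_derivative f x) (at x within {a..b})" if "x \<in> {a..b}" "x \<notin> N" for x
    using N(2) that by blast
  define f0 where "f0 = (\<lambda>x. if x \<in> N then 0 else f x)"
  have "(f0 has_integral (F b - F a)) {a..b}"
    unfolding has_integral_real
  proof (intro allI impI)
    fix e :: real assume "e > 0"
    define e1 where "e1 = e / (2 * (b - a + 1))"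
    have e1: "e1 > 0" using \<open>e > 0\<close> \<open>a \<le> b\<close> by (auto simp: e1_def)
    from AC[unfolded absolutely_continuous_on_def, rule_format, of "e/2"] \<open>e > 0\<close>
    obtain \<delta> where \<delta>: "\<delta> > 0"
      "\<And>D. D division_of \<Union>D \<and> \<Union>D \<subseteq> {a..b} \<and> (\<Sum>k\<in>D. Sup k - Inf k) < \<delta>
        \<Longrightarrow> (\<Sum>k\<in>D. dist (F (Inf k)) (F (Sup k))) < e/2" by fastforce
    obtain T where T: "open T" "N \<subseteq> T" "(T - N) \<in> lmeasurable" "emeasure lebesgue (T - N) < ennreal \<delta>"
      using sets_lebesgue_outer_open[of N \<delta>] N(1) \<delta>(1) negligible_imp_sets by blast
    have Tm: "T \<in> lmeasurable" "measure lebesgue T < \<delta>"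
    proof -
      have T_eq: "T = (T - N) \<union> N" using T by blast
      show "T \<in> lmeasurable"
        using T(3) N(1) T_eq fmeasurable.Un negligible_imp_measurable by metis
      have "measure lebesgue T = measure lebesgue (T - N)"
        by (rule measure_negligible_symdiff) (use T N in \<open>auto intro: negligible_subset fmeasurableD\<close>)
      also have "\<dots> < \<delta>"
        using T(3,4) \<delta>(1) by (simp add: emeasure_eq_measure2 ennreal_less_iff)
      finally show "measure lebesgue T < \<delta>" .
    qed
    have "\<forall>x. \<exists>d>0. x \<in> {a..b} - N \<longrightarrow>
         (\<forall>y\<in>{a..b}. norm (y-x) < d \<longrightarrow> norm (F y - F x - (y-x) *\<^sub>R f x) \<le> e1 * norm (y-x))"
      using vecd[unfolded has_vector_derivative_def has_derivative_within_alt] e1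
      by (metis DiffD1 DiffD2 zero_less_one)
    then obtain d where d: "\<And>x. 0 < d x"
                 "\<And>x y. \<lbrakk>x \<in> {a..b} - N; y \<in> {a..b}; norm (y-x) < d x\<rbrakk>
                        \<Longrightarrow> norm (F y - F x - (y-x) *\<^sub>R f x) \<le> e1 * norm (y-x)"
      by metis
    define \<gamma> where "\<gamma> = (\<lambda>x. if x \<in> N then T else ball x (d x))"
    show "\<exists>\<gamma>. gauge \<gamma> \<and> (\<forall>\<D>. \<D> tagged_division_of {a..b} \<and> \<gamma> fine \<D> \<longrightarrow>
        norm ((\<Sum>(x,k)\<in>\<D>. measure lborel k *\<^sub>R f0 x) - (F b - F a)) < e)"
    proof (intro exI[of _ \<gamma>] conjI allI impI)
      show "gauge \<gamma>" using d(1) T by (auto simp: gauge_def \<gamma>_def)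
      fix p assume p: "p tagged_division_of {a..b} \<and> \<gamma> fine p"
      then have ptag: "p tagged_division_of {a..b}" and finep: "\<gamma> fine p" by auto
      have fin: "finite p" using ptag by blast
      have ba: "b - a = (\<Sum>(x,K)\<in>p. Sup K - Inf K)" "F b - F a = (\<Sum>(x,K)\<in>p. F (Sup K) - F (Inf K))"
        using additive_tagged_division_1[where f= "\<lambda>x. x"] additive_tagged_division_1[where f= F]
            \<open>a \<le> b\<close> ptag by auto
      have shape: "\<exists>u v. K = {u..v} \<and> u \<le> v \<and> x \<in> {u..v} \<and> {u..v} \<subseteq> {a..b}" if xK: "(x,K) \<in> p" for x K
      proof -
        obtain u v where "K = cbox u v" using tagged_division_ofD(4)[OF ptag xK] by blast
        moreover have "x \<in> K" "K \<subseteq> {a..b}" using ptag xK by auto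
        ultimately show ?thesis by (intro exI[of _ u] exI[of _ v]) auto
      qed
      define q where "q = {(x,K) \<in> p. x \<in> N}"
      have qp: "q \<subseteq> p" by (auto simp: q_def)
      have qt: "q tagged_division_of (\<Union>(snd ` q))"
        by (rule tagged_partial_division_of_Union_self, rule tagged_partial_division_subset[OF _ qp])
           (use ptag tagged_division_of_def in blast)
      then have qd: "(snd ` q) division_of (\<Union>(snd ` q))"
        by (rule division_of_tagged_division)
      have qT: "\<Union>(snd ` q) \<subseteq> T"
        using finep by (fastforce simp: q_def fine_def \<gamma>_def)
      have qab: "\<Union>(snd ` q) \<subseteq> {a..b}" using shape qp by fastforce
      have box1: "Sup (cbox u v) - Inf (cbox u v) = measure lborel (cbox u v)" if "cbox u v \<noteq> {}" for u v :: real
        using that by (auto simp: interval_bounds_real)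
      have "(\<Sum>K\<in>snd ` q. Sup K - Inf K) = (\<Sum>K\<in>snd ` q. measure lebesgue K)"
      proof (rule sum.cong[OF refl])
        fix K assume K: "K \<in> snd ` q"
        then obtain u v where uv: "K = cbox u v" using division_ofD(4)[OF qd] by blast
        have "K \<noteq> {}" using division_ofD(3)[OF qd K] .
        then show "Sup K - Inf K = measure lebesgue K"
          using box1[of u v] unfolding uv by simp
      qed
      also have "\<dots> = measure lebesgue (\<Union>(snd ` q))"
        using content_division[OF qd] by simp
      also have "\<dots> \<le> measure lebesgue T"
        by (rule measure_mono_fmeasurable[OF qT _ Tm(1)])
           (use qd lmeasurable_division in blast)
      finally have small: "(\<Sum>K\<in>snd ` q. Sup K - Inf K) < \<delta>" using Tm by simp
      \<comment> \<open>\<open>Inf {}\<close> and \<open>Sup {}\<close> are unrelated reals, so the empty interval is given the value 0 explicitly.\<close>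
      define dF where "dF = (\<lambda>K. if K = {} then 0 else dist (F (Inf K)) (F (Sup K)))"
      have "(\<Sum>(x,K)\<in>q. dist (F (Inf K)) (F (Sup K))) = (\<Sum>(_,K)\<in>q. dF K)"
      proof (rule sum.cong[OF refl], clarify)
        fix x K assume "(x, K) \<in> q"
        then have "K \<in> snd ` q" by force
        then have "K \<noteq> {}" by (rule division_ofD(3)[OF qd])
        then show "dist (F (Inf K)) (F (Sup K)) = dF K" by (simp add: dF_def)
      qed
      also have "\<dots> = (\<Sum>K\<in>snd ` q. dF K)"
      proof (rule sum.over_tagged_division_lemma[OF qt])
        fix u v :: real assume "box u v = {}"
        then have "v \<le> u" by simp
        then show "dF (cbox u v) = 0" 
          by (cases "u = v") (auto simp: dF_def)
      qed
      also have "\<dots> = (\<Sum>K\<in>snd ` q. dist (F (Inf K)) (F (Sup K)))"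
      proof (rule sum.cong[OF refl])
        fix K assume "K \<in> snd ` q"
        then have "K \<noteq> {}" by (rule division_ofD(3)[OF qd])
        then show "dF K = dist (F (Inf K)) (F (Sup K))" by (simp add: dF_def)
      qed
      also have "\<dots> < e / 2" using \<delta>(2)[of "snd ` q"] qd qab small by blast
      finally have qs: "(\<Sum>(x,K)\<in>q. dist (F (Inf K)) (F (Sup K))) < e/2" .
      have "norm (\<Sum>(x, K) \<in> p. (measure lborel K *\<^sub>R f0 x) - (F(Sup K) - F(Inf K)))
          \<le> (\<Sum>(x,K)\<in>p. e1 * (Sup K - Inf K) + (if x \<in> N then dist (F (Inf K)) (F (Sup K)) else 0))"
      proof (rule sum_norm_le, safe)
        fix x K assume xK: "(x, K) \<in> p"
        then obtain u v where K: "K = {u..v}" "u \<le> v" "x \<in> {u..v}" "{u..v} \<subseteq> {a..b}" using shape by blast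
        show "norm (measure lborel K *\<^sub>R f0 x - (F (Sup K) - F (Inf K))) \<le> e1 * (Sup K - Inf K) + (if x \<in> N then dist (F (Inf K)) (F (Sup K)) else 0)"
        proof (cases "x \<in> N")
          case True
          then show ?thesis using K e1 by (simp add: f0_def dist_norm norm_minus_commute)
        next
          case False
          have ball: "\<forall>y\<in>K. y \<in> ball x (d x)"
            using finep xK False by (fastforce simp: fine_def \<gamma>_def)
          have "u \<in> K" "v \<in> K" using K by auto
          have "norm ((v - u) *\<^sub>R f x - (F v - F u)) = norm (F u - F x - (u - x) *\<^sub>R f x - (F v - F x - (v - x) *\<^sub>R f x))"
            by (auto simp: algebra_simps)
          also have "\<dots> \<le> norm (F u - F x - (u - x) *\<^sub>R f x) + norm (F v - F x - (v - x) *\<^sub>R f x)"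
            by (rule norm_triangle_ineq4)
          also have "\<dots> \<le> e1 * norm (u - x) + e1 * norm (v - x)"
          proof (rule add_mono)
            show "norm (F u - F x - (u - x) *\<^sub>R f x) \<le> e1 * norm (u - x)"
              using ball[rule_format, OF \<open>u \<in> K\<close>] K False by (intro d) (auto simp: dist_real_def)
            show "norm (F v - F x - (v - x) *\<^sub>R f x) \<le> e1 * norm (v - x)"
              using ball[rule_format, OF \<open>v \<in> K\<close>] K False by (intro d) (auto simp: dist_real_def)
          qed
          also have "\<dots> = e1 * (Sup K - Inf K)"
            using K by (auto simp: algebra_simps)
          finally show ?thesis using K False by (simp add: f0_def)
        qed
      qed
      also have "\<dots> = e1 * (\<Sum>(x,K)\<in>p. Sup K - Inf K) + (\<Sum>(x,K)\<in>p. (if x \<in> N then dist (F (Inf K)) (F (Sup K)) else 0))"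
        by (simp add: sum.distrib sum_distrib_left case_prod_unfold)
      also have "(\<Sum>(x,K)\<in>p. (if x \<in> N then dist (F (Inf K)) (F (Sup K)) else 0)) = (\<Sum>(x,K)\<in>q. dist (F (Inf K)) (F (Sup K)))"
        using fin unfolding q_def by (intro sum.mono_neutral_cong_right) (auto split: if_splits)
      also have "e1 * (\<Sum>(x,K)\<in>p. Sup K - Inf K) \<le> e / 2"
        using \<open>e > 0\<close> \<open>a \<le> b\<close> unfolding ba(1)[symmetric] e1_def by (simp add: field_simps)
      also note qs
      finally have "norm (\<Sum>(x, K) \<in> p. (measure lborel K *\<^sub>R f0 x) - (F(Sup K) - F(Inf K))) < e" by simp
      then show "norm ((\<Sum>(x,k)\<in>p. measure lborel k *\<^sub>R f0 x) - (F b - F a)) < e"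
        unfolding ba(2) by (simp add: sum_subtractf[symmetric] case_prod_unfold)
    qed
  qed
  then show ?thesis
    by (rule has_integral_spike[OF N(1), rotated]) (auto simp: f0_def)
qed


text \<open>
  The averages of \<open>g\<close> over the intervals \<open>[x, x + h]\<close> converge to \<open>g x\<close> for almost every \<open>x\<close>. This is the
  right-hand derivative; the left-hand one is the same statement for \<open>\<lambda>x. g (- x)\<close>.
\<close>

lemma AE_has_vector_derivative_integral:
  fixes f :: "real \<Rightarrow> 'a::euclidean_space"
  assumes f: "f absolutely_integrable_on {a..b}"
  shows "AE x in lebesgue_on {a..b}.
           ((\<lambda>x. integral {a..x} f) has_vector_derivative f x) (at x within {a..b})"
proof -
  define g where "g = (\<lambda>x. if x \<in> {a..b} then f x else 0)"
  have fi: "f integrable_on {a..b}" using f by (auto simp: absolutely_integrable_on_def)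
  have gi: "g integrable_on cbox u v" for u v
    unfolding g_def by (rule integrable_altD(1)[OF fi])
  have "(\<lambda>x. g (- x)) integrable_on cbox u v" for u v
    using gi[of "-v" "-u"] integrable_reflect[of g "-u" "-v"] by simp
  then have gri: "\<And>u v. (\<lambda>x. g (- x)) integrable_on cbox u v" .
  obtain N1 where N1: "negligible N1" "\<And>x e. \<lbrakk>x \<notin> N1; 0 < e\<rbrakk> \<Longrightarrow>
      \<exists>d>0. \<forall>h. 0 < h \<and> h < d \<longrightarrow> norm (integral (cbox x (x + h *\<^sub>R One)) g /\<^sub>R h ^ DIM(real) - g x) < e"
    by (rule integrable_ccontinuous_explicit[OF gi]) blast
  obtain N2 where N2: "negligible N2" "\<And>x e. \<lbrakk>x \<notin> N2; 0 < e\<rbrakk> \<Longrightarrow>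
      \<exists>d>0. \<forall>h. 0 < h \<and> h < d \<longrightarrow> norm (integral (cbox x (x + h *\<^sub>R One)) (\<lambda>x. g (- x)) /\<^sub>R h ^ DIM(real) - g (- x)) < e"
    by (rule integrable_ccontinuous_explicit[OF gri]) blast
  have "negligible (uminus ` N2)"
    by (rule negligible_differentiable_image_negligible[OF _ N2(1)])
       (auto simp: differentiable_on_def intro!: derivative_intros)
  then have neg: "negligible (N1 \<union> uminus ` N2)" using N1 by auto
  have diff: "integral {a..y} f - integral {a..x} f = integral {x..y} g" if "a \<le> x" "x \<le> y" "y \<le> b" for x y
  proof -
    have "integral {a..x} f + integral {x..y} f = integral {a..y} f"
      by (rule Henstock_Kurzweil_Integration.integral_combine) (use that fi in \<open>auto intro: integrable_on_subinterval\<close>)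
    moreover have "integral {x..y} f = integral {x..y} g"
      by (rule integral_cong) (use that in \<open>auto simp: g_def\<close>)
    ultimately show ?thesis by (simp add: algebra_simps)
  qed
  have der: "((\<lambda>x. integral {a..x} f) has_vector_derivative f x) (at x within {a..b})"
    if x: "x \<in> {a..b}" "x \<notin> N1 \<union> uminus ` N2" for x
    unfolding has_vector_derivative_def has_derivative_within_alt
  proof (intro conjI allI impI)
    fix e :: real assume "e > 0"
    have "- x \<notin> N2" using x by force
    then obtain d2 where d2: "d2 > 0" "\<And>h. 0 < h \<Longrightarrow> h < d2 \<Longrightarrow> norm (integral {-x..-x+h} (\<lambda>x. g (- x)) /\<^sub>R h - g x) < e"
      using N2(2)[of "-x" e] \<open>e > 0\<close> by (auto simp: )
    have "x \<notin> N1" using x by auto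
    then obtain d1 where d1: "d1 > 0" "\<And>h. 0 < h \<Longrightarrow> h < d1 \<Longrightarrow> norm (integral {x..x+h} g /\<^sub>R h - g x) < e"
      using N1(2)[of x e] \<open>e > 0\<close> by auto
    have gx: "g x = f x" using x by (auto simp: g_def)
    have scale: "norm (I - h *\<^sub>R z) \<le> e * h" if "h > 0" "norm (I /\<^sub>R h - z) < e" for I z :: 'a and h
    proof -
      have "I - h *\<^sub>R z = h *\<^sub>R (I /\<^sub>R h - z)" using that by (simp add: scaleR_diff_right)
      then have "norm (I - h *\<^sub>R z) = h * norm (I /\<^sub>R h - z)" using that by simp
      then show ?thesis using that by (simp add: mult.commute)
    qed
    show "\<exists>d>0. \<forall>y\<in>{a..b}. norm (y - x) < d \<longrightarrow>
        norm (integral {a..y} f - integral {a..x} f - (y - x) *\<^sub>R f x) \<le> e * norm (y - x)"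
    proof (intro exI[of _ "min d1 d2"] conjI ballI impI)
      show "min d1 d2 > 0" using d1 d2 by auto
      fix y assume y: "y \<in> {a..b}" "norm (y - x) < min d1 d2"
      consider "y = x" | "y > x" | "y < x" by linarith
      then show "norm (integral {a..y} f - integral {a..x} f - (y - x) *\<^sub>R f x) \<le> e * norm (y - x)"
      proof cases
        case 2
        have "norm (integral {x..y} g - (y - x) *\<^sub>R g x) \<le> e * (y - x)"
          by (rule scale) (use d1(2)[of "y - x"] 2 y in auto)
        then show ?thesis using diff[of x y] 2 x y gx by simp
      next
        case 3
        have "norm (integral {-x..-y} (\<lambda>x. g (- x)) - (x - y) *\<^sub>R g x) \<le> e * (x - y)"
          by (rule scale) (use d2(2)[of "x - y"] 3 y in auto)
        then have *: "norm (integral {y..x} g - (x - y) *\<^sub>R f x) \<le> e * (x - y)"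
          using Henstock_Kurzweil_Integration.integral_reflect_real[of x y g] gx by simp
        have "integral {a..y} f - integral {a..x} f = - integral {y..x} g"
          using diff[of y x] 3 x y by (simp add: algebra_simps)
        then have "integral {a..y} f - integral {a..x} f - (y - x) *\<^sub>R f x = - (integral {y..x} g - (x - y) *\<^sub>R f x)"
          by (simp add: algebra_simps)
        then show ?thesis using * 3 by (simp add: norm_minus_commute)
      qed auto
    qed
  qed (auto intro: bounded_linear_scaleR_left)
  show ?thesis
    by (subst AE_restrict_space_iff, simp, subst eventually_ae_filter_negligible)
       (use neg der in blast)
qed

section \<open>Calculus of functions with integrable derivative\<close>

text \<open>
  Absolute continuity on \<open>[0,1]\<close> with almost everywhere derivative \<open>f'\<close>, in the integral form,
  which is what integral operators produce. The lemmas \<open>L1D_AC\<close>, \<open>L1D_AE\<close> and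
  \<open>L1D_of_AE_derivative\<close> show that the two descriptions agree.
\<close>

definition has_L1_derivative :: "(real \<Rightarrow> 'a::euclidean_space) \<Rightarrow> (real \<Rightarrow> 'a) \<Rightarrow> bool"
    (infix \<open>has'_L1'_derivative\<close> 50) where
  "f has_L1_derivative f' \<longleftrightarrow> f' absolutely_integrable_on {0..1} \<and>
     (\<forall>x\<in>{0..1}. (f' has_integral (f x - f 0)) {0..x})"

lemma absolutely_continuous_on_subset:
  assumes "absolutely_continuous_on S f" "T \<subseteq> S"
  shows "absolutely_continuous_on T f"
  using assms unfolding absolutely_continuous_on_def by (meson order_trans)

lemma absint_subinterval:
  fixes f :: "real \<Rightarrow> 'a::euclidean_space"
  assumes "f absolutely_integrable_on {0..1}" "0 \<le> u" "v \<le> 1"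
  shows "f integrable_on {u..v}" "(\<lambda>x. norm (f x)) integrable_on {u..v}"
  using assms absolutely_integrable_on_subinterval[OF assms(1), of u v]
  by (auto simp: absolutely_integrable_on_def)

lemma L1D_integral:
  assumes "f absolutely_integrable_on {0..1}"
  shows "(\<lambda>x. integral {0..x} f) has_L1_derivative f"
  using assms absint_subinterval(1)[OF assms, of 0] by (simp add: has_L1_derivative_def integrable_integral)

lemma L1D_eq:
  assumes "f has_L1_derivative f'" "x \<in> {0..1}"
  shows "f x = f 0 + integral {0..x} f'"
proof -
  have "(f' has_integral (f x - f 0)) {0..x}" using assms by (simp add: has_L1_derivative_def)
  then have "integral {0..x} f' = f x - f 0" by (rule integral_unique)
  then show ?thesis by (simp add: algebra_simps)
qed

lemma L1D_AC:
  assumes "f has_L1_derivative f'"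
  shows "absolutely_continuous_on {0..1} f"
proof (rule absolutely_continuous_on_dominated[where K = 1])
  have "absolutely_continuous_on {0..1} (\<lambda>x. integral {0..x} f')"
    using assms by (intro absolutely_continuous_on_integral) (auto simp: has_L1_derivative_def)
  then show "absolutely_continuous_on {0..1} (\<lambda>x. integral {0..x} f')"
    and "absolutely_continuous_on {0..1} (\<lambda>x. integral {0..x} f')" by -
  show "dist (f u) (f v) \<le> 1 * (dist (integral {0..u} f') (integral {0..v} f') + dist (integral {0..u} f') (integral {0..v} f'))"
    if "u \<in> {0..1}" "v \<in> {0..1}" for u v
  proof -
    have "dist (f u) (f v) = dist (integral {0..u} f') (integral {0..v} f')"
      by (simp only: L1D_eq[OF assms that(1)] L1D_eq[OF assms that(2)] dist_norm add_diff_cancel_left)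
    then show ?thesis by (simp only: mult_1_left le_add_same_cancel1 zero_le_dist)
  qed
qed

lemma L1D_continuous: "f has_L1_derivative f' \<Longrightarrow> continuous_on {0..1} f"
  using L1D_AC absolutely_continuous_on_imp_continuous_on by blast

lemma L1D_absint: "f has_L1_derivative f' \<Longrightarrow> f' absolutely_integrable_on {0..1}"
  by (simp add: has_L1_derivative_def)

lemma L1D_AE:
  assumes "f has_L1_derivative f'"
  shows "AE x in lebesgue_on {0..1}. (f has_vector_derivative f' x) (at x within {0..1})"
proof -
  have "AE x in lebesgue_on {0..1}. ((\<lambda>x. integral {0..x} f') has_vector_derivative f' x) (at x within {0..1})"
    using assms by (intro AE_has_vector_derivative_integral) (auto simp: has_L1_derivative_def)
  moreover have "AE x in lebesgue_on {0..1::real}. x \<in> {0..1}" by (simp add: AE_restrict_space_iff)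
  ultimately show ?thesis
  proof eventually_elim
    case (elim x)
    from has_vector_derivative_add[OF has_vector_derivative_const[of "f 0"] elim(1)]
    have *: "((\<lambda>x. f 0 + integral {0..x} f') has_vector_derivative f' x) (at x within {0..1})" by simp
    show ?case
      by (rule has_vector_derivative_transform[OF elim(2) _ *]) (rule L1D_eq[OF assms])
  qed
qed

lemma L1D_of_AE_derivative:
  assumes AC: "absolutely_continuous_on {0..1} f" and i: "f' absolutely_integrable_on {0..1}"
    and der: "AE x in lebesgue_on {0..1}. (f has_vector_derivative f' x) (at x within {0..1})"
  shows "f has_L1_derivative f'"
  unfolding has_L1_derivative_def
proof (intro conjI ballI i)
  fix x :: real assume x: "x \<in> {0..1}"
  show "(f' has_integral f x - f 0) {0..x}"
  proof (rule has_integral_AE_derivative)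
    show "absolutely_continuous_on {0..x} f"
      using x by (intro absolutely_continuous_on_subset[OF AC]) auto
    have "AE y in lebesgue. y \<in> {0..1} \<longrightarrow> (f has_vector_derivative f' y) (at y within {0..1})"
      using der by (subst (asm) AE_restrict_space_iff) auto
    then show "AE y in lebesgue_on {0..x}. (f has_vector_derivative f' y) (at y within {0..x})"
      using x by (subst AE_restrict_space_iff) (auto elim!: eventually_mono intro: has_vector_derivative_within_subset)
  qed (use x in auto)
qed

lemma L1D_cong:
  assumes "f has_L1_derivative f'" "\<And>x. x \<in> {0..1} \<Longrightarrow> g x = f x" "\<And>x. x \<in> {0..1} \<Longrightarrow> g' x = f' x"
  shows "g has_L1_derivative g'"
  unfolding has_L1_derivative_def
proof (intro conjI ballI)
  show "g' absolutely_integrable_on {0..1}"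
    using assms(3) L1D_absint[OF assms(1)] set_integrable_cong[of lebesgue lebesgue "{0..1}" "{0..1}" g' f'] by simp
  fix x :: real assume x: "x \<in> {0..1}"
  have "(f' has_integral (f x - f 0)) {0..x}" using assms(1) x by (auto simp: has_L1_derivative_def)
  then show "(g' has_integral g x - g 0) {0..x}"
    using assms(2)[OF x] assms(2)[of 0] assms(3) x
    by (subst has_integral_cong[of _ g' f']) auto
qed

lemma L1D_const: "(\<lambda>x. c) has_L1_derivative (\<lambda>x. 0)"
  by (auto simp: has_L1_derivative_def)

lemma L1D_linear:
  assumes f: "f has_L1_derivative f'" and T: "bounded_linear T"
  shows "(\<lambda>x. T (f x)) has_L1_derivative (\<lambda>x. T (f' x))"
  unfolding has_L1_derivative_def
proof (intro conjI ballI)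
  interpret bounded_linear T by (rule T)
  show "(\<lambda>x. T (f' x)) absolutely_integrable_on {0..1}"
    using absolutely_integrable_linear[OF L1D_absint[OF f] T] by (simp add: o_def)
  fix x :: real assume "x \<in> {0..1}"
  then have "(f' has_integral (f x - f 0)) {0..x}" using f by (simp add: has_L1_derivative_def)
  from has_integral_linear[OF this T]
  show "((\<lambda>x. T (f' x)) has_integral T (f x) - T (f 0)) {0..x}" by (simp add: o_def diff)
qed

lemma L1D_add:
  assumes f: "f has_L1_derivative f'" and g: "g has_L1_derivative g'"
  shows "(\<lambda>x. f x + g x) has_L1_derivative (\<lambda>x. f' x + g' x)"
  unfolding has_L1_derivative_def
proof (intro conjI ballI)
  show "(\<lambda>x. f' x + g' x) absolutely_integrable_on {0..1}"
    by (rule set_integral_add(1)[OF L1D_absint[OF f] L1D_absint[OF g]])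
  fix x :: real assume "x \<in> {0..1}"
  then have "(f' has_integral (f x - f 0)) {0..x}" "(g' has_integral (g x - g 0)) {0..x}"
    using f g by (simp_all add: has_L1_derivative_def)
  from has_integral_add[OF this]
  show "((\<lambda>x. f' x + g' x) has_integral f x + g x - (f 0 + g 0)) {0..x}" by (simp add: algebra_simps)
qed

lemma absint_continuous_mult:
  fixes a b :: real and f g :: "real \<Rightarrow> complex"
  assumes "continuous_on {a..b} f" "g absolutely_integrable_on {a..b}"
  shows "(\<lambda>x. f x * g x) absolutely_integrable_on {a..b}"
    and "(\<lambda>x. g x * f x) absolutely_integrable_on {a..b}"
proof -
  have bdd: "bounded (f ` {a..b})"
    using assms(1) compact_continuous_image compact_imp_bounded by blast
  have meas: "f \<in> borel_measurable (lebesgue_on {a..b})"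
    using assms(1) by (intro continuous_imp_measurable_on_sets_lebesgue) auto
  have bil: "bilinear ((*) :: complex \<Rightarrow> complex \<Rightarrow> complex)"
    by (simp add: bilinear_times)
  show 1: "(\<lambda>x. f x * g x) absolutely_integrable_on {a..b}"
    by (rule absolutely_integrable_bounded_measurable_product[OF bil meas _ bdd assms(2)]) simp
  show "(\<lambda>x. g x * f x) absolutely_integrable_on {a..b}"
    using 1 by (simp only: mult.commute)
qed

text \<open>
  This is integration by parts for absolutely continuous functions. It is obtained from the pointwise
  product rule, which holds almost everywhere, because the product is absolutely continuous.
\<close>

lemma L1D_mult:
  fixes f g :: "real \<Rightarrow> complex"
  assumes f: "f has_L1_derivative f'" and g: "g has_L1_derivative g'"
  shows "(\<lambda>x. f x * g x) has_L1_derivative (\<lambda>x. f' x * g x + f x * g' x)"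
proof (rule L1D_of_AE_derivative)
  have cf: "continuous_on {0..1} f" "continuous_on {0..1} g" using f g L1D_continuous by auto
  have "bounded (f ` {0..1})" "bounded (g ` {0..1})"
    using cf compact_continuous_image compact_imp_bounded by blast+
  then obtain A B where A: "\<And>x. x \<in> {0..1} \<Longrightarrow> norm (f x) \<le> A" and B: "\<And>x. x \<in> {0..1} \<Longrightarrow> norm (g x) \<le> B"
    unfolding bounded_iff by blast
  show "absolutely_continuous_on {0..1} (\<lambda>x. f x * g x)"
  proof (rule absolutely_continuous_on_dominated[OF L1D_AC[OF f] L1D_AC[OF g], where K = "max A B"])
    fix u v :: real assume uv: "u \<in> {0..1}" "v \<in> {0..1}"
    have "f u * g u - f v * g v = (f u - f v) * g u + f v * (g u - g v)" by (simp add: algebra_simps)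
    then have "norm (f u * g u - f v * g v) \<le> norm (f u - f v) * norm (g u) + norm (f v) * norm (g u - g v)"
      by (metis norm_mult norm_triangle_ineq)
    also have "\<dots> \<le> norm (f u - f v) * max A B + max A B * norm (g u - g v)"
      using A[OF uv(2)] B[OF uv(1)] by (intro add_mono mult_left_mono mult_right_mono) auto
    finally show "dist (f u * g u) (f v * g v) \<le> max A B * (dist (f u) (f v) + dist (g u) (g v))"
      by (simp add: dist_norm algebra_simps)
  qed
  show "(\<lambda>x. f' x * g x + f x * g' x) absolutely_integrable_on {0..1}"
    using absint_continuous_mult[OF cf(2) L1D_absint[OF f]] absint_continuous_mult[OF cf(1) L1D_absint[OF g]]
    by (intro set_integral_add(1)) auto
  show "AE x in lebesgue_on {0..1}. ((\<lambda>x. f x * g x) has_vector_derivative f' x * g x + f x * g' x) (at x within {0..1})"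
    using L1D_AE[OF f] L1D_AE[OF g]
  proof eventually_elim
    case (elim x)
    from has_vector_derivative_mult[OF elim] show ?case by (simp only: add.commute)
  qed
qed

lemma L1D_cmult:
  fixes f :: "real \<Rightarrow> complex"
  shows "f has_L1_derivative f' \<Longrightarrow> (\<lambda>x. c * f x) has_L1_derivative (\<lambda>x. c * f' x)"
  by (rule L1D_linear) (auto intro: bounded_linear_mult_right)

lemma L1D_compose:
  fixes f :: "real \<Rightarrow> complex"
  assumes f: "f has_L1_derivative f'"
    and lip: "\<And>u v. u \<in> {0..1} \<Longrightarrow> v \<in> {0..1} \<Longrightarrow> norm (g (f u) - g (f v)) \<le> K * norm (f u - f v)"
    and der: "\<And>x. x \<in> {0..1} \<Longrightarrow> (g has_field_derivative g' x) (at (f x))"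
    and cont: "continuous_on {0..1} g'"
  shows "(\<lambda>x. g (f x)) has_L1_derivative (\<lambda>x. g' x * f' x)"
proof (rule L1D_of_AE_derivative)
  show "absolutely_continuous_on {0..1} (\<lambda>x. g (f x))"
  proof (rule absolutely_continuous_on_dominated[OF L1D_AC[OF f] L1D_AC[OF f], where K = K])
    fix u v :: real assume uv: "u \<in> {0..1}" "v \<in> {0..1}"
    have "0 \<le> K * norm (f u - f v)" using lip[OF uv] norm_ge_zero order_trans by blast
    then show "dist (g (f u)) (g (f v)) \<le> K * (dist (f u) (f v) + dist (f u) (f v))"
      using lip[OF uv] by (simp add: dist_norm)
  qed
  show "(\<lambda>x. g' x * f' x) absolutely_integrable_on {0..1}"
    by (rule absint_continuous_mult(1)[OF cont L1D_absint[OF f]])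
  have "AE x in lebesgue_on {0..1::real}. x \<in> {0..1}" by (simp add: AE_restrict_space_iff)
  then show "AE x in lebesgue_on {0..1}. ((\<lambda>x. g (f x)) has_vector_derivative g' x * f' x) (at x within {0..1})"
    using L1D_AE[OF f]
  proof eventually_elim
    case (elim x)
    from field_vector_diff_chain_within[OF elim(2) has_field_derivative_at_within[OF der[OF elim(1)]]]
    show ?case by (simp only: o_def mult.commute)
  qed
qed

lemma L1D_exp:
  fixes f :: "real \<Rightarrow> complex"
  assumes f: "f has_L1_derivative f'"
  shows "(\<lambda>x. exp (f x)) has_L1_derivative (\<lambda>x. exp (f x) * f' x)"
proof -
  have cf: "continuous_on {0..1} f" using f L1D_continuous by auto
  have "bounded (f ` {0..1})"
    using cf compact_continuous_image compact_imp_bounded by blast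
  then obtain A where A: "\<And>x. x \<in> {0..1} \<Longrightarrow> norm (f x) \<le> A" 
    unfolding bounded_iff by blast
  show ?thesis
  proof (rule L1D_compose[OF f, where K = "exp A"])
    fix u v :: real assume uv: "u \<in> {0..1}" "v \<in> {0..1}"
    show "norm (exp (f u) - exp (f v)) \<le> exp A * norm (f u - f v)"
    proof (rule field_differentiable_bound[of "cball 0 A"])
      show "norm (exp z) \<le> exp A" if "z \<in> cball 0 A" for z :: complex
        using that norm_exp[of z] by (simp add: order_trans)
    qed (use A uv in \<open>auto intro!: derivative_eq_intros\<close>)
  qed (auto intro!: derivative_eq_intros continuous_intros cf)
qed

lemma L1D_inverse:
  fixes f :: "real \<Rightarrow> complex"
  assumes f: "f has_L1_derivative f'" and \<epsilon>: "\<epsilon> > 0" "\<And>x. x \<in> {0..1} \<Longrightarrow> norm (f x) \<ge> \<epsilon>"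
  shows "(\<lambda>x. inverse (f x)) has_L1_derivative (\<lambda>x. - (inverse (f x) * inverse (f x)) * f' x)"
proof -
  have cf: "continuous_on {0..1} f" using f L1D_continuous by auto
  have nz: "f x \<noteq> 0" if "x \<in> {0..1}" for x using \<epsilon> that by fastforce
  show ?thesis
  proof (rule L1D_compose[OF f, where K = "inverse (\<epsilon> * \<epsilon>)"])
    fix u v :: real assume uv: "u \<in> {0..1}" "v \<in> {0..1}"
    have "inverse (f u) - inverse (f v) = (f v - f u) * inverse (f u * f v)"
      using nz uv by (simp add: field_simps)
    then have "norm (inverse (f u) - inverse (f v)) = norm (f u - f v) * inverse (norm (f u) * norm (f v))"
      by (simp add: norm_mult norm_inverse norm_minus_commute)
    also have "\<dots> \<le> norm (f u - f v) * inverse (\<epsilon> * \<epsilon>)"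
      using \<epsilon> uv by (intro mult_left_mono le_imp_inverse_le mult_mono) auto
    finally show "norm (inverse (f u) - inverse (f v)) \<le> inverse (\<epsilon> * \<epsilon>) * norm (f u - f v)" by (simp add: mult.commute)
  next
    fix x :: real assume x: "x \<in> {0..1}"
    show "(inverse has_field_derivative - (inverse (f x) * inverse (f x))) (at (f x))"
      using nz[OF x] by (auto intro!: derivative_eq_intros)
  qed (auto intro!: continuous_intros cf nz)
qed

lemma L1D_of_everywhere_derivative:
  fixes f :: "real \<Rightarrow> 'a::euclidean_space"
  assumes "\<And>x. x \<in> {0..1} \<Longrightarrow> (f has_vector_derivative f' x) (at x within {0..1})"
    and "f' absolutely_integrable_on {0..1}"
  shows "f has_L1_derivative f'"
  unfolding has_L1_derivative_def
proof (intro conjI ballI assms(2))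
  fix x :: real assume x: "x \<in> {0..1}"
  show "(f' has_integral f x - f 0) {0..x}"
  proof (rule fundamental_theorem_of_calculus)
    fix y assume y: "y \<in> {0..x}"
    then have "(f has_vector_derivative f' y) (at y within {0..1})" using x by (intro assms(1)) auto
    then show "(f has_vector_derivative f' y) (at y within {0..x})"
      by (rule has_vector_derivative_within_subset) (use x in auto)
  qed (use x in auto)
qed

section \<open>Primitives and holomorphic dependence on a parameter\<close>

definition L1norm :: "(real \<Rightarrow> 'a::euclidean_space) \<Rightarrow> real" where
  "L1norm f = integral {0..1} (\<lambda>x. norm (f x))"

lemma L1norm_nonneg: "f absolutely_integrable_on {0..1} \<Longrightarrow> L1norm f \<ge> 0"
  unfolding L1norm_def by (intro integral_nonneg) (auto simp: absolutely_integrable_on_def)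

text \<open>
  The primitive that vanishes at \<open>c\<close>. Letting \<open>c\<close> vary treats forward and backward integration, hence the
  operators \<open>I\<^sub>1\<close> and \<open>I\<^sub>2\<close> and both half-planes, by one set of estimates.
\<close>

definition integral_from :: "real \<Rightarrow> (real \<Rightarrow> 'a::euclidean_space) \<Rightarrow> real \<Rightarrow> 'a" where
  "integral_from c f x = integral {0..x} f - integral {0..c} f"

lemma integral_from_self [simp]: "integral_from c f c = 0"
  by (simp add: integral_from_def)

lemma integral_from_L1D:
  assumes "f absolutely_integrable_on {0..1}"
  shows "integral_from c f has_L1_derivative f"
proof -
  have "(\<lambda>x. integral {0..x} f + - integral {0..c} f) has_L1_derivative (\<lambda>x. f x + 0)"
    by (rule L1D_add[OF L1D_integral[OF assms] L1D_const])
  then show ?thesis by (rule L1D_cong) (auto simp: integral_from_def)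
qed

lemma integral_from_eq:
  assumes "F has_L1_derivative f" "x \<in> {0..1}" "c \<in> {0..1}"
  shows "integral_from c f x = F x - F c"
  using L1D_eq[OF assms(1,2)] L1D_eq[OF assms(1,3)] by (simp add: integral_from_def)

lemma integral_from_cong:
  assumes "\<And>t. t \<in> {0..1} \<Longrightarrow> f t = g t" "x \<le> 1" "c \<le> 1"
  shows "integral_from c f x = integral_from c g x"
proof -
  have "integral {0..x} f = integral {0..x} g" "integral {0..c} f = integral {0..c} g"
    using assms by (auto intro!: integral_cong)
  then show ?thesis by (simp add: integral_from_def)
qed

lemma integral_from_ge:
  assumes "f absolutely_integrable_on {0..1}" "0 \<le> c" "c \<le> x" "x \<le> 1"
  shows "integral_from c f x = integral {c..x} f"
proof -
  have "integral {0..c} f + integral {c..x} f = integral {0..x} f"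
    by (rule Henstock_Kurzweil_Integration.integral_combine)
       (use assms absint_subinterval(1)[OF assms(1), of 0 x] in auto)
  then show ?thesis by (simp add: integral_from_def algebra_simps)
qed

lemma integral_from_le:
  assumes "f absolutely_integrable_on {0..1}" "0 \<le> x" "x \<le> c" "c \<le> 1"
  shows "integral_from c f x = - integral {x..c} f"
proof -
  have "integral {0..x} f + integral {x..c} f = integral {0..c} f"
    by (rule Henstock_Kurzweil_Integration.integral_combine)
       (use assms absint_subinterval(1)[OF assms(1), of 0 c] in auto)
  then show ?thesis by (simp add: integral_from_def algebra_simps)
qed

lemma integral_from_add:
  assumes "f absolutely_integrable_on {0..1}" "g absolutely_integrable_on {0..1}" "x \<in> {0..1}" "c \<in> {0..1}"
  shows "integral_from c (\<lambda>t. f t + g t) x = integral_from c f x + integral_from c g x"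
  using integral_from_eq[OF L1D_add[OF integral_from_L1D[OF assms(1), of c] integral_from_L1D[OF assms(2), of c]] assms(3,4)]
  by simp

lemma integral_from_cmult:
  fixes f :: "real \<Rightarrow> complex"
  shows "integral_from c (\<lambda>t. k * f t) x = k * integral_from c f x"
  by (simp add: integral_from_def right_diff_distrib)

lemma integral_from_norm_le:
  fixes f h :: "real \<Rightarrow> complex"
  assumes h: "h absolutely_integrable_on {0..1}" and f: "f absolutely_integrable_on {0..1}"
    and cx: "c \<in> {0..1}" "x \<in> {0..1}" and B: "B \<ge> 0"
    and le: "\<And>t. t \<in> closed_segment c x \<Longrightarrow> norm (h t) \<le> B * norm (f t)"
  shows "norm (integral_from c h x) \<le> B * L1norm f"
proof -
  define u v where "u = min c x" and "v = max c x"
  have uv: "u \<le> v" "{u..v} = closed_segment c x" "0 \<le> u" "v \<le> 1"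
    using cx by (auto simp: u_def v_def closed_segment_eq_real_ivl)
  have "norm (integral_from c h x) = norm (integral {u..v} h)"
    using integral_from_ge[OF h, of c x] integral_from_le[OF h, of x c] cx
    by (cases "c \<le> x") (auto simp: u_def v_def)
  also have "\<dots> \<le> integral {u..v} (\<lambda>t. B * norm (f t))"
    using absint_subinterval[OF h uv(3,4)] absint_subinterval[OF f uv(3,4)] le uv
    by (intro integral_norm_bound_integral integrable_on_mult_right) auto
  also have "\<dots> = B * integral {u..v} (\<lambda>t. norm (f t))" by simp
  also have "\<dots> \<le> B * L1norm f"
    unfolding L1norm_def
    using absint_subinterval(2)[OF f uv(3,4)] absint_subinterval(2)[OF f, of 0 1] uv(3,4) B
    by (intro mult_left_mono integral_subset_le) auto
  finally show ?thesis .
qed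

text \<open>
  By Cauchy's inequality the bounded family \<open>f\<close> is Lipschitz near \<open>z\<close> with a constant independent of \<open>t\<close>. The
  difference quotients in \<open>z\<close> are therefore dominated by a multiple of \<open>norm \<circ> h\<close>, and dominated convergence
  differentiates under the integral although \<open>h\<close> is merely integrable.
\<close>

lemma holomorphic_on_integral:
  fixes f :: "complex \<Rightarrow> real \<Rightarrow> complex"
  assumes \<Omega>: "open \<Omega>" and h: "h absolutely_integrable_on {u..v}"
    and hol: "\<And>t. t \<in> {u..v} \<Longrightarrow> (\<lambda>z. f z t) holomorphic_on \<Omega>"
    and cont: "\<And>z. z \<in> \<Omega> \<Longrightarrow> continuous_on {u..v} (f z)"
    and bound: "\<And>z t. z \<in> \<Omega> \<Longrightarrow> t \<in> {u..v} \<Longrightarrow> cmod (f z t) \<le> M"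
  shows "(\<lambda>z. integral {u..v} (\<lambda>t. h t * f z t)) holomorphic_on \<Omega>"
  unfolding holomorphic_on_open[OF \<Omega>]
proof (intro ballI)
  fix z assume z: "z \<in> \<Omega>"
  define M' where "M' = max M 0"
  have M': "\<And>z t. z \<in> \<Omega> \<Longrightarrow> t \<in> {u..v} \<Longrightarrow> cmod (f z t) \<le> M'" "M' \<ge> 0"
    using bound by (force simp: M'_def)+
  obtain r0 where r0: "r0 > 0" "ball z r0 \<subseteq> \<Omega>" using \<Omega> z openE by blast
  \<comment> \<open>Discs of radius \<open>r\<close> about points of \<open>ball z r\<close> must stay in \<open>\<Omega>\<close>; a third of \<open>r0\<close> leaves room.\<close>
  define r where "r = r0 / 3"
  have r: "r > 0" using r0 by (simp add: r_def)
  have sub: "cball w r \<subseteq> \<Omega>" if "w \<in> ball z r" for w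
  proof -
    have "cball w r \<subseteq> ball z r0"
    proof
      fix y assume "y \<in> cball w r"
      then show "y \<in> ball z r0" using that r r0 dist_triangle[of z y w] by (auto simp: r_def)
    qed
    then show ?thesis using r0 by blast
  qed
  have zr: "ball z r \<subseteq> \<Omega>" using r0 by (auto simp: r_def)
  define F where "F = (\<lambda>z. integral {u..v} (\<lambda>t. h t * f z t))"
  define f' where "f' = (\<lambda>t. deriv (\<lambda>z. f z t) z)"
  have lip: "cmod (f y t - f z t) \<le> M' / r * cmod (y - z)" if y: "y \<in> ball z r" and t: "t \<in> {u..v}" for y t
  proof (rule field_differentiable_bound[of "ball z r" "\<lambda>z. f z t" "deriv (\<lambda>z. f z t)"])
    fix w assume w: "w \<in> ball z r"
    show "((\<lambda>z. f z t) has_field_derivative deriv (\<lambda>z. f z t) w) (at w within ball z r)"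
      using holomorphic_derivI[OF hol[OF t] \<Omega>] w zr has_field_derivative_at_within by blast
    have "cmod ((deriv ^^ 1) (\<lambda>z. f z t) w) \<le> fact 1 * M' / r ^ 1"
    proof (rule Cauchy_inequality)
      show "(\<lambda>z. f z t) holomorphic_on ball w r"
        by (rule holomorphic_on_subset[OF hol[OF t]]) (use sub[OF w] in auto)
      show "continuous_on (cball w r) (\<lambda>z. f z t)"
        by (rule holomorphic_on_imp_continuous_on, rule holomorphic_on_subset[OF hol[OF t] sub[OF w]])
      show "cmod (f x t) \<le> M'" if "cmod (w - x) = r" for x
        using sub[OF w] that t by (intro M') (auto simp: dist_norm)
    qed (rule r)
    then show "cmod (deriv (\<lambda>z. f z t) w) \<le> M' / r" by simp
  qed (use y r in auto)
  have int: "(\<lambda>t. h t * f y t) integrable_on {u..v}" if "y \<in> \<Omega>" for y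
    using absint_continuous_mult(2)[OF cont[OF that] h] by (auto simp: absolutely_integrable_on_def)
  have "((\<lambda>y. (F y - F z) / (y - z)) \<longlongrightarrow> integral {u..v} (\<lambda>t. h t * f' t)) (at z within ball z r)"
    unfolding tendsto_at_iff_sequentially
  proof (intro allI impI)
    fix X :: "nat \<Rightarrow> complex" assume X: "\<forall>i. X i \<in> ball z r - {z}" and lim: "X \<longlonglongrightarrow> z"
    have Xi: "X i \<in> ball z r" "X i \<noteq> z" "X i \<in> \<Omega>" for i using X zr by auto
    define g where "g = (\<lambda>k t. h t * ((f (X k) t - f z t) / (X k - z)))"
    have gi: "g k integrable_on {u..v}" for k
    proof -
      have "(\<lambda>t. (h t * f (X k) t - h t * f z t) * (1 / (X k - z))) integrable_on {u..v}"
        by (intro integrable_on_mult_left integrable_diff int Xi z)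
      then show ?thesis by (simp add: g_def algebra_simps diff_divide_distrib)
    qed
    have "(\<lambda>k. integral {u..v} (g k)) \<longlonglongrightarrow> integral {u..v} (\<lambda>t. h t * f' t)"
    proof (rule dominated_convergence(2)[OF gi])
      show "(\<lambda>t. norm (h t) * (M' / r)) integrable_on {u..v}"
        using h by (intro integrable_on_mult_left) (auto simp: absolutely_integrable_on_def)
      show "norm (g k t) \<le> norm (h t) * (M' / r)" if t: "t \<in> {u..v}" for k t
      proof -
        have "cmod ((f (X k) t - f z t) / (X k - z)) \<le> M' / r"
          using lip[OF Xi(1) t, of k] Xi(2)[of k] by (simp add: norm_divide pos_divide_le_eq)
        then show ?thesis unfolding g_def norm_mult by (intro mult_left_mono) auto
      qed
      show "(\<lambda>k. g k t) \<longlonglongrightarrow> h t * f' t" if t: "t \<in> {u..v}" for t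
      proof -
        have "((\<lambda>z. f z t) has_field_derivative f' t) (at z)"
          unfolding f'_def using holomorphic_derivI[OF hol[OF t] \<Omega> z] .
        then have "((\<lambda>y. (f y t - f z t) / (y - z)) \<longlongrightarrow> f' t) (at z)"
          by (simp add: has_field_derivative_iff)
        then have "((\<lambda>y. (f y t - f z t) / (y - z)) \<circ> X) \<longlonglongrightarrow> f' t"
          unfolding tendsto_at_iff_sequentially using Xi lim by auto
        then show ?thesis unfolding g_def o_def by (intro tendsto_mult tendsto_const)
      qed
    qed
    also have "(\<lambda>k. integral {u..v} (g k)) = (\<lambda>y. (F y - F z) / (y - z)) \<circ> X"
    proof
      fix k
      have "integral {u..v} (g k) = integral {u..v} (\<lambda>t. (h t * f (X k) t - h t * f z t) * (1 / (X k - z)))"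
        by (simp add: g_def algebra_simps diff_divide_distrib)
      also have "\<dots> = (F (X k) - F z) * (1 / (X k - z))"
        unfolding F_def by (subst integral_diff[symmetric, OF int[OF Xi(3)] int[OF z]]) (rule integral_mult_left)
      finally show "integral {u..v} (g k) = ((\<lambda>y. (F y - F z) / (y - z)) \<circ> X) k" by simp
    qed
    finally show "((\<lambda>y. (F y - F z) / (y - z)) \<circ> X) \<longlonglongrightarrow> integral {u..v} (\<lambda>t. h t * f' t)" .
  qed
  then have "((\<lambda>y. (F y - F z) / (y - z)) \<longlongrightarrow> integral {u..v} (\<lambda>t. h t * f' t)) (at z)"
    using r by (simp add: at_within_open[of z "ball z r"])
  then show "\<exists>f'. ((\<lambda>z. integral {u..v} (\<lambda>t. h t * f z t)) has_field_derivative f') (at z)"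
    unfolding F_def by (auto simp: has_field_derivative_iff)
qed

lemma holomorphic_on_integral_from:
  fixes f :: "complex \<Rightarrow> real \<Rightarrow> complex"
  assumes \<Omega>: "open \<Omega>" and h: "h absolutely_integrable_on {0..1}"
    and cx: "c \<in> {0..1}" "x \<in> {0..1}"
    and hol: "\<And>t. t \<in> closed_segment c x \<Longrightarrow> (\<lambda>z. f z t) holomorphic_on \<Omega>"
    and cont: "\<And>z. z \<in> \<Omega> \<Longrightarrow> continuous_on {0..1} (f z)"
    and bound: "\<And>z t. z \<in> \<Omega> \<Longrightarrow> t \<in> closed_segment c x \<Longrightarrow> cmod (f z t) \<le> M"
  shows "(\<lambda>z. integral_from c (\<lambda>t. h t * f z t) x) holomorphic_on \<Omega>"
proof -
  define u v where "u = min c x" and "v = max c x"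
  have uv: "u \<le> v" "{u..v} = closed_segment c x" "0 \<le> u" "v \<le> 1"
    using cx by (auto simp: u_def v_def closed_segment_eq_real_ivl)
  have sub: "{u..v} \<subseteq> {0..1}" using uv(3,4) by auto
  have *: "(\<lambda>z. integral {u..v} (\<lambda>t. h t * f z t)) holomorphic_on \<Omega>"
  proof (rule holomorphic_on_integral[OF \<Omega>])
    show "h absolutely_integrable_on {u..v}" by (rule absolutely_integrable_on_subinterval[OF h sub])
    show "continuous_on {u..v} (f z)" if "z \<in> \<Omega>" for z
      using cont[OF that] sub continuous_on_subset by blast
  qed (use uv hol bound in auto)
  define \<sigma> :: complex where "\<sigma> = (if c \<le> x then 1 else -1)"
  have eq: "integral_from c (\<lambda>t. h t * f z t) x = \<sigma> * integral {u..v} (\<lambda>t. h t * f z t)" if "z \<in> \<Omega>" for z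
    using integral_from_ge[OF absint_continuous_mult(2)[OF cont[OF that] h], of c x]
      integral_from_le[OF absint_continuous_mult(2)[OF cont[OF that] h], of x c] cx
    by (cases "c \<le> x") (auto simp: u_def v_def \<sigma>_def)
  show ?thesis
    by (rule holomorphic_transform[where f = "\<lambda>z. \<sigma> * integral {u..v} (\<lambda>t. h t * f z t)"])
       (auto simp: eq intro!: holomorphic_intros *)
qed

section \<open>Approximation in a weighted mean\<close>

text \<open>
  The radial retraction onto the disc of radius \<open>N\<close>.
\<close>

definition clip :: "real \<Rightarrow> complex \<Rightarrow> complex" where
  "clip N z = (N / max N (norm z)) *\<^sub>R z"

lemma clip_bound: "N > 0 \<Longrightarrow> norm (clip N z) \<le> N" "N > 0 \<Longrightarrow> norm (clip N z) \<le> norm z"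
  unfolding clip_def by (auto simp: divide_simps max_def mult.commute intro: mult_left_mono)

lemma clip_eq: "N > 0 \<Longrightarrow> norm z \<le> N \<Longrightarrow> clip N z = z"
  by (auto simp: clip_def max_def)

lemma continuous_clip: "N > 0 \<Longrightarrow> continuous_on UNIV (clip N)"
  unfolding clip_def by (intro continuous_intros) (auto simp: max_def)

text \<open>
  In other words, smooth functions are dense in \<open>L\<^sub>1\<close> with weight \<open>\<bar>\<alpha>\<bar>\<close>. The quotient \<open>h / \<alpha>\<close> is clipped at a
  height \<open>N\<close>; it is then an almost everywhere limit of continuous functions, which after clipping at the
  same height are dominated by \<open>N\<close> and so converge in the weighted norm; these are approximated uniformly
  by polynomials.
\<close>

lemma weighted_smooth_dense:
  fixes \<alpha> :: "real \<Rightarrow> real" and h :: "real \<Rightarrow> complex"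
  assumes \<alpha>: "\<alpha> absolutely_integrable_on {0..1}" and nz: "\<And>x. x \<in> {0..1} \<Longrightarrow> \<alpha> x \<noteq> 0"
    and h: "h absolutely_integrable_on {0..1}" and e: "e > 0"
  obtains \<phi> \<phi>' where "\<phi> has_L1_derivative \<phi>'" "L1norm (\<lambda>x. h x - of_real (\<alpha> x) * \<phi> x) < e"
proof -
  define f where "f = (\<lambda>x. h x / of_real (\<alpha> x))"
  define \<alpha>c where "\<alpha>c = (\<lambda>x. complex_of_real (\<alpha> x))"
  have \<alpha>c: "\<alpha>c absolutely_integrable_on {0..1}"
    using absolutely_integrable_linear[OF \<alpha> bounded_linear_of_real] by (simp add: o_def \<alpha>c_def)
  have ni: "(\<lambda>x. norm (h x)) integrable_on {0..1}" "(\<lambda>x. norm (\<alpha>c x)) integrable_on {0..1}"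
    using absint_subinterval[OF h] absint_subinterval[OF \<alpha>c] by auto
  have hm: "h \<in> borel_measurable (lebesgue_on {0..1})" "\<alpha>c \<in> borel_measurable (lebesgue_on {0..1})"
    using absolutely_integrable_imp_borel_measurable h \<alpha>c by fastforce+
  have fm: "f \<in> borel_measurable (lebesgue_on {0..1})"
    unfolding f_def \<alpha>c_def[symmetric] using hm(1) hm(2)[unfolded \<alpha>c_def] by (intro borel_measurable_divide) auto
  have clipm: "(\<lambda>x. clip N (k x)) \<in> borel_measurable (lebesgue_on {0..1})"
    if "N > 0" "k \<in> borel_measurable (lebesgue_on {0..1})" for N k
    using measurable_compose[OF that(2) borel_measurable_continuous_onI[OF continuous_clip[OF that(1)]]] .
  have absd: "(\<lambda>x. norm (h1 x - h2 x)) integrable_on {0..1}"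
    if "h1 absolutely_integrable_on {0..1}" "h2 absolutely_integrable_on {0..1}" for h1 h2 :: "real \<Rightarrow> complex"
    using set_integral_diff(1)[OF that] by (auto simp: absolutely_integrable_on_def)
  have prodm: "(\<lambda>x. \<alpha>c x * k x) absolutely_integrable_on {0..1}"
    if "k \<in> borel_measurable (lebesgue_on {0..1})" "\<And>x. x \<in> {0..1} \<Longrightarrow> norm (k x) \<le> C" for k and C :: real
  proof -
    have "bounded (k ` {0..1})" using that(2) unfolding bounded_iff by blast
    then have "(\<lambda>x. k x * \<alpha>c x) absolutely_integrable_on {0..1}"
      by (intro absolutely_integrable_bounded_measurable_product[of "(*)"])
         (use that(1) \<alpha>c in \<open>auto simp: bilinear_times\<close>)
    then show ?thesis by (simp only: mult.commute)
  qed
  have tri: "L1norm (\<lambda>x. h1 x - h3 x) \<le> L1norm (\<lambda>x. h1 x - h2 x) + L1norm (\<lambda>x. h2 x - h3 x)"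
    if "h1 absolutely_integrable_on {0..1}" "h2 absolutely_integrable_on {0..1}" "h3 absolutely_integrable_on {0..1}"
    for h1 h2 h3 :: "real \<Rightarrow> complex"
  proof -
    have "L1norm (\<lambda>x. h1 x - h3 x) \<le> integral {0..1} (\<lambda>x. norm (h1 x - h2 x) + norm (h2 x - h3 x))"
      unfolding L1norm_def
      by (rule integral_le) (use absd that norm_triangle_le_diff in \<open>auto intro!: integrable_add norm_diff_triangle_ineq norm_diff_triangle_le\<close>)
    also have "\<dots> = L1norm (\<lambda>x. h1 x - h2 x) + L1norm (\<lambda>x. h2 x - h3 x)"
      unfolding L1norm_def by (rule integral_add) (use absd that in auto)
    finally show ?thesis .
  qed
  define h1 where "h1 = (\<lambda>n::nat. \<lambda>x. \<alpha>c x * clip (real n + 1) (f x))"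
  have h1: "h1 n absolutely_integrable_on {0..1}" for n
    unfolding h1_def by (rule prodm[of _ "real n + 1"]) (auto intro!: clipm fm clip_bound)
  have "(\<lambda>n. integral {0..1} (\<lambda>x. norm (h x - h1 n x))) \<longlonglongrightarrow> integral {0..1} (\<lambda>x::real. 0)"
  proof (rule dominated_convergence(2)[where h = "\<lambda>x. 2 * norm (h x)"])
    show "(\<lambda>x. 2 * norm (h x)) integrable_on {0..1}" by (intro integrable_on_mult_right ni)
    show "(\<lambda>x. norm (h x - h1 n x)) integrable_on {0..1}" for n by (rule absd[OF h h1])
    fix x :: real assume x: "x \<in> {0..1}"
    have hx: "\<alpha>c x * f x = h x" using nz[OF x] by (simp add: \<alpha>c_def f_def)
    show "norm (norm (h x - h1 n x)) \<le> 2 * norm (h x)" for n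
    proof -
      have "norm (h1 n x) \<le> norm (\<alpha>c x) * norm (f x)"
        unfolding h1_def norm_mult by (intro mult_left_mono clip_bound) auto
      also have "\<dots> = norm (h x)" by (simp add: hx[symmetric] norm_mult)
      finally show ?thesis using norm_triangle_ineq4[of "h x" "h1 n x"] by simp
    qed
    obtain K :: nat where K: "norm (f x) \<le> K" using real_arch_simple by blast
    have "h1 n x = h x" if "n \<ge> K" for n
      using clip_eq[of "real n + 1" "f x"] K that hx by (simp add: h1_def)
    then have "\<forall>\<^sub>F n in sequentially. norm (h x - h1 n x) = 0"
      unfolding eventually_sequentially by (intro exI[of _ K]) auto
    then show "(\<lambda>n. norm (h x - h1 n x)) \<longlonglongrightarrow> 0" by (rule tendsto_eventually)
  qed
  then have "(\<lambda>n. L1norm (\<lambda>x. h x - h1 n x)) \<longlonglongrightarrow> 0" by (simp add: L1norm_def)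
  from order_tendstoD(2)[OF this, of "e/3"] e obtain n where n: "L1norm (\<lambda>x. h x - h1 n x) < e/3"
    by (auto simp: eventually_sequentially)
  define N where "N = real n + 1"
  have N: "N > 0" by (simp add: N_def)
  have "f measurable_on {0..1}" using fm by (subst measurable_on_iff_borel_measurable) auto
  then obtain Z g where Z: "negligible Z" and gc: "\<And>n. continuous_on UNIV (g n)"
    and glim: "\<And>x. x \<notin> Z \<Longrightarrow> (\<lambda>n. g n x) \<longlonglongrightarrow> (if x \<in> {0..1} then f x else 0)"
    unfolding measurable_on_def by blast
  define \<psi> where "\<psi> = (\<lambda>k x. clip N (g k x))"
  have \<psi>c: "continuous_on UNIV (\<psi> k)" for k
    unfolding \<psi>_def by (rule continuous_on_compose2[OF continuous_clip[OF N] gc]) auto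
  have \<psi>01: "continuous_on {0..1} (\<psi> k)" for k by (rule continuous_on_subset[OF \<psi>c]) auto
  have h2: "(\<lambda>x. \<alpha>c x * \<psi> k x) absolutely_integrable_on {0..1}" for k
    by (rule absint_continuous_mult(2)[OF \<psi>01 \<alpha>c])
  define G where "G = (\<lambda>k x. if x \<in> Z then 0 else norm (h1 n x - \<alpha>c x * \<psi> k x))"
  have Gi: "G k integrable_on {0..1}" for k
    by (rule integrable_spike[OF absd[OF h1 h2[of k]] Z]) (auto simp: G_def)
  have Geq: "integral {0..1} (G k) = L1norm (\<lambda>x. h1 n x - \<alpha>c x * \<psi> k x)" for k
    unfolding L1norm_def by (rule integral_spike[OF Z]) (auto simp: G_def)
  have "(\<lambda>k. integral {0..1} (G k)) \<longlonglongrightarrow> integral {0..1} (\<lambda>x::real. 0)"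
  proof (rule dominated_convergence(2)[OF Gi, where h = "\<lambda>x. norm (\<alpha>c x) * (2 * N)"])
    show "(\<lambda>x. norm (\<alpha>c x) * (2 * N)) integrable_on {0..1}" by (intro integrable_on_mult_left ni)
    fix x :: real assume x: "x \<in> {0..1}"
    have eq: "h1 n x - \<alpha>c x * \<psi> k x = \<alpha>c x * (clip N (f x) - clip N (g k x))" for k
      by (simp add: h1_def \<psi>_def N_def algebra_simps)
    have "norm (clip N (f x) - clip N (g k x)) \<le> 2 * N" for k
      using norm_triangle_ineq4[of "clip N (f x)" "clip N (g k x)"] clip_bound(1)[OF N, of "f x"] clip_bound(1)[OF N, of "g k x"] by linarith
    then show "norm (G k x) \<le> norm (\<alpha>c x) * (2 * N)" for k
      unfolding G_def eq norm_mult using N by (auto intro!: mult_left_mono)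
    show "(\<lambda>k. G k x) \<longlonglongrightarrow> 0"
    proof (cases "x \<in> Z")
      case False
      then have "(\<lambda>k. g k x) \<longlonglongrightarrow> f x" using glim[OF False] x by auto
      moreover have "isCont (clip N) (f x)" using continuous_clip[OF N] by (simp add: continuous_on_eq_continuous_at)
      ultimately have "(\<lambda>k. clip N (g k x)) \<longlonglongrightarrow> clip N (f x)" using isCont_tendsto_compose by blast
      then have "(\<lambda>k. norm (\<alpha>c x * (clip N (f x) - clip N (g k x)))) \<longlonglongrightarrow> norm (\<alpha>c x * (clip N (f x) - clip N (f x)))"
        by (intro tendsto_intros)
      then show ?thesis using False by (simp add: G_def eq)
    qed (simp add: G_def)
  qed
  then have "(\<lambda>k. L1norm (\<lambda>x. h1 n x - \<alpha>c x * \<psi> k x)) \<longlonglongrightarrow> 0" by (simp add: Geq)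
  from order_tendstoD(2)[OF this, of "e/3"] e obtain k where k: "L1norm (\<lambda>x. h1 n x - \<alpha>c x * \<psi> k x) < e/3"
    by (auto simp: eventually_sequentially)
  define \<delta> where "\<delta> = e / (3 * (L1norm \<alpha>c + 1))"
  have L0: "L1norm \<alpha>c \<ge> 0" by (rule L1norm_nonneg[OF \<alpha>c])
  have \<delta>: "\<delta> > 0" using e L0 by (auto simp: \<delta>_def)
  obtain \<phi> where \<phi>: "polynomial_function \<phi>" "\<And>x. x \<in> {0..1} \<Longrightarrow> norm (\<psi> k x - \<phi> x) < \<delta>"
    using Stone_Weierstrass_polynomial_function[OF _ \<psi>01 \<delta>, of k] by auto
  obtain \<phi>' where \<phi>': "polynomial_function \<phi>'" "\<And>x. (\<phi> has_vector_derivative \<phi>' x) (at x)"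
    using has_vector_derivative_polynomial_function[OF \<phi>(1)] by blast
  have L1D: "\<phi> has_L1_derivative \<phi>'"
    by (rule L1D_of_everywhere_derivative) (auto intro!: has_vector_derivative_at_within \<phi>' absolutely_integrable_continuous_real continuous_on_polymonial_function)
  have h3: "(\<lambda>x. \<alpha>c x * \<phi> x) absolutely_integrable_on {0..1}"
    by (rule absint_continuous_mult(2)[OF L1D_continuous[OF L1D] \<alpha>c])
  have "L1norm (\<lambda>x. \<alpha>c x * \<psi> k x - \<alpha>c x * \<phi> x) \<le> integral {0..1} (\<lambda>x. norm (\<alpha>c x) * \<delta>)"
    unfolding L1norm_def
  proof (rule integral_le[OF absd[OF h2 h3]])
    show "(\<lambda>x. norm (\<alpha>c x) * \<delta>) integrable_on {0..1}" by (intro integrable_on_mult_left ni)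
    fix x :: real assume x: "x \<in> {0..1}"
    show "norm (\<alpha>c x * \<psi> k x - \<alpha>c x * \<phi> x) \<le> norm (\<alpha>c x) * \<delta>"
      using \<phi>(2)[OF x] by (simp add: right_diff_distrib[symmetric] norm_mult mult_left_mono)
  qed
  also have "\<dots> = L1norm \<alpha>c * \<delta>" by (simp add: L1norm_def)
  also have "\<dots> < e / 3" using e L0 by (simp add: \<delta>_def field_simps)
  finally have 3: "L1norm (\<lambda>x. \<alpha>c x * \<psi> k x - \<alpha>c x * \<phi> x) < e/3" .
  have "L1norm (\<lambda>x. h x - \<alpha>c x * \<phi> x) < e"
    using tri[OF h h1 h3, of n] tri[OF h1 h2 h3, of n k] n k 3 by linarith
  then show ?thesis using that[OF L1D] by (simp add: \<alpha>c_def)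
qed

section \<open>The scalar equation with a large parameter\<close>

text \<open>
  The setting of the scalar equation \<open>w' = f - z \<alpha> w\<close> with \<open>w c = 0\<close>. The point \<open>c\<close> is the end of \<open>[0,1]\<close> from
  which the exponential kernel stays bounded for all \<open>z\<close> in \<open>\<Omega>\<close>.
\<close>

locale fast_kernel =
  fixes \<alpha> \<theta> :: "real \<Rightarrow> real" and c \<epsilon> B :: real and \<Omega> :: "complex set"
  assumes \<alpha>: "\<alpha> absolutely_integrable_on {0..1}"
    and \<theta>: "\<And>x. x \<in> {0..1} \<Longrightarrow> \<theta> x = integral {0..x} \<alpha>"
    and \<epsilon>: "\<epsilon> > 0" "\<And>x. x \<in> {0..1} \<Longrightarrow> \<epsilon> \<le> \<bar>\<alpha> x\<bar>"
    and c: "c \<in> {0..1}"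
    and kernel: "\<And>z x t. z \<in> \<Omega> \<Longrightarrow> x \<in> {0..1} \<Longrightarrow> t \<in> closed_segment c x \<Longrightarrow>
                   cmod (exp (- z * of_real (\<theta> x - \<theta> t))) \<le> B"
    and \<Omega>: "open \<Omega>"
begin

definition fast :: "complex \<Rightarrow> (real \<Rightarrow> complex) \<Rightarrow> real \<Rightarrow> complex" where
  "fast z f x = integral_from c (\<lambda>t. exp (- z * of_real (\<theta> x - \<theta> t)) * f t) x"

lemma \<alpha>c: "(\<lambda>x. complex_of_real (\<alpha> x)) absolutely_integrable_on {0..1}"
  using absolutely_integrable_linear[OF \<alpha> bounded_linear_of_real] by (simp add: o_def)

lemma \<theta>_L1D: "(\<lambda>x. complex_of_real (\<theta> x)) has_L1_derivative (\<lambda>x. of_real (\<alpha> x))"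
  by (rule L1D_cong[OF L1D_linear[OF L1D_integral[OF \<alpha>] bounded_linear_of_real]]) (auto simp: \<theta>)

lemma exp_\<theta>_L1D:
  "(\<lambda>x. exp (w * complex_of_real (\<theta> x))) has_L1_derivative (\<lambda>x. exp (w * of_real (\<theta> x)) * (w * of_real (\<alpha> x)))"
  by (rule L1D_exp[OF L1D_cmult[OF \<theta>_L1D]])

lemma segment_in_unit_interval: "x \<in> {0..1} \<Longrightarrow> t \<in> closed_segment c x \<Longrightarrow> t \<in> {0..1}"
  using c by (auto simp: closed_segment_eq_real_ivl split: if_splits)

lemma absint_exp:
  "f absolutely_integrable_on {0..1} \<Longrightarrow> (\<lambda>x. exp (w * complex_of_real (\<theta> x)) * f x) absolutely_integrable_on {0..1}"
  by (rule absint_continuous_mult(1)[OF L1D_continuous[OF exp_\<theta>_L1D]])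

lemma kernel_split:
  "exp (- z * complex_of_real (u - v)) = exp (- z * of_real u) * exp (z * of_real v)"
  unfolding exp_add[symmetric] by (simp add: algebra_simps)

lemma exp_cancel: "exp (- z * w) * (exp (z * w) * y) = (y::complex)"
proof -
  have "exp (- z * w) * exp (z * w) = 1" unfolding exp_add[symmetric] by simp
  then show ?thesis by (metis mult.assoc mult_1)
qed

lemma fast_alt: "fast z f x = exp (- z * of_real (\<theta> x)) * integral_from c (\<lambda>t. exp (z * of_real (\<theta> t)) * f t) x"
  unfolding fast_def kernel_split mult.assoc by (rule integral_from_cmult)

lemma fast_c [simp]: "fast z f c = 0"
  by (simp add: fast_def)

lemma fast_L1D:
  assumes f: "f absolutely_integrable_on {0..1}"
  shows "fast z f has_L1_derivative (\<lambda>x. f x - z * of_real (\<alpha> x) * fast z f x)"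
proof (rule L1D_cong[OF L1D_mult[OF exp_\<theta>_L1D[of "- z"] integral_from_L1D[OF absint_exp[OF f, of z], of c]]])
  fix x :: real assume "x \<in> {0..1}"
  show "f x - z * of_real (\<alpha> x) * fast z f x =
    exp (- z * of_real (\<theta> x)) * (- z * of_real (\<alpha> x)) * integral_from c (\<lambda>t. exp (z * of_real (\<theta> t)) * f t) x +
    exp (- z * of_real (\<theta> x)) * (exp (z * of_real (\<theta> x)) * f x)"
    unfolding exp_cancel fast_alt by (simp only: mult.assoc mult.left_commute) (simp add: mult.left_commute)
qed (simp add: fast_alt)

lemma fast_unique:
  assumes f: "f absolutely_integrable_on {0..1}"
    and w: "w has_L1_derivative (\<lambda>x. f x - z * of_real (\<alpha> x) * w x)" "w c = 0" and x: "x \<in> {0..1}"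
  shows "w x = fast z f x"
proof -
  have "(\<lambda>x. exp (z * of_real (\<theta> x)) * w x) has_L1_derivative (\<lambda>x. exp (z * of_real (\<theta> x)) * f x)"
    by (rule L1D_cong[OF L1D_mult[OF exp_\<theta>_L1D w(1)]]) (auto simp: algebra_simps)
  from integral_from_eq[OF this x c] w(2)
  have "integral_from c (\<lambda>t. exp (z * of_real (\<theta> t)) * f t) x = exp (z * of_real (\<theta> x)) * w x" by simp
  then show ?thesis unfolding fast_alt by (simp only: exp_cancel)
qed

lemma fast_cong:
  assumes "\<And>t. t \<in> {0..1} \<Longrightarrow> f t = g t" "x \<in> {0..1}"
  shows "fast z f x = fast z g x"
  unfolding fast_def using assms c by (intro integral_from_cong) auto

lemma fast_add:
  assumes f: "f absolutely_integrable_on {0..1}" and g: "g absolutely_integrable_on {0..1}" and x: "x \<in> {0..1}"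
  shows "fast z (\<lambda>x. f x + g x) x = fast z f x + fast z g x"
proof (rule fast_unique[symmetric, OF set_integral_add(1)[OF f g] _ _ x])
  show "(\<lambda>x. fast z f x + fast z g x) has_L1_derivative (\<lambda>x. f x + g x - z * of_real (\<alpha> x) * (fast z f x + fast z g x))"
    by (rule L1D_cong[OF L1D_add[OF fast_L1D[OF f, of z] fast_L1D[OF g, of z]]]) (simp_all add: distrib_left)
qed simp

lemma B_nonneg: "z \<in> \<Omega> \<Longrightarrow> B \<ge> 0"
  using kernel[of z c c] c by simp

lemma fast_norm_le:
  assumes z: "z \<in> \<Omega>" and f: "f absolutely_integrable_on {0..1}" and x: "x \<in> {0..1}"
    and h: "continuous_on {0..1} h" "\<And>t. t \<in> {0..1} \<Longrightarrow> cmod (h t) \<le> W"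
  shows "cmod (fast z (\<lambda>t. h t * f t) x) \<le> B * W * L1norm f"
  unfolding fast_def
proof (rule integral_from_norm_le[OF _ f c x])
  have hf: "(\<lambda>t. h t * f t) absolutely_integrable_on {0..1}"
    by (rule absint_continuous_mult(1)[OF h(1) f])
  have W: "W \<ge> 0" using order_trans[OF norm_ge_zero h(2)[of 0]] by simp
  show "B * W \<ge> 0" using W B_nonneg[OF z] by simp
  have "(\<lambda>t. exp (- z * of_real (\<theta> x)) * (exp (z * of_real (\<theta> t)) * (h t * f t))) absolutely_integrable_on {0..1}"
    by (rule absint_continuous_mult(1)[OF continuous_on_const absint_exp[OF hf]])
  then show "(\<lambda>t. exp (- z * of_real (\<theta> x - \<theta> t)) * (h t * f t)) absolutely_integrable_on {0..1}"
    by (simp only: kernel_split mult.assoc)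
  fix t assume t: "t \<in> closed_segment c x"
  show "cmod (exp (- z * of_real (\<theta> x - \<theta> t)) * (h t * f t)) \<le> B * W * cmod (f t)"
    unfolding norm_mult mult.assoc
    using mult_mono[OF kernel[OF z x t] mult_right_mono[OF h(2)[OF segment_in_unit_interval[OF x t]], of "cmod (f t)"] B_nonneg[OF z]]
    by simp
qed

lemma fast_norm_le':
  assumes z: "z \<in> \<Omega>" and f: "f absolutely_integrable_on {0..1}" and x: "x \<in> {0..1}"
  shows "cmod (fast z f x) \<le> B * L1norm f"
  using fast_norm_le[OF assms, of "\<lambda>_. 1" 1] by simp

text \<open>
  Since \<open>\<alpha>\<close> is the derivative of \<open>\<theta>\<close>, integration by parts gains the factor \<open>1 / z\<close> when the right-hand side is
  \<open>\<alpha> \<phi>\<close> with \<open>\<phi>\<close> absolutely continuous.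
\<close>

lemma fast_smooth:
  assumes \<phi>: "\<phi> has_L1_derivative \<phi>'" and z: "z \<noteq> 0" and x: "x \<in> {0..1}"
  shows "fast z (\<lambda>t. of_real (\<alpha> t) * \<phi> t) x =
           (\<phi> x - fast z \<phi>' x - exp (- z * of_real (\<theta> x - \<theta> c)) * \<phi> c) / z"
proof -
  define E where "E = (\<lambda>x. exp (- z * of_real (\<theta> x - \<theta> c)) * \<phi> c)"
  have E: "E has_L1_derivative (\<lambda>x. - z * of_real (\<alpha> x) * E x)"
  proof (rule L1D_cong[OF L1D_cmult[OF exp_\<theta>_L1D[of "- z"], of "exp (z * of_real (\<theta> c)) * \<phi> c"]])
    have E_alt: "E x = exp (z * of_real (\<theta> c)) * \<phi> c * exp (- z * of_real (\<theta> x))" for x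
      unfolding E_def kernel_split by (simp only: mult_ac)
    then show "E x = exp (z * of_real (\<theta> c)) * \<phi> c * exp (- z * of_real (\<theta> x))" for x .
    show "- z * of_real (\<alpha> x) * E x = exp (z * of_real (\<theta> c)) * \<phi> c * (exp (- z * of_real (\<theta> x)) * (- z * of_real (\<alpha> x)))" for x
      unfolding E_alt by (simp only: mult_ac)
  qed
  have "(\<lambda>x. (1 / z) * (\<phi> x + (- 1) * (fast z \<phi>' x + E x))) has_L1_derivative
        (\<lambda>x. (1 / z) * (\<phi>' x + (- 1) * (\<phi>' x - z * of_real (\<alpha> x) * fast z \<phi>' x + (- z * of_real (\<alpha> x) * E x))))"
    by (intro L1D_cmult L1D_add \<phi> fast_L1D E L1D_absint[OF \<phi>])
  then have "(\<lambda>x. (\<phi> x - fast z \<phi>' x - E x) / z) has_L1_derivative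
     (\<lambda>x. of_real (\<alpha> x) * \<phi> x - z * of_real (\<alpha> x) * ((\<phi> x - fast z \<phi>' x - E x) / z))"
    by (rule L1D_cong) (use z in \<open>auto simp: field_simps\<close>)
  then have "(\<phi> x - fast z \<phi>' x - E x) / z = fast z (\<lambda>t. of_real (\<alpha> t) * \<phi> t) x"
    by (rule fast_unique[OF absint_continuous_mult(2)[OF L1D_continuous[OF \<phi>] \<alpha>c] _ _ x]) (simp add: E_def)
  then show ?thesis by (simp add: E_def)
qed

text \<open>
  A Riemann-Lebesgue lemma, uniform in \<open>x\<close> and in the direction in which \<open>z\<close> tends to infinity: functions
  \<open>\<alpha> \<phi>\<close> with smooth \<open>\<phi>\<close> are dense in \<open>L\<^sub>1\<close>, and \<open>fast z\<close> is bounded from \<open>L\<^sub>1\<close> to the supremum norm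
  by a constant that does not depend on \<open>z\<close>.
\<close>

lemma fast_tendsto_0:
  assumes h: "h absolutely_integrable_on {0..1}" and e: "e > 0"
  shows "\<exists>\<mu>0. \<forall>z\<in>\<Omega>. cmod z > \<mu>0 \<longrightarrow> (\<forall>x\<in>{0..1}. cmod (fast z h x) \<le> e)"
proof (cases "\<Omega> = {}")
  case False
  then have B: "B \<ge> 0" using B_nonneg by auto
  define e' where "e' = e / (2 * (B + 1))"
  have e': "e' > 0" "B * e' \<le> e / 2" using e B by (auto simp: e'_def field_simps)
  have nz: "\<alpha> x \<noteq> 0" if "x \<in> {0..1}" for x using \<epsilon>(1) \<epsilon>(2)[OF that] by auto
  obtain \<phi> \<phi>' where \<phi>: "\<phi> has_L1_derivative \<phi>'" and dens: "L1norm (\<lambda>x. h x - of_real (\<alpha> x) * \<phi> x) < e'"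
    using weighted_smooth_dense[OF \<alpha> nz h e'(1)] by blast
  have "bounded (\<phi> ` {0..1})"
    using L1D_continuous[OF \<phi>] compact_continuous_image compact_imp_bounded by blast
  then obtain M where M: "\<And>x. x \<in> {0..1} \<Longrightarrow> norm (\<phi> x) \<le> M"
    unfolding bounded_iff by blast
  define C where "C = M + B * L1norm \<phi>' + B * M"
  have \<alpha>\<phi>: "(\<lambda>x. of_real (\<alpha> x) * \<phi> x) absolutely_integrable_on {0..1}"
    by (rule absint_continuous_mult(2)[OF L1D_continuous[OF \<phi>] \<alpha>c])
  have diff: "(\<lambda>x. h x - of_real (\<alpha> x) * \<phi> x) absolutely_integrable_on {0..1}"
    by (rule set_integral_diff(1)[OF h \<alpha>\<phi>])
  show ?thesis
  proof (intro exI[of _ "max 0 (2 * C / e)"] ballI impI)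
    fix z x assume z: "z \<in> \<Omega>" and zb: "max 0 (2 * C / e) < cmod z" and x: "x \<in> {0..1::real}"
    have z0: "z \<noteq> 0" "cmod z > 0" using zb by auto
    have Cz: "C \<le> e / 2 * cmod z" using zb e by (simp add: field_simps)
    have b1: "cmod (fast z \<phi>' x) \<le> B * L1norm \<phi>'"
      by (rule fast_norm_le'[OF z L1D_absint[OF \<phi>] x])
    have b2: "cmod (exp (- z * of_real (\<theta> x - \<theta> c)) * \<phi> c) \<le> B * M"
      unfolding norm_mult by (rule mult_mono[OF kernel[OF z x] M[OF c] B norm_ge_zero]) simp
    have "cmod (\<phi> x - fast z \<phi>' x - exp (- z * of_real (\<theta> x - \<theta> c)) * \<phi> c) \<le> C"
      using norm_triangle_ineq4[of "\<phi> x - fast z \<phi>' x" "exp (- z * of_real (\<theta> x - \<theta> c)) * \<phi> c"]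
        norm_triangle_ineq4[of "\<phi> x" "fast z \<phi>' x"] b1 b2 M[OF x] unfolding C_def by linarith
    then have "cmod (fast z (\<lambda>t. of_real (\<alpha> t) * \<phi> t) x) \<le> C / cmod z"
      unfolding fast_smooth[OF \<phi> z0(1) x] norm_divide by (intro divide_right_mono) auto
    also have "\<dots> \<le> e / 2" using Cz z0 by (simp add: pos_divide_le_eq)
    finally have 1: "cmod (fast z (\<lambda>t. of_real (\<alpha> t) * \<phi> t) x) \<le> e / 2" .
    have "cmod (fast z (\<lambda>x. h x - of_real (\<alpha> x) * \<phi> x) x) \<le> B * L1norm (\<lambda>x. h x - of_real (\<alpha> x) * \<phi> x)"
      by (rule fast_norm_le'[OF z diff x])
    also have "\<dots> \<le> B * e'" using dens B by (intro mult_left_mono) auto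
    also note e'(2)
    finally have 2: "cmod (fast z (\<lambda>x. h x - of_real (\<alpha> x) * \<phi> x) x) \<le> e / 2" .
    have "fast z h x = fast z (\<lambda>x. h x - of_real (\<alpha> x) * \<phi> x) x + fast z (\<lambda>t. of_real (\<alpha> t) * \<phi> t) x"
      using fast_add[OF diff \<alpha>\<phi> x, of z] by simp
    then show "cmod (fast z h x) \<le> e"
      using norm_triangle_le[of "fast z (\<lambda>x. h x - of_real (\<alpha> x) * \<phi> x) x" "fast z (\<lambda>t. of_real (\<alpha> t) * \<phi> t) x" e] 1 2 by simp
  qed
qed simp

lemma fast_holomorphic:
  assumes \<Omega>': "open \<Omega>'" "\<Omega>' \<subseteq> \<Omega>" and h: "h absolutely_integrable_on {0..1}" and x: "x \<in> {0..1}"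
    and hol: "\<And>t. t \<in> {0..1} \<Longrightarrow> (\<lambda>z. f z t) holomorphic_on \<Omega>'"
    and cont: "\<And>z. z \<in> \<Omega>' \<Longrightarrow> continuous_on {0..1} (f z)"
    and bound: "\<And>z t. z \<in> \<Omega>' \<Longrightarrow> t \<in> {0..1} \<Longrightarrow> cmod (f z t) \<le> M"
  shows "(\<lambda>z. fast z (\<lambda>t. h t * f z t) x) holomorphic_on \<Omega>'"
proof -
  have "(\<lambda>z. integral_from c (\<lambda>t. h t * (exp (- z * of_real (\<theta> x - \<theta> t)) * f z t)) x) holomorphic_on \<Omega>'"
  proof (rule holomorphic_on_integral_from[OF \<Omega>'(1) h c x])
    show "(\<lambda>z. exp (- z * of_real (\<theta> x - \<theta> t)) * f z t) holomorphic_on \<Omega>'" if "t \<in> closed_segment c x" for t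
      by (intro holomorphic_intros hol segment_in_unit_interval[OF x that])
    show "continuous_on {0..1} (\<lambda>t. exp (- z * of_real (\<theta> x - \<theta> t)) * f z t)" if "z \<in> \<Omega>'" for z
      unfolding of_real_diff by (intro continuous_intros cont that L1D_continuous[OF \<theta>_L1D])
    show "cmod (exp (- z * of_real (\<theta> x - \<theta> t)) * f z t) \<le> B * M" if "z \<in> \<Omega>'" "t \<in> closed_segment c x" for z t
      unfolding norm_mult using that \<Omega>'(2) B_nonneg segment_in_unit_interval[OF x that(2)]
      by (intro mult_mono kernel x bound) auto
  qed
  then show ?thesis unfolding fast_def by (simp add: mult.left_commute)
qed

end

section \<open>The coupled system\<close>

text \<open>
  One column of the transformed system. The slow component is \<open>u = slow v\<close>, that is \<open>u' = p v\<close> and \<open>u d = 0\<close>;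
  the fast component solves \<open>v' = q u + g - z \<alpha> v\<close> and \<open>v c = 0\<close>.
\<close>

locale fast_slow = fast_kernel +
  fixes p q :: "real \<Rightarrow> complex" and d :: real
  assumes p: "p absolutely_integrable_on {0..1}" and q: "q absolutely_integrable_on {0..1}" and d: "d \<in> {0..1}"
begin

definition slow :: "(real \<Rightarrow> complex) \<Rightarrow> real \<Rightarrow> complex" where
  "slow w = integral_from d (\<lambda>s. p s * w s)"

text \<open>
  Eliminating \<open>u\<close> turns the system into \<open>v = fast z g + feedback z v\<close>.
\<close>

definition feedback :: "complex \<Rightarrow> (real \<Rightarrow> complex) \<Rightarrow> real \<Rightarrow> complex" where
  "feedback z w = fast z (\<lambda>t. q t * slow w t)"

lemma slow_L1D: "continuous_on {0..1} w \<Longrightarrow> slow w has_L1_derivative (\<lambda>x. p x * w x)"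
  unfolding slow_def by (intro integral_from_L1D absint_continuous_mult(2) p)

lemma slow_continuous: "continuous_on {0..1} w \<Longrightarrow> continuous_on {0..1} (slow w)"
  using slow_L1D L1D_continuous by blast

lemma slow_norm_le:
  assumes w: "continuous_on {0..1} w" "\<And>t. t \<in> {0..1} \<Longrightarrow> cmod (w t) \<le> W" and x: "x \<in> {0..1}"
  shows "cmod (slow w x) \<le> W * L1norm p"
  unfolding slow_def
proof (rule integral_from_norm_le[OF absint_continuous_mult(2)[OF w(1) p] p d x])
  show "W \<ge> 0" using order_trans[OF norm_ge_zero w(2)[of 0]] by simp
  fix t assume "t \<in> closed_segment d x"
  then have "t \<in> {0..1}" using d x by (auto simp: closed_segment_eq_real_ivl split: if_splits)
  then show "cmod (p t * w t) \<le> W * cmod (p t)"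
    using w(2)[of t] by (simp add: norm_mult mult.commute[of "cmod (p t)"] mult_right_mono)
qed

lemma absint_q_slow: "continuous_on {0..1} w \<Longrightarrow> (\<lambda>t. q t * slow w t) absolutely_integrable_on {0..1}"
  by (intro absint_continuous_mult(2) q slow_continuous)

lemma feedback_continuous: "continuous_on {0..1} w \<Longrightarrow> continuous_on {0..1} (feedback z w)"
  unfolding feedback_def by (rule L1D_continuous[OF fast_L1D[OF absint_q_slow]])

lemma feedback_add:
  assumes "continuous_on {0..1} v" "continuous_on {0..1} w" "x \<in> {0..1}"
  shows "feedback z (\<lambda>t. v t + w t) x = feedback z v x + feedback z w x"
proof -
  have "slow (\<lambda>t. v t + w t) t = slow v t + slow w t" if "t \<in> {0..1}" for t
    unfolding slow_def
    by (subst integral_from_add[symmetric]) (use that d assms p in \<open>auto simp: distrib_left intro!: absint_continuous_mult(2)\<close>)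
  then have "feedback z (\<lambda>t. v t + w t) x = fast z (\<lambda>t. q t * slow v t + q t * slow w t) x"
    unfolding feedback_def using assms by (intro fast_cong) (auto simp: distrib_left)
  also have "\<dots> = feedback z v x + feedback z w x"
    unfolding feedback_def by (intro fast_add absint_q_slow assms)
  finally show ?thesis .
qed

text \<open>
  The derivative \<open>p w\<close> of \<open>slow w\<close> is free of \<open>z\<close>, whereas \<open>fast z q\<close> is uniformly small for large \<open>z\<close>.
  Integrating by parts produces this small factor in both terms; it makes \<open>feedback z\<close> a contraction for
  coefficients that are merely integrable.
\<close>

lemma feedback_by_parts:
  assumes w: "continuous_on {0..1} w" and x: "x \<in> {0..1}"
  shows "feedback z w x = fast z q x * slow w x - fast z (\<lambda>s. (fast z q s * w s) * p s) x"
proof -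
  let ?r = "\<lambda>s. (fast z q s * w s) * p s"
  have cS: "continuous_on {0..1} (\<lambda>s. fast z q s * w s)"
    by (intro continuous_intros w L1D_continuous[OF fast_L1D[OF q]])
  have r: "?r absolutely_integrable_on {0..1}"
    by (rule absint_continuous_mult(1)[OF cS p])
  have "(\<lambda>x. fast z q x * slow w x + (- 1) * fast z ?r x) has_L1_derivative
     (\<lambda>x. (q x - z * of_real (\<alpha> x) * fast z q x) * slow w x + fast z q x * (p x * w x) + (- 1) * (?r x - z * of_real (\<alpha> x) * fast z ?r x))"
    by (intro L1D_add L1D_mult L1D_cmult fast_L1D q r slow_L1D w)
  then have "(\<lambda>x. fast z q x * slow w x + (- 1) * fast z ?r x) has_L1_derivative
     (\<lambda>x. q x * slow w x - z * of_real (\<alpha> x) * (fast z q x * slow w x + (- 1) * fast z ?r x))"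
    by (rule L1D_cong) (auto simp: algebra_simps)
  from fast_unique[OF absint_q_slow[OF w] this _ x] show ?thesis unfolding feedback_def by simp
qed

lemma feedback_norm_le:
  assumes z: "z \<in> \<Omega>" and \<eta>: "\<And>x. x \<in> {0..1} \<Longrightarrow> cmod (fast z q x) \<le> \<eta>"
    and w: "continuous_on {0..1} w" "\<And>t. t \<in> {0..1} \<Longrightarrow> cmod (w t) \<le> W" and x: "x \<in> {0..1}"
  shows "cmod (feedback z w x) \<le> (1 + B) * L1norm p * \<eta> * W"
proof -
  have cS: "continuous_on {0..1} (\<lambda>s. fast z q s * w s)"
    by (intro continuous_intros w L1D_continuous[OF fast_L1D[OF q]])
  have W: "W \<ge> 0" using order_trans[OF norm_ge_zero w(2)[of 0]] by simp
  have \<eta>0: "\<eta> \<ge> 0" using order_trans[OF norm_ge_zero \<eta>[of 0]] by simp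
  have "cmod (feedback z w x) \<le> cmod (fast z q x) * cmod (slow w x) + cmod (fast z (\<lambda>s. (fast z q s * w s) * p s) x)"
    unfolding feedback_by_parts[OF w(1) x] norm_mult[symmetric] by (rule norm_triangle_ineq4)
  also have "\<dots> \<le> \<eta> * (W * L1norm p) + B * (\<eta> * W) * L1norm p"
  proof (intro add_mono mult_mono \<eta> x slow_norm_le w fast_norm_le z p cS)
    show "cmod (fast z q t * w t) \<le> \<eta> * W" if "t \<in> {0..1}" for t
      unfolding norm_mult by (intro mult_mono \<eta> w that \<eta>0) auto
  qed (use \<eta>0 in auto)
  finally show ?thesis by (simp add: algebra_simps)
qed

text \<open>
  The bound is stated for every majorant \<open>\<eta>\<close> of \<open>fast z g\<close>, because it is used with \<open>\<Upsilon> z\<close>, with a small constant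
  and with 0.
\<close>

definition coupled_solution ::
  "real \<Rightarrow> (real \<Rightarrow> complex) \<Rightarrow> (complex \<Rightarrow> real \<Rightarrow> complex) \<Rightarrow> (complex \<Rightarrow> real \<Rightarrow> complex) \<Rightarrow> bool" where
  "coupled_solution \<mu>0 g u v \<longleftrightarrow>
     (\<forall>z\<in>\<Omega>. cmod z > \<mu>0 \<longrightarrow>
        u z has_L1_derivative (\<lambda>x. p x * v z x) \<and>
        v z has_L1_derivative (\<lambda>x. q x * u z x + g x - z * of_real (\<alpha> x) * v z x) \<and>
        (\<forall>\<eta>. (\<forall>y\<in>{0..1}. cmod (fast z g y) \<le> \<eta>) \<longrightarrow> (\<forall>x\<in>{0..1}.
           cmod (u z x) \<le> 2 * (1 + L1norm p) * \<eta> \<and> cmod (v z x) \<le> 2 * (1 + L1norm p) * \<eta>))) \<and>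
     (\<forall>x\<in>{0..1}. (\<lambda>z. u z x) holomorphic_on {z \<in> \<Omega>. cmod z > \<mu>0} \<and>
                  (\<lambda>z. v z x) holomorphic_on {z \<in> \<Omega>. cmod z > \<mu>0})"

lemma coupled_solutionD:
  assumes "coupled_solution \<mu>0 g u v" "z \<in> \<Omega>" "cmod z > \<mu>0"
  shows "u z has_L1_derivative (\<lambda>x. p x * v z x)"
    "v z has_L1_derivative (\<lambda>x. q x * u z x + g x - z * of_real (\<alpha> x) * v z x)"
    "(\<And>y. y \<in> {0..1} \<Longrightarrow> cmod (fast z g y) \<le> \<eta>) \<Longrightarrow> x \<in> {0..1} \<Longrightarrow>
       cmod (u z x) \<le> 2 * (1 + L1norm p) * \<eta> \<and> cmod (v z x) \<le> 2 * (1 + L1norm p) * \<eta>"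
  using assms unfolding coupled_solution_def by blast+

text \<open>
  For large \<open>z\<close> the operator \<open>feedback z\<close> halves supremum norms, so the Neumann series of \<open>fast z g\<close> converges
  uniformly in \<open>x\<close> and \<open>z\<close>. Its terms are holomorphic in \<open>z\<close>, hence so is the sum.
\<close>

lemma coupled_solution_exists:
  assumes g: "g absolutely_integrable_on {0..1}"
  obtains \<mu>0 u v where "\<mu>0 \<ge> 0" "coupled_solution \<mu>0 g u v"
proof -
  \<comment> \<open>Chosen so that \<open>feedback_norm_le\<close> gives the factor \<open>1/2\<close>. The absolute value keeps \<open>e\<close> positive when \<open>\<Omega>\<close> is
      empty and \<open>B\<close> is unconstrained.\<close>
  define e where "e = 1 / (2 * ((1 + \<bar>B\<bar>) * L1norm p + 1))"
  have Lp: "L1norm p \<ge> 0" "L1norm g \<ge> 0" using L1norm_nonneg p g by auto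
  have e: "e > 0" unfolding e_def using Lp by (auto intro!: divide_pos_pos add_nonneg_pos)
  obtain \<mu>1 where \<mu>1: "\<And>z x. z \<in> \<Omega> \<Longrightarrow> cmod z > \<mu>1 \<Longrightarrow> x \<in> {0..1} \<Longrightarrow> cmod (fast z q x) \<le> e"
    using fast_tendsto_0[OF q e] by blast
  define \<mu>0 where "\<mu>0 = max \<mu>1 0"
  define \<Omega>0 where "\<Omega>0 = {z \<in> \<Omega>. cmod z > \<mu>0}"
  have \<Omega>0: "open \<Omega>0" "\<Omega>0 \<subseteq> \<Omega>"
  proof -
    have "\<Omega>0 = \<Omega> \<inter> {z. cmod z > \<mu>0}" by (auto simp: \<Omega>0_def)
    then show "open \<Omega>0" using \<Omega> by (auto intro!: open_Int open_Collect_less continuous_intros)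
  qed (auto simp: \<Omega>0_def)
  have half: "cmod (feedback z w x) \<le> W / 2"
    if z: "z \<in> \<Omega>0" and w: "continuous_on {0..1} w" "\<And>t. t \<in> {0..1} \<Longrightarrow> cmod (w t) \<le> W" and x: "x \<in> {0..1}"
    for z w W x
  proof -
    have W: "W \<ge> 0" using order_trans[OF norm_ge_zero w(2)[of 0]] by simp
    have B: "B \<ge> 0" using z \<Omega>0 B_nonneg by blast
    have K: "(1 + B) * L1norm p \<ge> 0" using B Lp by simp
    have "cmod (feedback z w x) \<le> (1 + B) * L1norm p * e * W"
      by (rule feedback_norm_le[OF _ _ w x]) (use z \<mu>1 in \<open>auto simp: \<Omega>0_def \<mu>0_def\<close>)
    also have "\<dots> \<le> (1 / 2) * W"
    proof (rule mult_right_mono[OF _ W])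
      have "(1 + B) * L1norm p * e = (1 + B) * L1norm p / ((1 + B) * L1norm p + 1) * (1 / 2)"
        using B by (simp add: e_def)
      also have "\<dots> \<le> 1 * (1 / 2)"
        using K by (intro mult_right_mono) (auto simp: divide_le_eq_1)
      finally show "(1 + B) * L1norm p * e \<le> 1 / 2" by simp
    qed
    finally show ?thesis by simp
  qed
  define V where "V = (\<lambda>k z. (feedback z ^^ k) (fast z g))"
  have V0: "V 0 z = fast z g" and VS: "V (Suc k) z = feedback z (V k z)" for k z by (simp_all add: V_def)
  have Vc: "continuous_on {0..1} (V k z)" for k z
    by (induction k) (auto simp: V0 VS intro: feedback_continuous L1D_continuous[OF fast_L1D[OF g]])
  have Vb: "cmod (V k z x) \<le> \<eta> * (1 / 2) ^ k"
    if z: "z \<in> \<Omega>0" and \<eta>: "\<And>y. y \<in> {0..1} \<Longrightarrow> cmod (fast z g y) \<le> \<eta>" and x: "x \<in> {0..1}" for k z x \<eta>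
    using x
  proof (induction k arbitrary: x)
    case 0
    then show ?case using \<eta> by (simp add: V0)
  next
    case (Suc k)
    from half[OF z Vc Suc.IH Suc.prems] show ?case by (simp add: VS)
  qed
  have Gb: "cmod (fast z g y) \<le> \<bar>B\<bar> * L1norm g" if "z \<in> \<Omega>0" "y \<in> {0..1}" for z y
    using fast_norm_le'[OF _ g that(2), of z] that \<Omega>0 B_nonneg[of z] by (auto simp: subset_iff)
  have geo: "summable (\<lambda>k. C * (1 / 2) ^ k)" for C :: real
    by (intro summable_mult summable_geometric) auto
  define v where "v = (\<lambda>z x. \<Sum>k. V k z x)"
  have ul: "uniform_limit (\<Omega>0 \<times> {0..1}) (\<lambda>n (z, x). \<Sum>k<n. V k z x) (\<lambda>(z, x). v z x) sequentially"
  proof -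
    have "uniform_limit (\<Omega>0 \<times> {0..1}) (\<lambda>n y. \<Sum>k<n. V k (fst y) (snd y)) (\<lambda>y. \<Sum>k. V k (fst y) (snd y)) sequentially"
    proof (rule Weierstrass_m_test[OF _ geo[of "\<bar>B\<bar> * L1norm g"]])
      fix k and y :: "complex \<times> real" assume "y \<in> \<Omega>0 \<times> {0..1}"
      then have y: "fst y \<in> \<Omega>0" "snd y \<in> {0..1}" by auto
      show "cmod (V k (fst y) (snd y)) \<le> \<bar>B\<bar> * L1norm g * (1 / 2) ^ k"
        by (rule Vb[OF y(1) Gb[OF y(1)] y(2)])
    qed
    then show ?thesis by (simp add: v_def case_prod_unfold)
  qed
  have ulx: "uniform_limit {0..1} (\<lambda>n x. \<Sum>k<n. V k z x) (v z) sequentially" if "z \<in> \<Omega>0" for z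
    using uniform_limit_compose'[OF ul, of "\<lambda>x. (z, x)" "{0..1}"] that by (simp add: Pi_iff)
  have ulz: "uniform_limit \<Omega>0 (\<lambda>n z. \<Sum>k<n. V k z x) (\<lambda>z. v z x) sequentially" if "x \<in> {0..1}" for x
    using uniform_limit_compose'[OF ul, of "\<lambda>z. (z, x)" \<Omega>0] that by (simp add: Pi_iff)
  have vc: "continuous_on {0..1} (v z)" if "z \<in> \<Omega>0" for z
  proof (rule uniform_limit_theorem[OF _ ulx[OF that]])
    show "\<forall>\<^sub>F n in sequentially. continuous_on {0..1} (\<lambda>x. \<Sum>k<n. V k z x)"
      by (intro always_eventually allI continuous_intros Vc)
  qed simp
  have part: "(\<Sum>k<Suc n. V k z x) = fast z g x + feedback z (\<lambda>x. \<Sum>k<n. V k z x) x" if "x \<in> {0..1}" for n z x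
    using that
  proof (induction n arbitrary: x)
    case 0
    have "feedback z (\<lambda>x. 0) x = feedback z (\<lambda>x. 0) x + feedback z (\<lambda>x. 0) x"
      using feedback_add[of "\<lambda>x. 0" "\<lambda>x. 0" x z] 0 by simp
    then show ?case by (simp add: V0)
  next
    case (Suc n)
    have "(\<Sum>k<Suc (Suc n). V k z x) = fast z g x + (feedback z (\<lambda>x. \<Sum>k<n. V k z x) x + feedback z (V n z) x)"
      using Suc.IH[OF Suc.prems] by (simp only: sum.lessThan_Suc VS add.assoc)
    also have "feedback z (\<lambda>x. \<Sum>k<n. V k z x) x + feedback z (V n z) x = feedback z (\<lambda>x. (\<Sum>k<n. V k z x) + V n z x) x"
      by (rule feedback_add[symmetric, OF _ Vc Suc.prems]) (intro continuous_intros Vc)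
    finally show ?case by (simp only: sum.lessThan_Suc)
  qed
  have fp: "v z x = fast z g x + feedback z (v z) x" if z: "z \<in> \<Omega>0" and x: "x \<in> {0..1}" for z x
  proof -
    have l1: "(\<lambda>n. \<Sum>k<Suc n. V k z x) \<longlonglongrightarrow> v z x"
      using tendsto_uniform_limitI[OF ulx[OF z] x] by (subst filterlim_sequentially_Suc)
    have "(\<lambda>n. feedback z (\<lambda>x. \<Sum>k<n. V k z x) x) \<longlonglongrightarrow> feedback z (v z) x"
    proof (rule metric_LIMSEQ_I)
      fix r :: real assume r: "r > 0"
      have "\<forall>\<^sub>F n in sequentially. \<forall>t\<in>{0..1}. dist (\<Sum>k<n. V k z t) (v z t) < r"
        using uniform_limitD[OF ulx[OF z] r] .
      then obtain N where N: "\<And>n t. n \<ge> N \<Longrightarrow> t \<in> {0..1} \<Longrightarrow> dist (\<Sum>k<n. V k z t) (v z t) < r"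
        unfolding eventually_sequentially by blast
      show "\<exists>N. \<forall>n\<ge>N. dist (feedback z (\<lambda>x. \<Sum>k<n. V k z x) x) (feedback z (v z) x) < r"
      proof (intro exI[of _ N] allI impI)
        fix n assume n: "n \<ge> N"
        let ?w = "\<lambda>x. \<Sum>k<n. V k z x"
        have cw: "continuous_on {0..1} ?w" by (intro continuous_intros Vc)
        have "feedback z (v z) x = feedback z ?w x + feedback z (\<lambda>t. v z t - ?w t) x"
          using feedback_add[OF cw continuous_on_diff[OF vc[OF z] cw] x, of z] by simp
        moreover have "cmod (feedback z (\<lambda>t. v z t - ?w t) x) \<le> r / 2"
        proof (rule half[OF z continuous_on_diff[OF vc[OF z] cw] _ x])
          show "cmod (v z t - ?w t) \<le> r" if "t \<in> {0..1}" for t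
            using N[OF n that] by (simp add: dist_norm norm_minus_commute)
        qed
        ultimately show "dist (feedback z ?w x) (feedback z (v z) x) < r" using r by (simp add: dist_norm)
      qed
    qed
    then have "(\<lambda>n. \<Sum>k<Suc n. V k z x) \<longlonglongrightarrow> fast z g x + feedback z (v z) x"
      unfolding part[OF x] by (intro tendsto_intros)
    then show ?thesis using l1 LIMSEQ_unique by blast
  qed
  have vb: "cmod (v z x) \<le> 2 * \<eta>"
    if z: "z \<in> \<Omega>0" and \<eta>: "\<And>y. y \<in> {0..1} \<Longrightarrow> cmod (fast z g y) \<le> \<eta>" and x: "x \<in> {0..1}" for z x \<eta>
  proof -
    have "cmod (v z x) \<le> (\<Sum>k. \<eta> * (1 / 2) ^ k)"
      unfolding v_def by (rule norm_suminf_le[OF _ geo]) (rule Vb[OF z \<eta> x])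
    also have "\<dots> = 2 * \<eta>" by (subst suminf_mult) (auto simp: suminf_geometric intro: summable_geometric)
    finally show ?thesis .
  qed
  have Vhol: "(\<lambda>z. V k z x) holomorphic_on \<Omega>0" if "x \<in> {0..1}" for k x
    using that
  proof (induction k arbitrary: x)
    case 0
    from fast_holomorphic[OF \<Omega>0 g 0, of "\<lambda>_ _. 1" 1] show ?case by (simp add: V0)
  next
    case (Suc k)
    let ?W = "\<bar>B\<bar> * L1norm g * (1 / 2) ^ k"
    have "(\<lambda>z. slow (V k z) t) holomorphic_on \<Omega>0" if t: "t \<in> {0..1}" for t
      unfolding slow_def
    proof (rule holomorphic_on_integral_from[OF \<Omega>0(1) p d t])
      fix s assume "s \<in> closed_segment d t"
      then have s: "s \<in> {0..1}" using d t by (auto simp: closed_segment_eq_real_ivl split: if_splits)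
      show "(\<lambda>z. V k z s) holomorphic_on \<Omega>0" by (rule Suc.IH[OF s])
      show "cmod (V k z s) \<le> ?W" if "z \<in> \<Omega>0" for z by (rule Vb[OF that Gb[OF that] s])
    qed (rule Vc)
    then show ?case
      unfolding VS feedback_def
      by (intro fast_holomorphic[OF \<Omega>0 q Suc.prems, where M = "?W * L1norm p"] slow_continuous Vc slow_norm_le Vb Gb)
  qed
  have vhol: "(\<lambda>z. v z x) holomorphic_on \<Omega>0" if x: "x \<in> {0..1}" for x
  proof (rule holomorphic_uniform_sequence[OF \<Omega>0(1)])
    show "(\<lambda>z. \<Sum>k<n. V k z x) holomorphic_on \<Omega>0" for n by (intro holomorphic_intros Vhol x)
    fix y assume "y \<in> \<Omega>0"
    then obtain r where r: "r > 0" "cball y r \<subseteq> \<Omega>0" using \<Omega>0(1) open_contains_cball by blast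
    show "\<exists>d>0. cball y d \<subseteq> \<Omega>0 \<and> uniform_limit (cball y d) (\<lambda>n z. \<Sum>k<n. V k z x) (\<lambda>z. v z x) sequentially"
      using r uniform_limit_on_subset[OF ulz[OF x] r(2)] by blast
  qed
  have shol: "(\<lambda>z. slow (v z) x) holomorphic_on \<Omega>0" if x: "x \<in> {0..1}" for x
    unfolding slow_def
  proof (rule holomorphic_on_integral_from[OF \<Omega>0(1) p d x])
    fix s assume "s \<in> closed_segment d x"
    then have s: "s \<in> {0..1}" using d x by (auto simp: closed_segment_eq_real_ivl split: if_splits)
    show "(\<lambda>z. v z s) holomorphic_on \<Omega>0" by (rule vhol[OF s])
    show "cmod (v z s) \<le> 2 * (\<bar>B\<bar> * L1norm g)" if "z \<in> \<Omega>0" for z by (rule vb[OF that Gb[OF that] s])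
  qed (rule vc)
  show ?thesis
  proof (rule that[of \<mu>0 "\<lambda>z. slow (v z)" v])
    show "\<mu>0 \<ge> 0" by (simp add: \<mu>0_def)
    show "coupled_solution \<mu>0 g (\<lambda>z. slow (v z)) v"
      unfolding coupled_solution_def
    proof (intro conjI ballI impI allI)
      fix z assume "z \<in> \<Omega>" "cmod z > \<mu>0"
      then have z: "z \<in> \<Omega>0" by (simp add: \<Omega>0_def)
      show "slow (v z) has_L1_derivative (\<lambda>x. p x * v z x)" by (rule slow_L1D[OF vc[OF z]])
      have "(\<lambda>x. fast z g x + feedback z (v z) x) has_L1_derivative
          (\<lambda>x. (g x - z * of_real (\<alpha> x) * fast z g x) + (q x * slow (v z) x - z * of_real (\<alpha> x) * feedback z (v z) x))"
        unfolding feedback_def by (intro L1D_add fast_L1D g absint_q_slow vc z)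
      then show "v z has_L1_derivative (\<lambda>x. q x * slow (v z) x + g x - z * of_real (\<alpha> x) * v z x)"
        by (rule L1D_cong) (simp_all add: fp[OF z] algebra_simps)
      fix \<eta> x assume "\<forall>y\<in>{0..1}. cmod (fast z g y) \<le> \<eta>" and x: "x \<in> {0..1::real}"
      then have \<eta>: "\<And>y. y \<in> {0..1} \<Longrightarrow> cmod (fast z g y) \<le> \<eta>" by blast
      have \<eta>0: "\<eta> \<ge> 0" using order_trans[OF norm_ge_zero \<eta>[of 0]] by simp
      have 1: "cmod (v z x) \<le> 2 * \<eta>" by (rule vb[OF z \<eta> x])
      have 2: "cmod (slow (v z) x) \<le> 2 * \<eta> * L1norm p" by (rule slow_norm_le[OF vc[OF z] vb[OF z \<eta>] x])
      have eq: "2 * (1 + L1norm p) * \<eta> = 2 * \<eta> + 2 * \<eta> * L1norm p" by (simp add: algebra_simps)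
      have pos: "2 * \<eta> * L1norm p \<ge> 0" using \<eta>0 Lp by simp
      show "cmod (v z x) \<le> 2 * (1 + L1norm p) * \<eta>" "cmod (slow (v z) x) \<le> 2 * (1 + L1norm p) * \<eta>"
        unfolding eq using 1 2 \<eta>0 pos by linarith+
    next
      fix x :: real assume x: "x \<in> {0..1}"
      show "(\<lambda>z. v z x) holomorphic_on {z \<in> \<Omega>. cmod z > \<mu>0}"
        using vhol[OF x] unfolding \<Omega>0_def .
      show "(\<lambda>z. slow (v z) x) holomorphic_on {z \<in> \<Omega>. cmod z > \<mu>0}"
        using shol[OF x] unfolding \<Omega>0_def .
    qed
  qed
qed

end

section \<open>Columns and their expansions in inverse powers of the parameter\<close>

lemma L1D_sum:
  fixes f :: "nat \<Rightarrow> real \<Rightarrow> complex"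
  assumes "\<And>i. i < n \<Longrightarrow> f i has_L1_derivative f' i"
  shows "(\<lambda>x. \<Sum>i<n. f i x) has_L1_derivative (\<lambda>x. \<Sum>i<n. f' i x)"
  using assms
proof (induction n)
  case 0
  then show ?case using L1D_const[of 0] by simp
next
  case (Suc n)
  then show ?case using L1D_add[of "\<lambda>x. \<Sum>i<n. f i x" "\<lambda>x. \<Sum>i<n. f' i x" "f n" "f' n"] by simp
qed

text \<open>
  The entries of one column of the matrix \<open>R\<close>: \<open>u\<close> on the diagonal and \<open>v\<close> off it. The diagonal entry of
  \<open>I + R\<close> is \<open>1 + u\<close>, which accounts for the inhomogeneity.
\<close>

definition column_pair ::
  "complex set \<Rightarrow> (real \<Rightarrow> real) \<Rightarrow> (real \<Rightarrow> complex) \<Rightarrow> (real \<Rightarrow> complex) \<Rightarrow>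
   (complex \<Rightarrow> real \<Rightarrow> complex) \<Rightarrow> (complex \<Rightarrow> real \<Rightarrow> complex) \<Rightarrow> bool" where
  "column_pair \<Omega> \<alpha> p q u v \<longleftrightarrow>
     (\<forall>z\<in>\<Omega>. u z has_L1_derivative (\<lambda>x. p x * v z x) \<and>
           v z has_L1_derivative (\<lambda>x. q x * (1 + u z x) - z * of_real (\<alpha> x) * v z x)) \<and>
     (\<forall>x\<in>{0..1}. (\<lambda>z. u z x) holomorphic_on \<Omega> \<and> (\<lambda>z. v z x) holomorphic_on \<Omega>)"

lemma column_pair_subset: "column_pair \<Omega> \<alpha> p q u v \<Longrightarrow> \<Omega>' \<subseteq> \<Omega> \<Longrightarrow> column_pair \<Omega>' \<alpha> p q u v"
  unfolding column_pair_def by (blast intro: holomorphic_on_subset)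

text \<open>
  An expansion in \<open>1 / z\<close> up to an error \<open>o(z\<^sup>-\<^sup>n)\<close> that is uniform on \<open>[0,1]\<close>; the coefficient with index \<open>m\<close>
  belongs to the power \<open>m + 1\<close>.
\<close>

definition has_inverse_powers ::
  "complex set \<Rightarrow> nat \<Rightarrow> (complex \<Rightarrow> real \<Rightarrow> complex) \<Rightarrow> (nat \<Rightarrow> real \<Rightarrow> complex) \<Rightarrow> bool" where
  "has_inverse_powers \<Omega> n f r \<longleftrightarrow> (\<forall>e>0. \<exists>K. \<forall>z\<in>\<Omega>. cmod z > K \<longrightarrow> (\<forall>x\<in>{0..1}.
     cmod (z ^ n * (f z x - (\<Sum>m<n. r m x / z ^ Suc m))) \<le> e))"

lemma has_inverse_powers_cong:
  assumes "has_inverse_powers \<Omega> n f r" "\<And>m x. m < n \<Longrightarrow> x \<in> {0..1} \<Longrightarrow> r' m x = r m x"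
  shows "has_inverse_powers \<Omega> n f r'"
proof -
  have "(\<Sum>m<n. r' m x / z ^ Suc m) = (\<Sum>m<n. r m x / z ^ Suc m)" if "x \<in> {0..1}" for x z
    using assms(2)[OF _ that] by (intro sum.cong) simp_all
  then have "(\<forall>x\<in>{0..1}. cmod (z ^ n * (f z x - (\<Sum>m<n. r' m x / z ^ Suc m))) \<le> e) \<longleftrightarrow>
      (\<forall>x\<in>{0..1}. cmod (z ^ n * (f z x - (\<Sum>m<n. r m x / z ^ Suc m))) \<le> e)" for z e
    by (intro ball_cong refl) (simp only:)
  then show ?thesis using assms(1) unfolding has_inverse_powers_def by (simp only:)
qed

lemma has_inverse_powers_zero:
  assumes "\<And>z x. z \<in> \<Omega> \<Longrightarrow> cmod z > K \<Longrightarrow> x \<in> {0..1} \<Longrightarrow> f z x = 0"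
    and "\<And>m x. x \<in> {0..1} \<Longrightarrow> r m x = 0"
  shows "has_inverse_powers \<Omega> n f r"
  unfolding has_inverse_powers_def by (intro allI impI exI[of _ K] ballI) (simp add: assms)

context fast_kernel
begin

text \<open>
  Integrating \<open>w' = q - z \<alpha> w\<close> for \<open>w = fast z q\<close> recovers a fixed nonzero number from \<open>w\<close> at the cost of a
  factor \<open>O(z)\<close>. So \<open>\<Upsilon>\<close>, which majorises \<open>fast z q\<close>, cannot decay faster than \<open>1 / \<bar>z\<bar>\<close> unless \<open>q\<close> vanishes, and
  otherwise every matrix \<open>R\<close> of size \<open>O(1/z)\<close> satisfies the bound by \<open>\<Upsilon>\<close>.
\<close>

lemma fast_lower_bound:
  assumes q: "q absolutely_integrable_on {0..1}" and x0: "x0 \<in> {0..1}" "integral_from c q x0 \<noteq> 0"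
  obtains k where "k > 0"
    "\<And>z \<eta>. cmod z \<ge> 1 \<Longrightarrow> (\<And>y. y \<in> {0..1} \<Longrightarrow> cmod (fast z q y) \<le> \<eta>) \<Longrightarrow> k / cmod z \<le> \<eta>"
proof -
  define A where "A = L1norm (\<lambda>x. complex_of_real (\<alpha> x))"
  have A: "A \<ge> 0" unfolding A_def by (rule L1norm_nonneg[OF \<alpha>c])
  show ?thesis
  proof (rule that[of "cmod (integral_from c q x0) / (1 + A)"])
    show "cmod (integral_from c q x0) / (1 + A) > 0" using x0 A by simp
    fix z :: complex and \<eta> assume z: "cmod z \<ge> 1" and \<eta>: "\<And>y. y \<in> {0..1} \<Longrightarrow> cmod (fast z q y) \<le> \<eta>"
    have \<eta>0: "\<eta> \<ge> 0" using order_trans[OF norm_ge_zero \<eta>[of 0]] by simp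
    have cS: "continuous_on {0..1} (fast z q)" by (rule L1D_continuous[OF fast_L1D[OF q]])
    have i: "(\<lambda>x. complex_of_real (\<alpha> x) * fast z q x) absolutely_integrable_on {0..1}"
      by (rule absint_continuous_mult(2)[OF cS \<alpha>c])
    have "(\<lambda>x. fast z q x + z * integral_from c (\<lambda>x. complex_of_real (\<alpha> x) * fast z q x) x) has_L1_derivative
      (\<lambda>x. (q x - z * of_real (\<alpha> x) * fast z q x) + z * (of_real (\<alpha> x) * fast z q x))"
      by (intro L1D_add L1D_cmult fast_L1D q integral_from_L1D i)
    then have "(\<lambda>x. fast z q x + z * integral_from c (\<lambda>x. complex_of_real (\<alpha> x) * fast z q x) x) has_L1_derivative q"
      by (rule L1D_cong) (simp_all add: mult.assoc)
    from integral_from_eq[OF this x0(1) c]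
    have eq: "integral_from c q x0 = fast z q x0 + z * integral_from c (\<lambda>x. complex_of_real (\<alpha> x) * fast z q x) x0"
      by simp
    have "cmod (integral_from c (\<lambda>x. complex_of_real (\<alpha> x) * fast z q x) x0) \<le> \<eta> * A"
      unfolding A_def
    proof (rule integral_from_norm_le[OF i \<alpha>c c x0(1) \<eta>0])
      fix t assume "t \<in> closed_segment c x0"
      then have "cmod (fast z q t) \<le> \<eta>" by (intro \<eta> segment_in_unit_interval[OF x0(1)])
      then show "cmod (complex_of_real (\<alpha> t) * fast z q t) \<le> \<eta> * cmod (complex_of_real (\<alpha> t))"
        unfolding norm_mult mult.commute[of \<eta>] by (rule mult_left_mono) simp
    qed
    then have "cmod (z * integral_from c (\<lambda>x. complex_of_real (\<alpha> x) * fast z q x) x0) \<le> cmod z * (\<eta> * A)"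
      unfolding norm_mult by (rule mult_left_mono) simp
    then have "cmod (integral_from c q x0) \<le> \<eta> + cmod z * (\<eta> * A)"
      unfolding eq using \<eta>[OF x0(1)] by (intro norm_triangle_le) linarith
    also have "\<dots> \<le> cmod z * \<eta> + cmod z * (\<eta> * A)"
      using mult_right_mono[OF z \<eta>0] by simp
    also have "\<dots> = \<eta> * cmod z * (1 + A)" by (simp add: algebra_simps)
    finally have "cmod (integral_from c q x0) / (1 + A) \<le> \<eta> * cmod z"
      using A by (simp add: pos_divide_le_eq)
    then show "cmod (integral_from c q x0) / (1 + A) / cmod z \<le> \<eta>"
      using z by (subst pos_divide_le_eq) auto
  qed
qed

end

context fast_slow
begin

text \<open>
  Inserting \<open>1 + u\<close> in place of \<open>u\<close> adds the term \<open>q\<close>, so this is the coupled system with \<open>g = q\<close>.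
\<close>

lemma column_pair_exists:
  obtains \<mu>0 u v C where "\<mu>0 \<ge> 0" "C \<ge> 0" "column_pair {z \<in> \<Omega>. cmod z > \<mu>0} \<alpha> p q u v"
    "\<And>z x \<eta>. z \<in> \<Omega> \<Longrightarrow> cmod z > \<mu>0 \<Longrightarrow> (\<And>y. y \<in> {0..1} \<Longrightarrow> cmod (fast z q y) \<le> \<eta>) \<Longrightarrow> x \<in> {0..1}
       \<Longrightarrow> cmod (u z x) \<le> C * \<eta> \<and> cmod (v z x) \<le> C * \<eta>"
proof -
  obtain \<mu>0 u v where s: "\<mu>0 \<ge> 0" "coupled_solution \<mu>0 q u v"
    by (rule coupled_solution_exists[OF q])
  have Lp: "L1norm p \<ge> 0" using L1norm_nonneg p by auto
  show ?thesis
  proof (rule that[of \<mu>0 "2 * (1 + L1norm p)" u v])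
    show "column_pair {z \<in> \<Omega>. cmod z > \<mu>0} \<alpha> p q u v"
      unfolding column_pair_def
    proof (intro conjI ballI)
      fix z assume "z \<in> {z \<in> \<Omega>. cmod z > \<mu>0}"
      then have z: "z \<in> \<Omega>" "cmod z > \<mu>0" by auto
      show "u z has_L1_derivative (\<lambda>x. p x * v z x)" by (rule coupled_solutionD(1)[OF s(2) z])
      show "v z has_L1_derivative (\<lambda>x. q x * (1 + u z x) - z * of_real (\<alpha> x) * v z x)"
        by (rule L1D_cong[OF coupled_solutionD(2)[OF s(2) z]]) (simp_all add: distrib_left)
    qed (use s(2) in \<open>simp_all add: coupled_solution_def\<close>)
    show "cmod (u z x) \<le> 2 * (1 + L1norm p) * \<eta> \<and> cmod (v z x) \<le> 2 * (1 + L1norm p) * \<eta>"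
      if "z \<in> \<Omega>" "cmod z > \<mu>0" "\<And>y. y \<in> {0..1} \<Longrightarrow> cmod (fast z q y) \<le> \<eta>" "x \<in> {0..1}" for z x \<eta>
      by (rule coupled_solutionD(3)[OF s(2) that])
  qed (use s(1) Lp in simp_all)
qed

text \<open>
  The recursion for \<open>r\<close> is chosen so that inserting the truncated series into the equation cancels all powers
  of \<open>1 / z\<close> except the last one. Here \<open>U\<close> and \<open>V\<close> are the remainders multiplied by \<open>z ^ n\<close>, and the
  inhomogeneity \<open>Q * s (n - 1) - r' (n - 1)\<close> of their system is free of \<open>z\<close>.
\<close>

lemma formal_residual:
  fixes r r' :: "nat \<Rightarrow> complex"
  assumes n: "n > 0" and z: "z \<noteq> 0" and A: "A * r 0 = Q"
    and rec: "\<And>m. Suc m < n \<Longrightarrow> A * r (Suc m) = Q * s m - r' m"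
  shows "(\<Sum>m<n. r' m / z ^ Suc m) + (Q * (U / z ^ n) + (Q * s (n - 1) - r' (n - 1)) / z ^ n - z * A * (V / z ^ n)) =
     Q * (1 + ((\<Sum>m<n. s m / z ^ Suc m) + U / z ^ n)) - z * A * ((\<Sum>m<n. r m / z ^ Suc m) + V / z ^ n)"
proof -
  obtain N where N: "n = Suc N" using n gr0_conv_Suc by blast
  have "(\<Sum>m<n. Q * s m / z ^ Suc m) - (\<Sum>m<n. r' m / z ^ Suc m) = (\<Sum>m<n. (Q * s m - r' m) / z ^ Suc m)"
    by (simp add: sum_subtractf diff_divide_distrib)
  also have "\<dots> = (\<Sum>m<N. (Q * s m - r' m) / z ^ Suc m) + (Q * s N - r' N) / z ^ n"
    by (simp add: N)
  also have "(\<Sum>m<N. (Q * s m - r' m) / z ^ Suc m) = (\<Sum>m<N. A * r (Suc m) / z ^ Suc m)"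
    by (rule sum.cong[OF refl]) (use rec N in simp)
  also have "\<dots> = (\<Sum>m<n. A * r m / z ^ m) - Q"
    unfolding N sum.lessThan_Suc_shift by (simp add: A)
  also have "(\<Sum>m<n. A * r m / z ^ m) = z * A * (\<Sum>m<n. r m / z ^ Suc m)"
    unfolding sum_distrib_left by (rule sum.cong[OF refl]) (use z in \<open>simp add: field_simps\<close>)
  finally have key: "(\<Sum>m<n. Q * s m / z ^ Suc m) - (\<Sum>m<n. r' m / z ^ Suc m) =
     z * A * (\<Sum>m<n. r m / z ^ Suc m) - Q + (Q * s N - r' N) / z ^ n" .
  have "Q * (\<Sum>m<n. s m / z ^ Suc m) = (\<Sum>m<n. Q * s m / z ^ Suc m)"
    by (simp add: sum_distrib_left)
  then show ?thesis using key N by (simp add: algebra_simps)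
qed

text \<open>
  The remainders of the truncated series, multiplied by \<open>z ^ n\<close>, solve the coupled system with a fixed
  integrable \<open>g\<close>; by \<open>fast_tendsto_0\<close> they tend to 0. The series need not vanish at the point \<open>c\<close>, so
  the solution is normalised there by the series and differs from that of \<open>column_pair_exists\<close>.
\<close>

lemma column_pair_expansion:
  assumes n: "n > 0"
    and rL: "\<And>m. m < n \<Longrightarrow> r m has_L1_derivative r' m"
    and r0: "\<And>x. x \<in> {0..1} \<Longrightarrow> of_real (\<alpha> x) * r 0 x = q x"
    and rec: "\<And>m x. Suc m < n \<Longrightarrow> x \<in> {0..1} \<Longrightarrow> of_real (\<alpha> x) * r (Suc m) x = q x * slow (r m) x - r' m x"
  obtains \<mu>0 u v C where "\<mu>0 \<ge> 1" "C \<ge> 0" "column_pair {z \<in> \<Omega>. cmod z > \<mu>0} \<alpha> p q u v"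
    "\<And>z x. z \<in> \<Omega> \<Longrightarrow> cmod z > \<mu>0 \<Longrightarrow> x \<in> {0..1} \<Longrightarrow> cmod (u z x) \<le> C / cmod z \<and> cmod (v z x) \<le> C / cmod z"
    "has_inverse_powers \<Omega> n u (\<lambda>m. slow (r m))" "has_inverse_powers \<Omega> n v r"
proof -
  define g where "g = (\<lambda>x. q x * slow (r (n - 1)) x - r' (n - 1) x)"
  have rc: "continuous_on {0..1} (r m)" if "m < n" for m by (rule L1D_continuous[OF rL[OF that]])
  have g: "g absolutely_integrable_on {0..1}"
    unfolding g_def using n by (intro set_integral_diff(1) absint_q_slow rc L1D_absint[OF rL]) auto
  obtain \<mu>0 u0 v0 where s: "\<mu>0 \<ge> 0" "coupled_solution \<mu>0 g u0 v0"
    by (rule coupled_solution_exists[OF g])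
  have Lp: "L1norm p \<ge> 0" using L1norm_nonneg p by auto
  define u where "u = (\<lambda>z x. (\<Sum>m<n. slow (r m) x / z ^ Suc m) + u0 z x / z ^ n)"
  define v where "v = (\<lambda>z x. (\<Sum>m<n. r m x / z ^ Suc m) + v0 z x / z ^ n)"
  have small: "\<exists>\<mu>1\<ge>\<mu>0. \<forall>z\<in>\<Omega>. cmod z > \<mu>1 \<longrightarrow> (\<forall>x\<in>{0..1}. cmod (u0 z x) \<le> e \<and> cmod (v0 z x) \<le> e)"
    if e: "e > 0" for e
  proof -
    define e' where "e' = e / (2 * (1 + L1norm p))"
    have e': "e' > 0" "2 * (1 + L1norm p) * e' = e" using e Lp by (auto simp: e'_def field_simps add_nonneg_eq_0_iff)
    obtain \<mu>1 where \<mu>1: "\<And>z x. z \<in> \<Omega> \<Longrightarrow> cmod z > \<mu>1 \<Longrightarrow> x \<in> {0..1} \<Longrightarrow> cmod (fast z g x) \<le> e'"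
      using fast_tendsto_0[OF g e'(1)] by blast
    show ?thesis
    proof (intro exI[of _ "max \<mu>0 \<mu>1"] conjI ballI impI)
      fix z x assume z: "z \<in> \<Omega>" "cmod z > max \<mu>0 \<mu>1" and x: "x \<in> {0..1::real}"
      then have z': "cmod z > \<mu>0" "cmod z > \<mu>1" by auto
      from coupled_solutionD(3)[OF s(2) z(1) z'(1) \<mu>1[OF z(1) z'(2)] x]
      show "cmod (u0 z x) \<le> e" "cmod (v0 z x) \<le> e" unfolding e'(2) by auto
    qed simp
  qed
  obtain \<mu>2 where \<mu>2: "\<mu>2 \<ge> \<mu>0"
    "\<And>z x. z \<in> \<Omega> \<Longrightarrow> cmod z > \<mu>2 \<Longrightarrow> x \<in> {0..1} \<Longrightarrow> cmod (u0 z x) \<le> 1 \<and> cmod (v0 z x) \<le> 1"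
    using small[of 1] by auto
  have bdd: "\<exists>M\<ge>0. \<forall>x\<in>{0..1}. cmod (f x) \<le> M" if "continuous_on {0..1} f" for f :: "real \<Rightarrow> complex"
  proof -
    have "bounded (f ` {0..1})" using that compact_continuous_image compact_imp_bounded by blast
    then obtain M where "\<forall>x\<in>{0..1}. cmod (f x) \<le> M" unfolding bounded_iff by blast
    then show ?thesis by (intro exI[of _ "max M 0"]) (auto intro: max.coboundedI1)
  qed
  have "\<exists>M\<ge>0. \<forall>x\<in>{0..1}. cmod (r m x) \<le> M" if "m < n" for m by (rule bdd[OF rc[OF that]])
  then obtain M1 where M1: "\<And>m. m < n \<Longrightarrow> M1 m \<ge> 0" "\<And>m x. m < n \<Longrightarrow> x \<in> {0..1} \<Longrightarrow> cmod (r m x) \<le> M1 m"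
    by metis
  have "\<exists>M\<ge>0. \<forall>x\<in>{0..1}. cmod (slow (r m) x) \<le> M" if "m < n" for m by (rule bdd[OF slow_continuous[OF rc[OF that]]])
  then obtain M2 where M2: "\<And>m. m < n \<Longrightarrow> M2 m \<ge> 0" "\<And>m x. m < n \<Longrightarrow> x \<in> {0..1} \<Longrightarrow> cmod (slow (r m) x) \<le> M2 m"
    by metis
  define C where "C = (\<Sum>m<n. M1 m + M2 m) + 1"
  have sumbound: "cmod ((\<Sum>m<n. y m / z ^ Suc m) + w / z ^ n) \<le> C / cmod z"
    if z: "cmod z \<ge> 1" and y: "\<And>m. m < n \<Longrightarrow> cmod (y m) \<le> M1 m + M2 m" and w: "cmod w \<le> 1"
    for z w and y :: "nat \<Rightarrow> complex"
  proof -
    have zp: "cmod z > 0" using z by linarith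
    have term_le: "cmod (y' / z ^ Suc m) \<le> K / cmod z" if "cmod y' \<le> K" for y' K m
    proof -
      have "1 \<le> cmod z ^ m" using z by (rule one_le_power)
      then have "cmod z \<le> cmod z ^ Suc m" using zp by simp
      then have "cmod y' / cmod z ^ Suc m \<le> cmod y' / cmod z"
        using zp by (intro divide_left_mono) auto
      also have "\<dots> \<le> K / cmod z" using that zp by (intro divide_right_mono) auto
      finally show ?thesis by (simp add: norm_divide norm_power norm_mult)
    qed
    obtain N where N: "n = Suc N" using n gr0_conv_Suc by blast
    have "cmod ((\<Sum>m<n. y m / z ^ Suc m) + w / z ^ n) \<le> (\<Sum>m<n. cmod (y m / z ^ Suc m)) + cmod (w / z ^ n)"
      by (rule order_trans[OF norm_triangle_ineq add_right_mono[OF norm_sum]])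
    also have "\<dots> \<le> (\<Sum>m<n. (M1 m + M2 m) / cmod z) + 1 / cmod z"
      unfolding N by (rule add_mono[OF sum_mono]) (use y w N in \<open>auto intro!: term_le simp del: power_Suc\<close>)
    also have "\<dots> = C / cmod z" by (simp add: C_def sum_divide_distrib add_divide_distrib)
    finally show ?thesis .
  qed
  define \<mu>3 where "\<mu>3 = max 1 \<mu>2"
  show ?thesis
  proof (rule that[of \<mu>3 C u v])
    show "\<mu>3 \<ge> 1" by (simp add: \<mu>3_def)
    show "C \<ge> 0" unfolding C_def using M1(1) M2(1) by (intro add_nonneg_nonneg sum_nonneg) auto
    show "column_pair {z \<in> \<Omega>. cmod z > \<mu>3} \<alpha> p q u v"
      unfolding column_pair_def
    proof (intro conjI ballI)
      fix z assume "z \<in> {z \<in> \<Omega>. cmod z > \<mu>3}"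
      then have z: "z \<in> \<Omega>" "cmod z > \<mu>0" and z0: "z \<noteq> 0" using \<mu>2(1) by (auto simp: \<mu>3_def)
      have "(\<lambda>x. (\<Sum>m<n. (1 / z ^ Suc m) * slow (r m) x) + (1 / z ^ n) * u0 z x) has_L1_derivative
         (\<lambda>x. (\<Sum>m<n. (1 / z ^ Suc m) * (p x * r m x)) + (1 / z ^ n) * (p x * v0 z x))"
        by (intro L1D_add L1D_sum L1D_cmult slow_L1D rc coupled_solutionD(1)[OF s(2) z])
      then show "u z has_L1_derivative (\<lambda>x. p x * v z x)"
        by (rule L1D_cong) (simp_all add: u_def v_def distrib_left sum_distrib_left mult.left_commute)
      have "(\<lambda>x. (\<Sum>m<n. (1 / z ^ Suc m) * r m x) + (1 / z ^ n) * v0 z x) has_L1_derivative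
         (\<lambda>x. (\<Sum>m<n. (1 / z ^ Suc m) * r' m x) + (1 / z ^ n) * (q x * u0 z x + g x - z * of_real (\<alpha> x) * v0 z x))"
        by (intro L1D_add L1D_sum L1D_cmult rL coupled_solutionD(2)[OF s(2) z])
      then show "v z has_L1_derivative (\<lambda>x. q x * (1 + u z x) - z * of_real (\<alpha> x) * v z x)"
      proof (rule L1D_cong)
        fix x :: real assume x: "x \<in> {0..1}"
        have "q x * (1 + u z x) - z * of_real (\<alpha> x) * v z x =
          (\<Sum>m<n. r' m x / z ^ Suc m) + (q x * (u0 z x / z ^ n) + g x / z ^ n - z * of_real (\<alpha> x) * (v0 z x / z ^ n))"
          unfolding u_def v_def g_def
          by (rule formal_residual[OF n z0, symmetric]) (use r0[OF x] rec[OF _ x] in auto)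
        then show "q x * (1 + u z x) - z * of_real (\<alpha> x) * v z x =
          (\<Sum>m<n. (1 / z ^ Suc m) * r' m x) + (1 / z ^ n) * (q x * u0 z x + g x - z * of_real (\<alpha> x) * v0 z x)"
          by (simp add: algebra_simps add_divide_distrib diff_divide_distrib)
      qed (simp add: v_def)
    next
      fix x :: real assume x: "x \<in> {0..1}"
      have sub: "{z \<in> \<Omega>. cmod z > \<mu>3} \<subseteq> {z \<in> \<Omega>. cmod z > \<mu>0}" using \<mu>2(1) by (auto simp: \<mu>3_def)
      have hol: "(\<lambda>z. u0 z x) holomorphic_on {z \<in> \<Omega>. cmod z > \<mu>0}" "(\<lambda>z. v0 z x) holomorphic_on {z \<in> \<Omega>. cmod z > \<mu>0}"
        using s(2) x by (simp_all add: coupled_solution_def)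
      have nz: "z ^ k \<noteq> 0" if "z \<in> {z \<in> \<Omega>. cmod z > \<mu>3}" for z k using that by (auto simp: \<mu>3_def)
      show "(\<lambda>z. u z x) holomorphic_on {z \<in> \<Omega>. cmod z > \<mu>3}"
        unfolding u_def using holomorphic_on_subset[OF hol(1) sub] nz by (intro holomorphic_intros)
      show "(\<lambda>z. v z x) holomorphic_on {z \<in> \<Omega>. cmod z > \<mu>3}"
        unfolding v_def using holomorphic_on_subset[OF hol(2) sub] nz by (intro holomorphic_intros)
    qed
    show "cmod (u z x) \<le> C / cmod z \<and> cmod (v z x) \<le> C / cmod z"
      if z: "z \<in> \<Omega>" "cmod z > \<mu>3" and x: "x \<in> {0..1}" for z x
    proof -
      have z1: "cmod z \<ge> 1" "cmod z > \<mu>2" using z by (auto simp: \<mu>3_def)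
      have y1: "cmod (slow (r m) x) \<le> M1 m + M2 m" if "m < n" for m
        using M2(2)[OF that x] M1(1)[OF that] by linarith
      have y2: "cmod (r m x) \<le> M1 m + M2 m" if "m < n" for m
        using M1(2)[OF that x] M2(1)[OF that] by linarith
      show ?thesis unfolding u_def v_def
        using sumbound[OF z1(1) y1] sumbound[OF z1(1) y2] \<mu>2(2)[OF z(1) z1(2) x] by simp
    qed
    have "\<exists>K. \<forall>z\<in>\<Omega>. cmod z > K \<longrightarrow> (\<forall>x\<in>{0..1}.
        cmod (z ^ n * (u z x - (\<Sum>m<n. slow (r m) x / z ^ Suc m))) \<le> e \<and>
        cmod (z ^ n * (v z x - (\<Sum>m<n. r m x / z ^ Suc m))) \<le> e)" if e: "e > 0" for e
    proof -
      obtain K where K: "K \<ge> \<mu>0"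
        "\<And>z x. z \<in> \<Omega> \<Longrightarrow> cmod z > K \<Longrightarrow> x \<in> {0..1} \<Longrightarrow> cmod (u0 z x) \<le> e \<and> cmod (v0 z x) \<le> e"
        using small[OF e] by blast
      show ?thesis
      proof (intro exI[of _ K] ballI impI)
        fix z x assume z: "z \<in> \<Omega>" "cmod z > K" and x: "x \<in> {0..1::real}"
        have "z \<noteq> 0" using z K(1) s(1) by auto
        then have "z ^ n * (u z x - (\<Sum>m<n. slow (r m) x / z ^ Suc m)) = u0 z x"
          "z ^ n * (v z x - (\<Sum>m<n. r m x / z ^ Suc m)) = v0 z x"
          by (simp_all add: u_def v_def)
        then show "cmod (z ^ n * (u z x - (\<Sum>m<n. slow (r m) x / z ^ Suc m))) \<le> e \<and>
          cmod (z ^ n * (v z x - (\<Sum>m<n. r m x / z ^ Suc m))) \<le> e"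
          using K(2)[OF z x] by simp
      qed
    qed
    then show "has_inverse_powers \<Omega> n u (\<lambda>m. slow (r m))" "has_inverse_powers \<Omega> n v r"
      unfolding has_inverse_powers_def by blast+
  qed
qed

end

section \<open>Sobolev classes and the coefficients\<close>

text \<open>
  The class \<open>W\<^sub>1\<^sup>k[0,1]\<close> as \<open>k\<close>-fold primitives of integrable functions, a form suited to induction on \<open>k\<close>.
\<close>

primrec W1 :: "nat \<Rightarrow> (real \<Rightarrow> complex) \<Rightarrow> bool" where
  "W1 0 f \<longleftrightarrow> f absolutely_integrable_on {0..1}"
| "W1 (Suc k) f \<longleftrightarrow> (\<exists>f'. f has_L1_derivative f' \<and> W1 k f')"

lemma W1_Suc_continuous: "W1 (Suc k) f \<Longrightarrow> continuous_on {0..1} f"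
  using L1D_continuous by auto

lemma W1_Suc_imp: "W1 (Suc k) f \<Longrightarrow> W1 k f"
proof (induction k arbitrary: f)
  case 0
  then have "continuous_on {0..1} f" by (rule W1_Suc_continuous)
  then show ?case by (simp add: absolutely_integrable_continuous_real)
next
  case (Suc k)
  then obtain f' where "f has_L1_derivative f'" "W1 (Suc k) f'" by auto
  then show ?case using Suc.IH[of f'] by auto
qed

lemma W1_mono:
  assumes "W1 k f" "j \<le> k"
  shows "W1 j f"
  using assms(2,1) by (induction rule: inc_induct) (simp_all only: W1_Suc_imp)

lemma W1_cong:
  assumes "W1 k f" "\<And>x. x \<in> {0..1} \<Longrightarrow> g x = f x"
  shows "W1 k g"
proof (cases k)
  case 0
  then show ?thesis using assms set_integrable_cong[of lebesgue lebesgue "{0..1}" "{0..1}" g f] by simp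
next
  case (Suc j)
  then obtain f' where "f has_L1_derivative f'" "W1 j f'" using assms by auto
  then show ?thesis using L1D_cong[of f f' g f'] assms(2) Suc by auto
qed

lemma W1_const: "W1 k (\<lambda>x. c)"
  by (induction k arbitrary: c) (auto intro!: exI[of _ "\<lambda>x. 0"] L1D_const)

lemma W1_add: "W1 k f \<Longrightarrow> W1 k g \<Longrightarrow> W1 k (\<lambda>x. f x + g x)"
proof (induction k arbitrary: f g)
  case 0
  then show ?case by (simp add: set_integral_add(1))
next
  case (Suc k)
  then obtain f' g' where "f has_L1_derivative f'" "W1 k f'" "g has_L1_derivative g'" "W1 k g'" by auto
  then show ?case using L1D_add[of f f' g g'] Suc.IH[of f' g'] by auto
qed

text \<open>
  The asymmetric form is what the product rule asks for: in \<open>f' * g\<close> one factor has a derivative less than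
  the other. For \<open>k = 0\<close> it says that integrable times continuous is integrable.
\<close>

lemma W1_mult_lower: "W1 k f \<Longrightarrow> W1 (Suc k) g \<Longrightarrow> W1 k (\<lambda>x. f x * g x)"
proof (induction k arbitrary: f g)
  case 0
  then show ?case using absint_continuous_mult(2)[OF W1_Suc_continuous[of 0 g], of f] by simp
next
  case (Suc k)
  obtain f' where f': "f has_L1_derivative f'" "W1 k f'" using Suc.prems by auto
  obtain g' where g': "g has_L1_derivative g'" "W1 (Suc k) g'" using Suc.prems by auto
  have "W1 k (\<lambda>x. f' x * g x)" by (rule Suc.IH[OF f'(2) W1_Suc_imp[OF Suc.prems(2)]])
  moreover have "W1 k (\<lambda>x. f x * g' x)"
    using Suc.IH[OF W1_Suc_imp[OF g'(2)] Suc.prems(1)] by (simp only: mult.commute)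
  ultimately have "W1 k (\<lambda>x. f' x * g x + f x * g' x)" by (rule W1_add)
  then show ?case using L1D_mult[OF f'(1) g'(1)] by auto
qed

lemma W1_mult:
  assumes f: "W1 (Suc k) f" and g: "W1 (Suc k) g"
  shows "W1 (Suc k) (\<lambda>x. f x * g x)"
proof -
  obtain f' where f': "f has_L1_derivative f'" "W1 k f'" using f by auto
  obtain g' where g': "g has_L1_derivative g'" "W1 k g'" using g by auto
  have "W1 k (\<lambda>x. f' x * g x)" by (rule W1_mult_lower[OF f'(2) g])
  moreover have "W1 k (\<lambda>x. f x * g' x)"
    using W1_mult_lower[OF g'(2) f] by (simp only: mult.commute)
  ultimately have "W1 k (\<lambda>x. f' x * g x + f x * g' x)" by (rule W1_add)
  then show ?thesis using L1D_mult[OF f'(1) g'(1)] by auto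
qed

lemma W1_cmult: "W1 k f \<Longrightarrow> W1 k (\<lambda>x. c * f x)"
  using W1_mult_lower[OF _ W1_const, of k f c] by (simp add: mult.commute)

lemma W1_diff: "W1 k f \<Longrightarrow> W1 k g \<Longrightarrow> W1 k (\<lambda>x. f x - g x)"
  using W1_add[OF _ W1_cmult[of k g "-1"], of f] by simp

lemma W1_exp: "W1 (Suc k) f \<Longrightarrow> W1 (Suc k) (\<lambda>x. exp (f x))"
proof (induction k)
  case 0
  then obtain f' where f': "f has_L1_derivative f'" by auto
  then show ?case using L1D_exp[OF f'] L1D_absint by auto
next
  case (Suc k)
  then obtain f' where f': "f has_L1_derivative f'" "W1 (Suc k) f'" by auto
  have "W1 (Suc k) (\<lambda>x. exp (f x))" by (rule Suc.IH[OF W1_Suc_imp[OF Suc.prems]])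
  from W1_mult[OF this f'(2)] show ?case using L1D_exp[OF f'(1)] by (subst W1.simps) blast
qed

lemma W1_inverse:
  assumes "W1 (Suc k) f" and \<epsilon>: "\<epsilon> > 0" "\<And>x. x \<in> {0..1} \<Longrightarrow> norm (f x) \<ge> \<epsilon>"
  shows "W1 (Suc k) (\<lambda>x. inverse (f x))"
  using assms(1)
proof (induction k)
  case 0
  then obtain f' where f': "f has_L1_derivative f'" by auto
  then show ?case using L1D_inverse[OF f' \<epsilon>] L1D_absint by auto
next
  case (Suc k)
  then obtain f' where f': "f has_L1_derivative f'" "W1 (Suc k) f'" by auto
  have i: "W1 (Suc k) (\<lambda>x. inverse (f x))" by (rule Suc.IH[OF W1_Suc_imp[OF Suc.prems]])
  have "W1 (Suc k) (\<lambda>x. (-1) * (inverse (f x) * inverse (f x)) * f' x)"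
    by (intro W1_mult W1_cmult i f'(2))
  then have "W1 (Suc k) (\<lambda>x. - (inverse (f x) * inverse (f x)) * f' x)" by simp
  then show ?case using L1D_inverse[OF f'(1) \<epsilon>] by (subst W1.simps) blast
qed

lemma W1_integral_from: "W1 k f \<Longrightarrow> W1 (Suc k) (integral_from c f)"
  using integral_from_L1D[of f c] W1_mono[of k f 0] by auto

lemma L1D_has_vector_derivative:
  assumes f: "f has_L1_derivative f'" and c: "continuous_on {0..1} f'" and x: "x \<in> {0..1}"
  shows "(f has_vector_derivative f' x) (at x within {0..1})"
proof -
  have "((\<lambda>x. integral {0..x} f') has_vector_derivative f' x) (at x within {0..1})"
    by (rule integral_has_vector_derivative[OF c x])
  from has_vector_derivative_add[OF has_vector_derivative_const[of "f 0"] this]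
  have *: "((\<lambda>x. f 0 + integral {0..x} f') has_vector_derivative f' x) (at x within {0..1})" by simp
  show ?thesis
    by (rule has_vector_derivative_transform[OF x _ *]) (rule L1D_eq[OF f])
qed

lemma L1D_vector_derivative:
  assumes f: "f has_L1_derivative f'" and c: "continuous_on {0..1} f'" and x: "x \<in> {0..1}"
  shows "vector_derivative f (at x within {0..1}) = f' x"
  using vector_derivative_within_cbox[of 0 1 x f "f' x"] L1D_has_vector_derivative[OF assms] x by simp

lemma sobolev_W1_imp_W1:
  fixes T :: "'a::euclidean_space \<Rightarrow> complex"
  assumes "sobolev_W1 k f" and T: "bounded_linear T"
  shows "W1 k (\<lambda>x. T (f x))"
  using assms(1)
proof (induction k arbitrary: f)
  case 0
  then obtain F where F: "\<forall>x\<in>{0..1}. F 0 x = f x" "F 0 absolutely_integrable_on {0..1}"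
    unfolding sobolev_W1_def by (elim exE conjE) (rule that; assumption)
  have "(\<lambda>x. T (F 0 x)) absolutely_integrable_on {0..1}"
    using absolutely_integrable_linear[OF F(2) T] by (simp add: o_def)
  then have "W1 0 (\<lambda>x. T (F 0 x))" by simp
  then show ?case by (rule W1_cong) (use F(1) in auto)
next
  case (Suc k)
  from Suc.prems obtain F where F':
    "\<forall>x\<in>{0..1}. F 0 x = f x" "\<forall>s<Suc k. absolutely_continuous_on {0..1} (F s)"
    "\<forall>s. Suc s < Suc k \<longrightarrow> (\<forall>x\<in>{0..1}. (F s has_vector_derivative F (Suc s) x) (at x within {0..1}))"
    "\<forall>s. Suc s = Suc k \<longrightarrow> (AE x in lebesgue_on {0..1}. (F s has_vector_derivative F (Suc s) x) (at x within {0..1}))"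
    "F (Suc k) absolutely_integrable_on {0..1}"
    unfolding sobolev_W1_def by (elim exE conjE) (rule that; assumption)
  note F = F'(1) F'(2)[rule_format] F'(3)[rule_format] F'(4)[rule_format] F'(5)
  have "sobolev_W1 k (F 1)"
    unfolding sobolev_W1_def
    by (rule exI[of _ "\<lambda>s. F (Suc s)"]) (use F in simp_all)
  then have W: "W1 k (\<lambda>x. T (F 1 x))" by (rule Suc.IH)
  have "F 0 has_L1_derivative F 1"
  proof (rule L1D_of_AE_derivative[OF F(2)])
    show "F 1 absolutely_integrable_on {0..1}"
    proof (cases k)
      case 0
      then show ?thesis using F(5) by simp
    next
      case (Suc j)
      then have "continuous_on {0..1} (F 1)" using F(2)[of 1] absolutely_continuous_on_imp_continuous_on by auto
      then show ?thesis by (rule absolutely_integrable_continuous_real)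
    qed
    show "AE x in lebesgue_on {0..1}. (F 0 has_vector_derivative F 1 x) (at x within {0..1})"
    proof (cases k)
      case 0
      then show ?thesis using F(4)[of 0] by simp
    next
      case (Suc j)
      then have "(F 0 has_vector_derivative F 1 x) (at x within {0..1})" if "x \<in> {0..1}" for x
        using F(3)[of 0 x] that by simp
      then show ?thesis by (intro AE_I2) simp
    qed
  qed simp
  from L1D_linear[OF this T] W have "W1 (Suc k) (\<lambda>x. T (F 0 x))" by auto
  then show ?case by (rule W1_cong) (use F(1) in auto)
qed

context fast_slow
begin

text \<open>
  Each step of the recursion costs one derivative, so \<open>r m\<close> belongs to \<open>W\<^sub>1\<close> of order \<open>n - m\<close>: all derivatives
  in the recursion up to index \<open>n - 1\<close> are classical, and that of \<open>r (n - 1)\<close> is still integrable.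
\<close>

lemma coefficient_chain:
  assumes n: "n > 0" and A: "W1 n (\<lambda>x. of_real (\<alpha> x))" and pW: "W1 n p" and qW: "W1 n q"
    and r0: "\<And>x. x \<in> {0..1} \<Longrightarrow> r 0 x = q x / of_real (\<alpha> x)"
    and rec: "\<And>m x. continuous_on {0..1} (r m) \<Longrightarrow> x \<in> {0..1} \<Longrightarrow>
       r (Suc m) x = (q x * slow (r m) x - vector_derivative (r m) (at x within {0..1})) / of_real (\<alpha> x)"
  obtains r' where "\<And>m. m < n \<Longrightarrow> r m has_L1_derivative r' m"
    "\<And>x. x \<in> {0..1} \<Longrightarrow> of_real (\<alpha> x) * r 0 x = q x"
    "\<And>m x. Suc m < n \<Longrightarrow> x \<in> {0..1} \<Longrightarrow> of_real (\<alpha> x) * r (Suc m) x = q x * slow (r m) x - r' m x"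
proof -
  have nz: "of_real (\<alpha> x) \<noteq> (0::complex)" if "x \<in> {0..1}" for x using \<epsilon>(1) \<epsilon>(2)[OF that] by auto
  have inv: "W1 (Suc k) (\<lambda>x. inverse (of_real (\<alpha> x)))" if "Suc k \<le> n" for k
    by (rule W1_inverse[OF W1_mono[OF A that] \<epsilon>(1)]) (simp add: \<epsilon>(2))
  have W: "W1 (n - m) (r m)" if "m < n" for m
    using that
  proof (induction m)
    case 0
    obtain k where k: "n = Suc k" using n gr0_conv_Suc by blast
    have "W1 n (\<lambda>x. q x * inverse (of_real (\<alpha> x)))"
      unfolding k by (rule W1_mult) (use qW inv k in auto)
    then have "W1 n (r 0)" by (rule W1_cong) (simp add: r0 divide_inverse)
    then show ?case by simp
  next
    case (Suc m)
    define k where "k = n - Suc (Suc m)"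
    have k: "n - m = Suc (Suc k)" "n - Suc m = Suc k" "Suc k \<le> n" "Suc (Suc k) \<le> n" using Suc.prems by (auto simp: k_def)
    have "W1 (Suc (Suc k)) (r m)" using Suc k by simp
    then obtain f' where f': "r m has_L1_derivative f'" "W1 (Suc k) f'" by auto
    have pr: "W1 (Suc k) (\<lambda>x. p x * r m x)"
      by (rule W1_mult[OF W1_mono[OF pW k(3)] W1_Suc_imp[OF \<open>W1 (Suc (Suc k)) (r m)\<close>]])
    have "W1 (Suc k) (slow (r m))"
      unfolding slow_def by (rule W1_Suc_imp[OF W1_integral_from[OF pr]])
    then have "W1 (Suc k) (\<lambda>x. (q x * slow (r m) x - f' x) * inverse (of_real (\<alpha> x)))"
      by (intro W1_mult W1_diff inv[OF k(3)] W1_mono[OF qW k(3)] f'(2))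
    then have "W1 (Suc k) (r (Suc m))"
    proof (rule W1_cong)
      fix x :: real assume x: "x \<in> {0..1}"
      show "r (Suc m) x = (q x * slow (r m) x - f' x) * inverse (of_real (\<alpha> x))"
        unfolding rec[OF L1D_continuous[OF f'(1)] x] L1D_vector_derivative[OF f'(1) W1_Suc_continuous[OF f'(2)] x]
        by (simp add: divide_inverse)
    qed
    then show ?case using k by simp
  qed
  have "\<exists>f'. r m has_L1_derivative f' \<and> W1 (n - Suc m) f'" if "m < n" for m
    using W[OF that] Suc_diff_Suc[OF that] by (metis W1.simps(2))
  then obtain r' where r': "\<And>m. m < n \<Longrightarrow> r m has_L1_derivative r' m" "\<And>m. m < n \<Longrightarrow> W1 (n - Suc m) (r' m)"
    by metis
  show ?thesis
  proof (rule that[of r', OF r'(1)])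
    show "of_real (\<alpha> x) * r 0 x = q x" if "x \<in> {0..1}" for x
      using r0[OF that] nz[OF that] by simp
    fix m and x :: real assume m: "Suc m < n" and x: "x \<in> {0..1}"
    have "W1 (Suc (n - Suc (Suc m))) (r' m)" using r'(2)[of m] m Suc_diff_Suc[OF m] by simp
    from L1D_vector_derivative[OF r'(1) W1_Suc_continuous[OF this] x] m
    show "of_real (\<alpha> x) * r (Suc m) x = q x * slow (r m) x - r' m x"
      unfolding rec[OF L1D_continuous[OF r'(1)[OF Suc_lessD[OF m]]] x] using nz[OF x] by simp
  qed
qed

lemma coefficient_zero:
  assumes q0: "\<And>x. x \<in> {0..1} \<Longrightarrow> q x = 0"
    and r0: "\<And>x. x \<in> {0..1} \<Longrightarrow> r 0 x = q x / of_real (\<alpha> x)"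
    and rec: "\<And>m x. continuous_on {0..1} (r m) \<Longrightarrow> x \<in> {0..1} \<Longrightarrow>
       r (Suc m) x = (q x * slow (r m) x - vector_derivative (r m) (at x within {0..1})) / of_real (\<alpha> x)"
    and x: "x \<in> {0..1}"
  shows "r m x = 0" "slow (r m) x = 0"
proof -
  have r: "r m x = 0" if "x \<in> {0..1}" for m x
    using that
  proof (induction m arbitrary: x)
    case 0
    then show ?case using r0 q0 by simp
  next
    case (Suc m)
    have "r m has_L1_derivative (\<lambda>x. 0)"
      by (rule L1D_cong[OF L1D_const[of 0]]) (simp_all add: Suc.IH)
    from L1D_vector_derivative[OF this _ Suc.prems] L1D_continuous[OF this] show ?case
      using rec[OF _ Suc.prems] q0[OF Suc.prems] by simp
  qed
  show "r m x = 0" by (rule r[OF x])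
  have "slow (r m) x = integral_from d (\<lambda>x. 0) x"
    unfolding slow_def by (rule integral_from_cong) (use x d r in auto)
  then show "slow (r m) x = 0" by (simp add: integral_from_def)
qed

end

lemma continuous_integral_from_zero:
  assumes q: "continuous_on {0..1} q" and zero: "\<And>x. x \<in> {0..1} \<Longrightarrow> integral_from c q x = 0" and x: "x \<in> {0..1}"
  shows "q x = (0::complex)"
proof -
  have i: "q absolutely_integrable_on {0..1}" using q by (rule absolutely_integrable_continuous_real)
  have "integral_from c q has_L1_derivative (\<lambda>x. 0)"
    by (rule L1D_cong[OF L1D_const[of 0]]) (simp_all add: zero)
  from L1D_vector_derivative[OF this _ x] L1D_vector_derivative[OF integral_from_L1D[OF i] q x]
  show ?thesis by simp
qed

section \<open>The fundamental matrix\<close>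

lemma bounded_linear_axis: "bounded_linear (axis i :: complex \<Rightarrow> complex ^ 'n)"
  unfolding linear_conv_bounded_linear[symmetric]
  by (auto simp: linear_iff axis_def vec_eq_iff)

lemma UNIV_2_cases: "i \<noteq> j \<Longrightarrow> (UNIV :: 2 set) = {i, j}"
  using exhaust_2[of i] exhaust_2[of j] UNIV_2 by auto

lemma near_identity_injective:
  fixes c1 c2 :: complex
  assumes "c1 * (1 + u1) + c2 * v2 = 0" "c1 * v1 + c2 * (1 + u2) = 0"
    and "cmod u1 \<le> 1/4" "cmod v1 \<le> 1/4" "cmod u2 \<le> 1/4" "cmod v2 \<le> 1/4"
  shows "c1 = 0 \<and> c2 = 0"
proof -
  have *: "4 * cmod c \<le> cmod c + cmod c'"
    if "c * (1 + u) + c' * v = 0" "cmod u \<le> 1/4" "cmod v \<le> 1/4" for c c' u v :: complex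
  proof -
    have "c = - (c * u + c' * v)" using that(1) by (simp add: algebra_simps eq_neg_iff_add_eq_0)
    then have "cmod c = cmod (c * u + c' * v)" by (metis norm_minus_cancel)
    also have "\<dots> \<le> cmod c * cmod u + cmod c' * cmod v"
      by (rule norm_triangle_le) (simp add: norm_mult)
    also have "\<dots> \<le> cmod c * (1/4) + cmod c' * (1/4)"
      by (intro add_mono mult_left_mono that) auto
    finally show ?thesis by simp
  qed
  have "4 * cmod c1 \<le> cmod c1 + cmod c2" "4 * cmod c2 \<le> cmod c2 + cmod c1"
    using *[OF assms(1,3,6)] *[of c2 u2 c1 v1] assms by (auto simp: add.commute)
  moreover from this have "cmod c1 \<le> 0" by linarith
  ultimately have "cmod c1 \<le> 0" "cmod c2 \<le> 0" by simp_all
  then show ?thesis by simp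
qed

locale canonical_system =
  fixes a :: "2 \<Rightarrow> real \<Rightarrow> real" and b :: "2 \<Rightarrow> 2 \<Rightarrow> real \<Rightarrow> complex" and \<epsilon> :: real
  assumes a_int: "\<And>i. a i absolutely_integrable_on {0..1}"
    and b_int: "\<And>i j. b i j absolutely_integrable_on {0..1}"
    and \<epsilon>: "\<epsilon> > 0" "\<And>x. x \<in> {0..1} \<Longrightarrow> a 1 x - a 2 x \<ge> \<epsilon>"
begin

definition M :: "2 \<Rightarrow> real \<Rightarrow> complex" where
  "M i x = exp (integral {0..x} (b i i))"

lemma M_L1D: "M i has_L1_derivative (\<lambda>x. M i x * b i i x)"
  unfolding M_def by (rule L1D_exp[OF L1D_integral[OF b_int]])

lemma M_nz: "M i x \<noteq> 0"
  by (simp add: M_def)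

lemma adiff_int: "adiff a absolutely_integrable_on {0..1}"
proof -
  have "(\<lambda>x. a 1 x - a 2 x) absolutely_integrable_on {0..1}"
    by (rule set_integral_diff(1)[OF a_int a_int])
  then show ?thesis by (simp add: adiff_def[abs_def])
qed

lemma bdiff_int: "(\<lambda>t. b 1 1 t - b 2 2 t) absolutely_integrable_on {0..1}"
  by (rule set_integral_diff(1)[OF b_int b_int])

lemma bexp_eq: "x \<in> {0..1} \<Longrightarrow> bexp b x = M 1 x / M 2 x"
  unfolding bexp_def M_def
  by (subst integral_diff) (auto simp: exp_diff intro: absint_subinterval(1)[OF b_int])

lemma inverse_bexp: "inverse (bexp b x) = exp (- integral {0..x} (\<lambda>t. b 1 1 t - b 2 2 t))"
  by (simp add: bexp_def exp_minus)

lemma bexp_continuous: "continuous_on {0..1} (bexp b)" "continuous_on {0..1} (\<lambda>x. inverse (bexp b x))"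
proof -
  note H = L1D_continuous[OF L1D_integral[OF bdiff_int]]
  show "continuous_on {0..1} (bexp b)"
    unfolding bexp_def[abs_def] by (intro continuous_intros H)
  show "continuous_on {0..1} (\<lambda>x. inverse (bexp b x))"
    unfolding inverse_bexp by (intro continuous_intros H)
qed

lemma q_int: "q12 b absolutely_integrable_on {0..1}" "q21 b absolutely_integrable_on {0..1}"
  unfolding q12_def[abs_def] q21_def[abs_def]
  by (rule absint_continuous_mult(2)[OF bexp_continuous(2) b_int],
      rule absint_continuous_mult(2)[OF bexp_continuous(1) b_int])

lemma q_eq:
  assumes "x \<in> {0..1}"
  shows "q12 b x * M 1 x = b 1 2 x * M 2 x" "q21 b x * M 2 x = b 2 1 x * M 1 x"
  using bexp_eq[OF assms] M_nz[of 1 x] M_nz[of 2 x] by (simp_all add: q12_def q21_def)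

definition E :: "complex \<Rightarrow> 2 \<Rightarrow> real \<Rightarrow> complex" where
  "E z i x = exp (z * of_real (integral {0..x} (a i)))"

lemma E_L1D: "E z i has_L1_derivative (\<lambda>x. E z i x * (z * of_real (a i x)))"
  unfolding E_def by (intro L1D_exp L1D_cmult L1D_linear[OF L1D_integral[OF a_int] bounded_linear_of_real])

text \<open>
  Substituting \<open>y = M (I + R) E\<close> into the system: \<open>M\<close> absorbs the diagonal coefficients and the \<open>j\<close>-th exponential
  absorbs \<open>z a\<^sub>j\<close>, so the entry in row \<open>j\<close> becomes slow and the other one keeps \<open>z (a\<^sub>j - a\<^sub>k)\<close>.
\<close>

lemma column_is_solution:
  assumes jk: "j \<noteq> k"
    and u: "u has_L1_derivative (\<lambda>x. P x * v x)"
    and v: "v has_L1_derivative (\<lambda>x. Q x * (1 + u x) - z * of_real (\<alpha> x) * v x)"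
    and P: "\<And>x. x \<in> {0..1} \<Longrightarrow> P x * M j x = b j k x * M k x"
    and Q: "\<And>x. x \<in> {0..1} \<Longrightarrow> Q x * M k x = b k j x * M j x"
    and \<alpha>: "\<And>x. x \<in> {0..1} \<Longrightarrow> \<alpha> x = a j x - a k x"
  shows "is_solution a b z (\<lambda>x. \<chi> i. M i x * (if i = j then 1 + u x else v x) * E z j x)"
proof -
  define yj yk where "yj = (\<lambda>x. M j x * (1 + u x) * E z j x)" and "yk = (\<lambda>x. M k x * v x * E z j x)"
  define yj' yk' where "yj' = (\<lambda>x. b j j x * yj x + b j k x * yk x + z * of_real (a j x) * yj x)"
    and "yk' = (\<lambda>x. b k k x * yk x + b k j x * yj x + z * of_real (a k x) * yk x)"
  have "yj has_L1_derivative yj'"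
  proof (rule L1D_cong[OF L1D_mult[OF L1D_mult[OF M_L1D[of j] L1D_add[OF L1D_const[of 1] u]] E_L1D[of z j]]])
    fix x :: real assume x: "x \<in> {0..1}"
    have "M j x * (P x * v x) * E z j x = b j k x * yk x"
      using P[OF x] by (simp add: yk_def mult_ac)
    then show "yj' x = (M j x * b j j x * (1 + u x) + M j x * (0 + P x * v x)) * E z j x +
        M j x * (1 + u x) * (E z j x * (z * of_real (a j x)))"
      by (simp add: yj'_def yj_def algebra_simps)
  qed (simp add: yj_def)
  moreover have "yk has_L1_derivative yk'"
  proof (rule L1D_cong[OF L1D_mult[OF L1D_mult[OF M_L1D[of k] v] E_L1D[of z j]]])
    fix x :: real assume x: "x \<in> {0..1}"
    have "M k x * (Q x * (1 + u x)) * E z j x = b k j x * yj x"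
      using Q[OF x] by (simp add: yj_def mult_ac)
    then show "yk' x = (M k x * b k k x * v x + M k x * (Q x * (1 + u x) - z * of_real (\<alpha> x) * v x)) * E z j x +
        M k x * v x * (E z j x * (z * of_real (a j x)))"
      by (simp add: yk'_def yk_def \<alpha>[OF x] algebra_simps)
  qed (simp add: yk_def)
  ultimately have "(\<lambda>x. axis j (yj x) + axis k (yk x)) has_L1_derivative (\<lambda>x. axis j (yj' x) + axis k (yk' x))"
    by (intro L1D_add L1D_linear[OF _ bounded_linear_axis])
  moreover have U: "(UNIV :: 2 set) = {j, k}" by (rule UNIV_2_cases[OF jk])
  have all2: "(\<forall>i. \<Phi> i) \<longleftrightarrow> \<Phi> j \<and> \<Phi> k" for \<Phi> :: "2 \<Rightarrow> bool"
    using U by (metis UNIV_I empty_iff insert_iff)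
  have sum2: "(\<Sum>i\<in>UNIV. f i) = f j + f k" for f :: "2 \<Rightarrow> complex"
    unfolding U using jk by simp
  have "(\<lambda>x. axis j (yj x) + axis k (yk x)) = (\<lambda>x. \<chi> i. M i x * (if i = j then 1 + u x else v x) * E z j x)"
    using jk by (auto simp: fun_eq_iff vec_eq_iff all2 axis_def yj_def yk_def)
  ultimately have L: "(\<lambda>x. \<chi> i. M i x * (if i = j then 1 + u x else v x) * E z j x) has_L1_derivative
      (\<lambda>x. axis j (yj' x) + axis k (yk' x))" by simp
  show ?thesis
    unfolding is_solution_def
  proof (intro conjI L1D_AC[OF L])
    have "AE x in lebesgue_on {0..1::real}. x \<in> {0..1}" by (simp add: AE_restrict_space_iff)
    then show "AE x in lebesgue_on {0..1}. \<exists>y'.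
       ((\<lambda>x. \<chi> i. M i x * (if i = j then 1 + u x else v x) * E z j x) has_vector_derivative y') (at x within {0..1}) \<and>
       y' - (\<chi> i j. b i j x) *v (\<chi> i. M i x * (if i = j then 1 + u x else v x) * E z j x) =
       z *s (diag2 (\<lambda>i. complex_of_real (a i x)) *v (\<chi> i. M i x * (if i = j then 1 + u x else v x) * E z j x))"
      using L1D_AE[OF L]
    proof eventually_elim
      case (elim x)
      have "axis j (yj' x) + axis k (yk' x) - (\<chi> i j. b i j x) *v (\<chi> i. M i x * (if i = j then 1 + u x else v x) * E z j x) =
       z *s (diag2 (\<lambda>i. complex_of_real (a i x)) *v (\<chi> i. M i x * (if i = j then 1 + u x else v x) * E z j x))"
        using jk jk[symmetric]
        by (simp add: vec_eq_iff all2 sum2 axis_def matrix_vector_mult_def diag2_def yj'_def yk'_def yj_def yk_def algebra_simps)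
      then show ?case using elim(2) by blast
    qed
  qed
qed

definition Rmat :: "(complex \<Rightarrow> real \<Rightarrow> complex) \<Rightarrow> (complex \<Rightarrow> real \<Rightarrow> complex) \<Rightarrow> (complex \<Rightarrow> real \<Rightarrow> complex)
    \<Rightarrow> (complex \<Rightarrow> real \<Rightarrow> complex) \<Rightarrow> real \<Rightarrow> complex \<Rightarrow> complex^2^2" where
  "Rmat u1 v1 u2 v2 x z = vector [vector [u1 z x, v2 z x], vector [v1 z x, u2 z x]]"

lemma Rmat_nth [simp]:
  "Rmat u1 v1 u2 v2 x z $ 1 $ 1 = u1 z x" "Rmat u1 v1 u2 v2 x z $ 1 $ 2 = v2 z x"
  "Rmat u1 v1 u2 v2 x z $ 2 $ 1 = v1 z x" "Rmat u1 v1 u2 v2 x z $ 2 $ 2 = u2 z x"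
  by (simp_all add: Rmat_def)

definition Ymat :: "(real \<Rightarrow> complex \<Rightarrow> complex^2^2) \<Rightarrow> real \<Rightarrow> complex \<Rightarrow> complex^2^2" where
  "Ymat R x z = matM b x ** (mat 1 + R x z) ** matE a x z"

lemma column_Ymat: "column j (Ymat R x z) = (\<chi> i. M i x * ((if i = j then 1 else 0) + R x z $ i $ j) * E z j x)"
  using exhaust_2[of j]
  by (auto simp: Ymat_def vec_eq_iff column_def matrix_matrix_mult_def sum_2 forall_2 matM_def matE_def diag2_def
      mat_def M_def E_def)

lemma fundamental_matrix_Ymat:
  assumes 1: "column_pair \<Omega> (adiff a) (q12 b) (q21 b) u1 v1"
    and 2: "column_pair \<Omega> (\<lambda>x. - adiff a x) (q21 b) (q12 b) u2 v2"
    and small: "\<And>z. z \<in> \<Omega> \<Longrightarrow> cmod (u1 z 0) \<le> 1/4 \<and> cmod (v1 z 0) \<le> 1/4 \<and> cmod (u2 z 0) \<le> 1/4 \<and> cmod (v2 z 0) \<le> 1/4"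
  shows "fundamental_matrix a b \<Omega> (Ymat (Rmat u1 v1 u2 v2))"
  unfolding fundamental_matrix_def
proof (intro ballI conjI allI impI)
  fix z j assume z: "z \<in> \<Omega>"
  let ?R = "Rmat u1 v1 u2 v2"
  have s1: "is_solution a b z (\<lambda>x. \<chi> i. M i x * (if i = 1 then 1 + u1 z x else v1 z x) * E z 1 x)"
    using 1 z unfolding column_pair_def
    by (intro column_is_solution[where k = 2 and P = "q12 b" and Q = "q21 b" and \<alpha> = "adiff a"]) (auto simp: q_eq adiff_def)
  have s2: "is_solution a b z (\<lambda>x. \<chi> i. M i x * (if i = 2 then 1 + u2 z x else v2 z x) * E z 2 x)"
    using 2 z unfolding column_pair_def
    by (intro column_is_solution[where k = 1 and P = "q21 b" and Q = "q12 b" and \<alpha> = "\<lambda>x. - adiff a x"]) (auto simp: q_eq adiff_def)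
  have c1: "(\<lambda>x. column 1 (Ymat ?R x z)) = (\<lambda>x. \<chi> i. M i x * (if i = 1 then 1 + u1 z x else v1 z x) * E z 1 x)"
    by (auto simp: column_Ymat vec_eq_iff forall_2)
  have c2: "(\<lambda>x. column 2 (Ymat ?R x z)) = (\<lambda>x. \<chi> i. M i x * (if i = 2 then 1 + u2 z x else v2 z x) * E z 2 x)"
    by (auto simp: column_Ymat vec_eq_iff forall_2)
  show "is_solution a b z (\<lambda>x. column j (Ymat ?R x z))"
    using exhaust_2[of j] s1 s2 unfolding c1[symmetric] c2[symmetric] by auto
  fix c :: "2 \<Rightarrow> complex" 
  assume "\<forall>x\<in>{0..1}. (\<Sum>j\<in>UNIV. c j *s column j (Ymat ?R x z)) = 0"
  then have "(\<Sum>j\<in>UNIV. c j *s column j (Ymat ?R 0 z)) = 0" by simp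
  then have "c 1 * (1 + u1 z 0) + c 2 * v2 z 0 = 0" "c 1 * v1 z 0 + c 2 * (1 + u2 z 0) = 0"
    by (auto simp: sum_2 vec_eq_iff forall_2 column_Ymat M_def E_def)
  then have "c 1 = 0 \<and> c 2 = 0"
    by (rule near_identity_injective) (use small[OF z] in auto)
  then show "c j = 0" using exhaust_2[of j] by auto
qed

lemma has_representation_Ymat:
  assumes 1: "column_pair {z \<in> \<Omega>. cmod z > \<mu>0} (adiff a) (q12 b) (q21 b) u1 v1"
    and 2: "column_pair {z \<in> \<Omega>. cmod z > \<mu>0} (\<lambda>x. - adiff a x) (q21 b) (q12 b) u2 v2"
    and small: "\<And>z x. z \<in> \<Omega> \<Longrightarrow> cmod z > \<mu>0 \<Longrightarrow> x \<in> {0..1} \<Longrightarrow>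
      cmod (u1 z x) \<le> 1/4 \<and> cmod (v1 z x) \<le> 1/4 \<and> cmod (u2 z x) \<le> 1/4 \<and> cmod (v2 z x) \<le> 1/4"
    and bound: "\<And>z x. z \<in> \<Omega> \<Longrightarrow> cmod z > \<mu>0 \<Longrightarrow> x \<in> {0..1} \<Longrightarrow>
      cmod (u1 z x) \<le> C0 * \<Upsilon> z \<and> cmod (v1 z x) \<le> C0 * \<Upsilon> z \<and> cmod (u2 z x) \<le> C0 * \<Upsilon> z \<and> cmod (v2 z x) \<le> C0 * \<Upsilon> z"
  shows "has_representation a b \<Omega> \<Upsilon> (Ymat (Rmat u1 v1 u2 v2)) (Rmat u1 v1 u2 v2)"
  unfolding has_representation_def
proof (rule exI[of _ \<mu>0], rule exI[of _ C0], intro conjI)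
  show "fundamental_matrix a b {z \<in> \<Omega>. cmod z > \<mu>0} (Ymat (Rmat u1 v1 u2 v2))"
    by (rule fundamental_matrix_Ymat[OF 1 2]) (use small in auto)
  show "\<forall>z\<in>\<Omega>. cmod z > \<mu>0 \<longrightarrow> (\<forall>x\<in>{0..1}. Ymat (Rmat u1 v1 u2 v2) x z =
      matM b x ** (mat 1 + Rmat u1 v1 u2 v2 x z) ** matE a x z)"
    by (simp add: Ymat_def)
  show "\<forall>x\<in>{0..1}. \<forall>i j. (\<lambda>z. Rmat u1 v1 u2 v2 x z $ i $ j) holomorphic_on {z \<in> \<Omega>. cmod z > \<mu>0}"
    using 1 2 by (auto simp: forall_2 column_pair_def)
  show "\<forall>z\<in>\<Omega>. cmod z > \<mu>0 \<longrightarrow>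
     (\<forall>i j. continuous_on {0..1} (\<lambda>x. Rmat u1 v1 u2 v2 x z $ i $ j) \<and>
            (SUP x\<in>{0..1}. cmod (Rmat u1 v1 u2 v2 x z $ i $ j)) \<le> C0 * \<Upsilon> z)"
  proof (intro ballI impI)
    fix z assume z: "z \<in> \<Omega>" "cmod z > \<mu>0"
    then have zm: "z \<in> {z \<in> \<Omega>. cmod z > \<mu>0}" by simp
    have "continuous_on {0..1} (u1 z) \<and> continuous_on {0..1} (v1 z) \<and> continuous_on {0..1} (u2 z) \<and> continuous_on {0..1} (v2 z)"
      using 1 2 zm unfolding column_pair_def by (blast intro: L1D_continuous)
    moreover have "(SUP x\<in>{0..1}. cmod (f x)) \<le> C0 * \<Upsilon> z"
      if "\<And>x. x \<in> {0..1} \<Longrightarrow> cmod (f x) \<le> C0 * \<Upsilon> z" for f :: "real \<Rightarrow> complex"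
      by (rule cSUP_least) (use that in auto)
    ultimately show "\<forall>i j. continuous_on {0..1} (\<lambda>x. Rmat u1 v1 u2 v2 x z $ i $ j) \<and>
            (SUP x\<in>{0..1}. cmod (Rmat u1 v1 u2 v2 x z $ i $ j)) \<le> C0 * \<Upsilon> z"
      using bound[OF z] by (simp add: forall_2)
  qed
qed

lemma has_expansion_Rmat:
  assumes "has_inverse_powers \<Omega> n u1 (\<lambda>m. op_I1 b (coef21 a b m))" "has_inverse_powers \<Omega> n v1 (coef21 a b)"
    and "has_inverse_powers \<Omega> n u2 (\<lambda>m. op_I2 b (coef12 a b m))" "has_inverse_powers \<Omega> n v2 (coef12 a b)"
  shows "has_expansion a b \<Omega> n (Rmat u1 v1 u2 v2)"
proof -
  have ul: "uniform_limit {0..1} (\<lambda>z x. z ^ n * (f z x - (\<Sum>m<n. r m x / z ^ Suc m))) (\<lambda>x. 0)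
      (inf at_infinity (principal \<Omega>))" if f: "has_inverse_powers \<Omega> n f r" for f r
  proof (rule uniform_limitI)
    fix e :: real assume "e > 0"
    then have "e / 2 > 0" by simp
    then obtain K where K: "\<And>z x. z \<in> \<Omega> \<Longrightarrow> cmod z > K \<Longrightarrow> x \<in> {0..1} \<Longrightarrow>
        cmod (z ^ n * (f z x - (\<Sum>m<n. r m x / z ^ Suc m))) \<le> e / 2"
      using f unfolding has_inverse_powers_def by blast
    show "\<forall>\<^sub>F z in inf at_infinity (principal \<Omega>). \<forall>x\<in>{0..1}.
        dist (z ^ n * (f z x - (\<Sum>m<n. r m x / z ^ Suc m))) 0 < e"
      unfolding eventually_inf_principal eventually_at_infinity
    proof (intro exI[of _ "K + 1"] allI impI ballI)
      fix z x assume "K + 1 \<le> norm z" "z \<in> \<Omega>" "x \<in> {0..1::real}"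
      then have "cmod (z ^ n * (f z x - (\<Sum>m<n. r m x / z ^ Suc m))) \<le> e / 2" by (intro K) auto
      then show "dist (z ^ n * (f z x - (\<Sum>m<n. r m x / z ^ Suc m))) 0 < e" using \<open>e > 0\<close> by simp
    qed
  qed
  have sum1: "(\<Sum>m=1..n. f m) = (\<Sum>m<n. f (Suc m))" for f :: "nat \<Rightarrow> complex"
    using sum.atLeast1_atMost_eq[of f n] by simp
  have cm: "coef_matrix a b (Suc m) x $ 1 $ 1 = op_I1 b (coef21 a b m) x"
     "coef_matrix a b (Suc m) x $ 1 $ 2 = coef12 a b m x"
     "coef_matrix a b (Suc m) x $ 2 $ 1 = coef21 a b m x"
     "coef_matrix a b (Suc m) x $ 2 $ 2 = op_I2 b (coef12 a b m) x" for m x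
    by (simp_all add: coef_matrix_def)
  show ?thesis
    unfolding has_expansion_def forall_2 sum1 cm Rmat_nth by (intro conjI ul assms)
qed

lemma adiff_ge: "x \<in> {0..1} \<Longrightarrow> \<epsilon> \<le> adiff a x"
  using \<epsilon>(2) by (simp add: adiff_def)

lemma coefficient_regularity:
  assumes n: "n \<ge> 1" and smooth: "smooth_coefficients n a b"
  shows "W1 n (\<lambda>x. of_real (adiff a x))" "W1 n (q12 b)" "W1 n (q21 b)"
proof -
  have sm: "sobolev_W1 n (a 1)" "sobolev_W1 n (a 2)" "sobolev_W1 n (b 1 2)" "sobolev_W1 n (b 2 1)"
     "sobolev_W1 (n - 1) (b 1 1)" "sobolev_W1 (n - 1) (b 2 2)"
    using smooth by (auto simp: smooth_coefficients_def)
  obtain k where k: "n = Suc k" using n by (cases n) auto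
  have "W1 n (\<lambda>x. of_real (a 1 x) - of_real (a 2 x))"
    by (intro W1_diff sobolev_W1_imp_W1[OF _ bounded_linear_of_real] sm)
  then show "W1 n (\<lambda>x. of_real (adiff a x))" by (simp add: adiff_def)
  have "W1 k (\<lambda>t. b 1 1 t - b 2 2 t)"
    using sobolev_W1_imp_W1[OF sm(5) bounded_linear_ident] sobolev_W1_imp_W1[OF sm(6) bounded_linear_ident] k
    by (intro W1_diff) simp_all
  from W1_integral_from[OF this, of 0]
  have H: "W1 n (\<lambda>x. integral {0..x} (\<lambda>t. b 1 1 t - b 2 2 t))"
    unfolding k by (rule W1_cong) (simp add: integral_from_def)
  have "W1 n (bexp b)"
    using H unfolding bexp_def[abs_def] k by (rule W1_exp)
  then show "W1 n (q21 b)"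
    using sobolev_W1_imp_W1[OF sm(4) bounded_linear_ident] unfolding q21_def[abs_def] k by (intro W1_mult)
  have "W1 n (\<lambda>x. exp ((-1) * integral {0..x} (\<lambda>t. b 1 1 t - b 2 2 t)))"
    using W1_cmult[OF H, of "-1"] unfolding k by (rule W1_exp)
  then have "W1 n (\<lambda>x. inverse (bexp b x))" by (simp add: inverse_bexp)
  then show "W1 n (q12 b)"
    using sobolev_W1_imp_W1[OF sm(3) bounded_linear_ident] unfolding q12_def[abs_def] k by (intro W1_mult)
qed

lemma coef21_0: "coef21 a b 0 x = q21 b x / of_real (adiff a x)"
  by (simp add: coef21_def q21_def)

lemma op_I1_eq:
  assumes f: "continuous_on {0..1} f" and x: "x \<in> {0..1}"
  shows "op_I1 b f x = integral_from 1 (\<lambda>t. q12 b t * f t) x"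
  using integral_from_le[OF absint_continuous_mult(2)[OF f q_int(1)], of x 1] x
  by (simp add: op_I1_def q12_def)

lemma op_I2_eq: "op_I2 b f x = integral_from 0 (\<lambda>t. q21 b t * f t) x"
  by (simp add: op_I2_def q21_def integral_from_def)

lemma coef21_Suc:
  assumes "continuous_on {0..1} (coef21 a b m)" and x: "x \<in> {0..1}"
  shows "coef21 a b (Suc m) x = (q21 b x * integral_from 1 (\<lambda>t. q12 b t * coef21 a b m t) x -
           vector_derivative (coef21 a b m) (at x within {0..1})) / of_real (adiff a x)"
proof -
  have "coef21 a b (Suc m) x = - op_D a (coef21 a b m) x + op_J1 a b (coef21 a b m) x"
    by (simp add: coef21_def)
  then show ?thesis
    by (simp add: op_D_def op_J1_def op_I1_eq[OF assms] q21_def diff_divide_distrib)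
qed

lemma coef12_0: "coef12 a b 0 x = q12 b x / of_real (- adiff a x)"
  by (simp add: coef12_def q12_def)

lemma coef12_Suc:
  "coef12 a b (Suc m) x = (q12 b x * integral_from 0 (\<lambda>t. q21 b t * coef12 a b m t) x -
     vector_derivative (coef12 a b m) (at x within {0..1})) / of_real (- adiff a x)"
proof -
  have "coef12 a b (Suc m) x = op_D a (coef12 a b m) x + op_J2 a b (coef12 a b m) x"
    by (simp add: coef12_def)
  then show ?thesis
    by (simp add: op_D_def op_J2_def op_I2_eq q12_def diff_divide_distrib)
qed

text \<open>
  The base points 1 and 0 of the slow components are those of \<open>I\<^sub>1\<close> and \<open>I\<^sub>2\<close>; only the base points \<open>c1\<close> and \<open>c2\<close>
  of the fast components depend on the half-plane. This is why the coefficient formulas are the same in both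
  half-planes. For smooth coefficients there are two cases. If \<open>q12\<close> or \<open>q21\<close> is not identically 0, the
  solution built from the expansion is \<open>O(1/z)\<close> and the lower bound for \<open>\<Upsilon>\<close> applies. If both vanish, the
  solution of the first part has \<open>R = 0\<close> and all coefficients are 0.
\<close>

lemma half_plane_conclusions:
  assumes F1: "fast_slow (adiff a) (rho a) c1 \<epsilon> B \<Omega> (q12 b) (q21 b) 1"
    and F2: "fast_slow (\<lambda>x. - adiff a x) (\<lambda>x. - rho a x) c2 \<epsilon> B \<Omega> (q21 b) (q12 b) 0"
    and \<Upsilon>1: "\<And>z y. z \<in> \<Omega> \<Longrightarrow> y \<in> {0..1} \<Longrightarrow> cmod (fast_kernel.fast (rho a) c1 z (q21 b) y) \<le> \<Upsilon> z"
    and \<Upsilon>2: "\<And>z y. z \<in> \<Omega> \<Longrightarrow> y \<in> {0..1} \<Longrightarrow> cmod (fast_kernel.fast (\<lambda>x. - rho a x) c2 z (q12 b) y) \<le> \<Upsilon> z"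
  shows "(\<exists>Y R. has_representation a b \<Omega> \<Upsilon> Y R) \<and>
    (\<forall>n\<ge>1. smooth_coefficients n a b \<longrightarrow>
       (\<exists>Y R. has_representation a b \<Omega> \<Upsilon> Y R \<and> has_expansion a b \<Omega> n R))"
proof -
  interpret C1: fast_slow "adiff a" "rho a" c1 \<epsilon> B \<Omega> "q12 b" "q21 b" 1 by (rule F1)
  interpret C2: fast_slow "\<lambda>x. - adiff a x" "\<lambda>x. - rho a x" c2 \<epsilon> B \<Omega> "q21 b" "q12 b" 0 by (rule F2)
  obtain \<mu>1 u1 v1 K1 where K1: "\<mu>1 \<ge> 0" "K1 \<ge> 0"
    "column_pair {z \<in> \<Omega>. cmod z > \<mu>1} (adiff a) (q12 b) (q21 b) u1 v1"
    "\<And>z x \<eta>. z \<in> \<Omega> \<Longrightarrow> cmod z > \<mu>1 \<Longrightarrow> (\<And>y. y \<in> {0..1} \<Longrightarrow> cmod (C1.fast z (q21 b) y) \<le> \<eta>) \<Longrightarrow> x \<in> {0..1}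
       \<Longrightarrow> cmod (u1 z x) \<le> K1 * \<eta> \<and> cmod (v1 z x) \<le> K1 * \<eta>"
    by (rule C1.column_pair_exists) blast
  obtain \<mu>2 u2 v2 K2 where K2: "\<mu>2 \<ge> 0" "K2 \<ge> 0"
    "column_pair {z \<in> \<Omega>. cmod z > \<mu>2} (\<lambda>x. - adiff a x) (q21 b) (q12 b) u2 v2"
    "\<And>z x \<eta>. z \<in> \<Omega> \<Longrightarrow> cmod z > \<mu>2 \<Longrightarrow> (\<And>y. y \<in> {0..1} \<Longrightarrow> cmod (C2.fast z (q12 b) y) \<le> \<eta>) \<Longrightarrow> x \<in> {0..1}
       \<Longrightarrow> cmod (u2 z x) \<le> K2 * \<eta> \<and> cmod (v2 z x) \<le> K2 * \<eta>"
    by (rule C2.column_pair_exists) blast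
  have \<Upsilon>0: "\<Upsilon> z \<ge> 0" if "z \<in> \<Omega>" for z
    using order_trans[OF norm_ge_zero \<Upsilon>1[OF that, of 0]] by simp
  define e where "e = 1 / (4 * (K1 + K2 + 1))"
  have e: "e > 0" "K1 * e \<le> 1/4" "K2 * e \<le> 1/4" using K1(2) K2(2) by (auto simp: e_def field_simps)
  obtain \<mu>3 where \<mu>3: "\<And>z x. z \<in> \<Omega> \<Longrightarrow> cmod z > \<mu>3 \<Longrightarrow> x \<in> {0..1} \<Longrightarrow> cmod (C1.fast z (q21 b) x) \<le> e"
    using C1.fast_tendsto_0[OF q_int(2) e(1)] by blast
  obtain \<mu>4 where \<mu>4: "\<And>z x. z \<in> \<Omega> \<Longrightarrow> cmod z > \<mu>4 \<Longrightarrow> x \<in> {0..1} \<Longrightarrow> cmod (C2.fast z (q12 b) x) \<le> e"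
    using C2.fast_tendsto_0[OF q_int(1) e(1)] by blast
  define \<mu>0 where "\<mu>0 = max (max \<mu>1 \<mu>2) (max \<mu>3 \<mu>4)"
  have rep: "has_representation a b \<Omega> \<Upsilon> (Ymat (Rmat u1 v1 u2 v2)) (Rmat u1 v1 u2 v2)"
  proof (rule has_representation_Ymat[of \<Omega> \<mu>0 u1 v1 u2 v2 "K1 + K2"])
    show "column_pair {z \<in> \<Omega>. cmod z > \<mu>0} (adiff a) (q12 b) (q21 b) u1 v1"
      by (rule column_pair_subset[OF K1(3)]) (auto simp: \<mu>0_def)
    show "column_pair {z \<in> \<Omega>. cmod z > \<mu>0} (\<lambda>x. - adiff a x) (q21 b) (q12 b) u2 v2"
      by (rule column_pair_subset[OF K2(3)]) (auto simp: \<mu>0_def)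
    fix z x assume z: "z \<in> \<Omega>" "cmod z > \<mu>0" and x: "x \<in> {0..1::real}"
    have zs: "cmod z > \<mu>1" "cmod z > \<mu>2" "cmod z > \<mu>3" "cmod z > \<mu>4" using z by (auto simp: \<mu>0_def)
    show "cmod (u1 z x) \<le> 1/4 \<and> cmod (v1 z x) \<le> 1/4 \<and> cmod (u2 z x) \<le> 1/4 \<and> cmod (v2 z x) \<le> 1/4"
      using K1(4)[OF z(1) zs(1) \<mu>3[OF z(1) zs(3)] x] K2(4)[OF z(1) zs(2) \<mu>4[OF z(1) zs(4)] x] e(2,3)
      by linarith
    have "K1 * \<Upsilon> z \<le> (K1 + K2) * \<Upsilon> z" "K2 * \<Upsilon> z \<le> (K1 + K2) * \<Upsilon> z"
      using K1(2) K2(2) \<Upsilon>0[OF z(1)] by (auto intro!: mult_right_mono)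
    then show "cmod (u1 z x) \<le> (K1 + K2) * \<Upsilon> z \<and> cmod (v1 z x) \<le> (K1 + K2) * \<Upsilon> z \<and>
          cmod (u2 z x) \<le> (K1 + K2) * \<Upsilon> z \<and> cmod (v2 z x) \<le> (K1 + K2) * \<Upsilon> z"
      using K1(4)[OF z(1) zs(1) \<Upsilon>1[OF z(1)] x] K2(4)[OF z(1) zs(2) \<Upsilon>2[OF z(1)] x]
      by linarith
  qed
  have expansion: "\<exists>Y R. has_representation a b \<Omega> \<Upsilon> Y R \<and> has_expansion a b \<Omega> n R"
    if n: "n \<ge> 1" and smooth: "smooth_coefficients n a b" for n
  proof -
    have n0: "n > 0" using n by simp
    note reg = coefficient_regularity[OF n smooth]
    have reg': "W1 n (\<lambda>x. of_real (- adiff a x))" using W1_cmult[OF reg(1), of "-1"] by simp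
    have qc: "continuous_on {0..1} (q12 b)" "continuous_on {0..1} (q21 b)"
      using reg W1_Suc_continuous[of "n - 1"] n by simp_all
    note rec1 = coef21_Suc[folded C1.slow_def]
    note rec2 = coef12_Suc[folded C2.slow_def]
    show ?thesis
    proof (cases "\<forall>x\<in>{0..1}. q12 b x = 0 \<and> q21 b x = 0")
      case True
      have "has_expansion a b \<Omega> n (Rmat u1 v1 u2 v2)"
      proof (rule has_expansion_Rmat)
        have uv1: "u1 z x = 0 \<and> v1 z x = 0" if "z \<in> \<Omega>" "cmod z > \<mu>1" "x \<in> {0..1}" for z x
        proof -
          have "cmod (C1.fast z (q21 b) y) \<le> 0" if "y \<in> {0..1}" for y
            using C1.fast_cong[of "q21 b" "\<lambda>_. 0" y z] True that by (simp add: C1.fast_def integral_from_def)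
          from K1(4)[OF that(1,2) this that(3)] show ?thesis by simp
        qed
        have uv2: "u2 z x = 0 \<and> v2 z x = 0" if "z \<in> \<Omega>" "cmod z > \<mu>2" "x \<in> {0..1}" for z x
        proof -
          have "cmod (C2.fast z (q12 b) y) \<le> 0" if "y \<in> {0..1}" for y
            using C2.fast_cong[of "q12 b" "\<lambda>_. 0" y z] True that by (simp add: C2.fast_def integral_from_def)
          from K2(4)[OF that(1,2) this that(3)] show ?thesis by simp
        qed
        have zero1: "coef21 a b m y = 0" "C1.slow (coef21 a b m) y = 0" if "y \<in> {0..1}" for m y
          using C1.coefficient_zero[of "coef21 a b", OF _ coef21_0 rec1 that, of m] True by simp_all
        have zero2: "coef12 a b m y = 0" "op_I2 b (coef12 a b m) y = 0" if "y \<in> {0..1}" for m y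
          using C2.coefficient_zero[of "coef12 a b", OF _ coef12_0 rec2 that, of m] True
          by (simp_all add: op_I2_eq C2.slow_def)
        have "op_I1 b (coef21 a b m) y = 0" if y: "y \<in> {0..1}" for m y
        proof -
          have "continuous_on {0..1} (coef21 a b m)"
            by (rule continuous_on_eq[of _ "\<lambda>_. 0"]) (simp_all add: zero1)
          from op_I1_eq[OF this y] zero1(2)[OF y, of m] show ?thesis by (simp add: C1.slow_def)
        qed
        then show "has_inverse_powers \<Omega> n u1 (\<lambda>m. op_I1 b (coef21 a b m))"
          by (intro has_inverse_powers_zero[where K = \<mu>1]) (simp_all add: uv1)
        show "has_inverse_powers \<Omega> n v1 (coef21 a b)"
          by (rule has_inverse_powers_zero[where K = \<mu>1]) (simp_all add: uv1 zero1)
        show "has_inverse_powers \<Omega> n u2 (\<lambda>m. op_I2 b (coef12 a b m))" "has_inverse_powers \<Omega> n v2 (coef12 a b)"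
          by (rule has_inverse_powers_zero[where K = \<mu>2]; simp add: uv2 zero2)+
      qed
      then show ?thesis using rep by blast
    next
      case False
      obtain k where k: "k > 0" "\<And>z. z \<in> \<Omega> \<Longrightarrow> cmod z \<ge> 1 \<Longrightarrow> k / cmod z \<le> \<Upsilon> z"
      proof (cases "\<forall>x\<in>{0..1}. q21 b x = 0")
        case True
        then have "\<exists>x\<in>{0..1}. integral_from c2 (q12 b) x \<noteq> 0"
          using False continuous_integral_from_zero[OF qc(1), of c2] by blast
        then obtain x0 where x0: "x0 \<in> {0..1}" "integral_from c2 (q12 b) x0 \<noteq> 0" by blast
        obtain k where "k > 0" "\<And>z \<eta>. cmod z \<ge> 1 \<Longrightarrow> (\<And>y. y \<in> {0..1} \<Longrightarrow> cmod (C2.fast z (q12 b) y) \<le> \<eta>) \<Longrightarrow> k / cmod z \<le> \<eta>"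
          by (rule C2.fast_lower_bound[OF q_int(1) x0]) blast
        then show ?thesis using \<Upsilon>2 by (intro that[of k]) blast+
      next
        case False
        then have "\<exists>x\<in>{0..1}. integral_from c1 (q21 b) x \<noteq> 0"
          using continuous_integral_from_zero[OF qc(2), of c1] by blast
        then obtain x0 where x0: "x0 \<in> {0..1}" "integral_from c1 (q21 b) x0 \<noteq> 0" by blast
        obtain k where "k > 0" "\<And>z \<eta>. cmod z \<ge> 1 \<Longrightarrow> (\<And>y. y \<in> {0..1} \<Longrightarrow> cmod (C1.fast z (q21 b) y) \<le> \<eta>) \<Longrightarrow> k / cmod z \<le> \<eta>"
          by (rule C1.fast_lower_bound[OF q_int(2) x0]) blast
        then show ?thesis using \<Upsilon>1 by (intro that[of k]) blast+
      qed
      obtain r1' where r1: "\<And>m. m < n \<Longrightarrow> coef21 a b m has_L1_derivative r1' m"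
        "\<And>x. x \<in> {0..1} \<Longrightarrow> of_real (adiff a x) * coef21 a b 0 x = q21 b x"
        "\<And>m x. Suc m < n \<Longrightarrow> x \<in> {0..1} \<Longrightarrow>
           of_real (adiff a x) * coef21 a b (Suc m) x = q21 b x * C1.slow (coef21 a b m) x - r1' m x"
      proof (rule C1.coefficient_chain[of n "coef21 a b", OF n0 reg(1,2,3) coef21_0])
        fix m and x :: real assume "continuous_on {0..1} (coef21 a b m)" "x \<in> {0..1}"
        then show "coef21 a b (Suc m) x = (q21 b x * C1.slow (coef21 a b m) x -
            vector_derivative (coef21 a b m) (at x within {0..1})) / of_real (adiff a x)"
          by (rule rec1)
      qed (use that in blast)
      obtain r2' where r2: "\<And>m. m < n \<Longrightarrow> coef12 a b m has_L1_derivative r2' m"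
        "\<And>x. x \<in> {0..1} \<Longrightarrow> of_real (- adiff a x) * coef12 a b 0 x = q12 b x"
        "\<And>m x. Suc m < n \<Longrightarrow> x \<in> {0..1} \<Longrightarrow>
           of_real (- adiff a x) * coef12 a b (Suc m) x = q12 b x * C2.slow (coef12 a b m) x - r2' m x"
        by (rule C2.coefficient_chain[of n "coef12 a b", OF n0 reg' reg(3,2) coef12_0 rec2]) (use that in blast)
      obtain \<nu>1 s1 w1 L1 where P1: "\<nu>1 \<ge> 1" "L1 \<ge> 0"
        "column_pair {z \<in> \<Omega>. cmod z > \<nu>1} (adiff a) (q12 b) (q21 b) s1 w1"
        "\<And>z x. z \<in> \<Omega> \<Longrightarrow> cmod z > \<nu>1 \<Longrightarrow> x \<in> {0..1} \<Longrightarrow> cmod (s1 z x) \<le> L1 / cmod z \<and> cmod (w1 z x) \<le> L1 / cmod z"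
        "has_inverse_powers \<Omega> n s1 (\<lambda>m. C1.slow (coef21 a b m))" "has_inverse_powers \<Omega> n w1 (coef21 a b)"
      proof (rule C1.column_pair_expansion[OF n0, of "coef21 a b" r1'], goal_cases)
        case (1 m)
        show ?case by (rule r1(1)[OF 1(2)])
      next
        case (2 x)
        show ?case by (rule r1(2)[OF 2(2)])
      next
        case (3 m x)
        show ?case by (rule r1(3)[OF 3(2,3)])
      next
        case (4 \<nu> s w L)
        show ?case using 4(2-) by (rule that)
      qed
      obtain \<nu>2 s2 w2 L2 where P2: "\<nu>2 \<ge> 1" "L2 \<ge> 0"
        "column_pair {z \<in> \<Omega>. cmod z > \<nu>2} (\<lambda>x. - adiff a x) (q21 b) (q12 b) s2 w2"
        "\<And>z x. z \<in> \<Omega> \<Longrightarrow> cmod z > \<nu>2 \<Longrightarrow> x \<in> {0..1} \<Longrightarrow> cmod (s2 z x) \<le> L2 / cmod z \<and> cmod (w2 z x) \<le> L2 / cmod z"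
        "has_inverse_powers \<Omega> n s2 (\<lambda>m. C2.slow (coef12 a b m))" "has_inverse_powers \<Omega> n w2 (coef12 a b)"
      proof (rule C2.column_pair_expansion[OF n0, of "coef12 a b" r2'], goal_cases)
        case (1 m)
        show ?case by (rule r2(1)[OF 1(2)])
      next
        case (2 x)
        show ?case by (rule r2(2)[OF 2(2)])
      next
        case (3 m x)
        show ?case by (rule r2(3)[OF 3(2,3)])
      next
        case (4 \<nu> s w L)
        show ?case using 4(2-) by (rule that)
      qed
      define \<nu>0 where "\<nu>0 = max (max \<nu>1 \<nu>2) (4 * (L1 + L2))"
      have "has_representation a b \<Omega> \<Upsilon> (Ymat (Rmat s1 w1 s2 w2)) (Rmat s1 w1 s2 w2)"
      proof (rule has_representation_Ymat[of \<Omega> \<nu>0 s1 w1 s2 w2 "(L1 + L2) / k"])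
        show "column_pair {z \<in> \<Omega>. cmod z > \<nu>0} (adiff a) (q12 b) (q21 b) s1 w1"
          by (rule column_pair_subset[OF P1(3)]) (auto simp: \<nu>0_def)
        show "column_pair {z \<in> \<Omega>. cmod z > \<nu>0} (\<lambda>x. - adiff a x) (q21 b) (q12 b) s2 w2"
          by (rule column_pair_subset[OF P2(3)]) (auto simp: \<nu>0_def)
        fix z x assume z: "z \<in> \<Omega>" "cmod z > \<nu>0" and x: "x \<in> {0..1::real}"
        have zs: "cmod z > \<nu>1" "cmod z > \<nu>2" "cmod z > 4 * (L1 + L2)" "cmod z \<ge> 1"
          using z P1(1) by (auto simp: \<nu>0_def)
        have zp: "cmod z > 0" using zs(4) by linarith
        have le: "L1 / cmod z \<le> (L1 + L2) / cmod z" "L2 / cmod z \<le> (L1 + L2) / cmod z"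
          using P1(2) P2(2) zp by (auto intro!: divide_right_mono)
        have q: "(L1 + L2) / cmod z \<le> 1/4" using zs(3) zp by (simp add: pos_divide_le_eq)
        have "(L1 + L2) / cmod z = (L1 + L2) / k * (k / cmod z)" using k(1) by simp
        also have "\<dots> \<le> (L1 + L2) / k * \<Upsilon> z"
          using k P1(2) P2(2) z(1) zs(4) by (intro mult_left_mono) auto
        finally have U: "(L1 + L2) / cmod z \<le> (L1 + L2) / k * \<Upsilon> z" .
        show "cmod (s1 z x) \<le> 1/4 \<and> cmod (w1 z x) \<le> 1/4 \<and> cmod (s2 z x) \<le> 1/4 \<and> cmod (w2 z x) \<le> 1/4"
          using P1(4)[OF z(1) zs(1) x] P2(4)[OF z(1) zs(2) x] le q by linarith
        show "cmod (s1 z x) \<le> (L1 + L2) / k * \<Upsilon> z \<and> cmod (w1 z x) \<le> (L1 + L2) / k * \<Upsilon> z \<and>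
              cmod (s2 z x) \<le> (L1 + L2) / k * \<Upsilon> z \<and> cmod (w2 z x) \<le> (L1 + L2) / k * \<Upsilon> z"
          using P1(4)[OF z(1) zs(1) x] P2(4)[OF z(1) zs(2) x] le U by linarith
      qed
      moreover have "has_expansion a b \<Omega> n (Rmat s1 w1 s2 w2)"
      proof (rule has_expansion_Rmat)
        have "op_I1 b (coef21 a b m) x = C1.slow (coef21 a b m) x" if "m < n" "x \<in> {0..1}" for m x
          unfolding C1.slow_def by (rule op_I1_eq[OF L1D_continuous[OF r1(1)[OF that(1)]] that(2)])
        then show "has_inverse_powers \<Omega> n s1 (\<lambda>m. op_I1 b (coef21 a b m))"
          by (rule has_inverse_powers_cong[OF P1(5)])
        show "has_inverse_powers \<Omega> n s2 (\<lambda>m. op_I2 b (coef12 a b m))"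
          using P2(5) unfolding op_I2_eq C2.slow_def .
      qed (rule P1(6) P2(6))+
      ultimately show ?thesis by blast
    qed
  qed
  show ?thesis using rep expansion by blast
qed

end

section \<open>The two half-planes\<close>

context canonical_system
begin

lemma rho_continuous: "continuous_on {0..1} (rho a)"
  unfolding rho_def[abs_def] by (rule L1D_continuous[OF L1D_integral[OF adiff_int]])

lemma rho_increment:
  assumes "0 \<le> t" "t \<le> x" "x \<le> 1"
  shows "0 \<le> rho a x - rho a t" "rho a x - rho a t \<le> rho a 1"
proof -
  have inc: "rho a t \<le> rho a x" if tx: "0 \<le> t" "t \<le> x" "x \<le> 1" for t x
  proof -
    have "rho a x - rho a t = integral_from t (adiff a) x" by (simp add: rho_def integral_from_def)
    also have "\<dots> = integral {t..x} (adiff a)" by (rule integral_from_ge[OF adiff_int tx])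
    also have "\<dots> \<ge> 0"
    proof (rule integral_nonneg[OF absint_subinterval(1)[OF adiff_int tx(1,3)]])
      fix s assume "s \<in> {t..x}"
      then show "0 \<le> adiff a s" using adiff_ge[of s] \<epsilon>(1) tx by auto
    qed
    finally show ?thesis by simp
  qed
  have "rho a 0 = 0" by (simp add: rho_def)
  then show "0 \<le> rho a x - rho a t" "rho a x - rho a t \<le> rho a 1"
    using inc[of t x] inc[of 0 t] inc[of x 1] assms by auto
qed

lemma kernel_bound:
  assumes "Re w \<ge> - \<kappa>" "0 \<le> \<delta>" "\<delta> \<le> rho a 1"
  shows "cmod (exp (- w * of_real \<delta>)) \<le> exp (\<bar>\<kappa>\<bar> * rho a 1)"
proof -
  have "- Re w * \<delta> \<le> \<bar>\<kappa>\<bar> * \<delta>" using assms by (intro mult_right_mono) auto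
  also have "\<dots> \<le> \<bar>\<kappa>\<bar> * rho a 1" using assms by (intro mult_left_mono) auto
  finally show ?thesis by simp
qed

lemma fast_slow_col1:
  assumes "open \<Omega>" "c \<in> {0..1}"
    and "\<And>z x t. z \<in> \<Omega> \<Longrightarrow> x \<in> {0..1} \<Longrightarrow> t \<in> closed_segment c x \<Longrightarrow> cmod (exp (- z * of_real (rho a x - rho a t))) \<le> B"
  shows "fast_slow (adiff a) (rho a) c \<epsilon> B \<Omega> (q12 b) (q21 b) 1"
proof
  show "\<epsilon> \<le> \<bar>adiff a x\<bar>" if "x \<in> {0..1}" for x using adiff_ge[OF that] \<epsilon>(1) by simp
qed (use assms adiff_int q_int \<epsilon>(1) in \<open>simp_all add: rho_def\<close>)

lemma fast_slow_col2:
  assumes "open \<Omega>" "c \<in> {0..1}"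
    and "\<And>z x t. z \<in> \<Omega> \<Longrightarrow> x \<in> {0..1} \<Longrightarrow> t \<in> closed_segment c x \<Longrightarrow> cmod (exp (- z * of_real (- rho a x - - rho a t))) \<le> B"
  shows "fast_slow (\<lambda>x. - adiff a x) (\<lambda>x. - rho a x) c \<epsilon> B \<Omega> (q21 b) (q12 b) 0"
proof
  show "\<epsilon> \<le> \<bar>- adiff a x\<bar>" if "x \<in> {0..1}" for x using adiff_ge[OF that] \<epsilon>(1) by simp
  show "(\<lambda>x. - adiff a x) absolutely_integrable_on {0..1}"
    using absolutely_integrable_linear[OF adiff_int bounded_linear_minus[OF bounded_linear_ident]] by (simp add: o_def)
  show "- rho a x = integral {0..x} (\<lambda>x. - adiff a x)" for x by (simp add: rho_def)
  show "cmod (exp (- z * of_real (- rho a x - - rho a t))) \<le> B"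
    if "z \<in> \<Omega>" "x \<in> {0..1}" "t \<in> closed_segment c x" for z x t by (rule assms(3)[OF that])
qed (use assms q_int \<epsilon>(1) in simp_all)

text \<open>
  A bound for fixed \<open>z\<close>, which makes the suprema in the definition of \<open>\<Upsilon>\<close> suprema of bounded sets.
\<close>

lemma exponential_integral_bound:
  assumes q: "q absolutely_integrable_on {0..1}" and w: "continuous_on {0..1} w"
    and K: "\<And>t. t \<in> {0..1} \<Longrightarrow> cmod (w t) \<le> K" and uv: "0 \<le> u" "v \<le> 1"
  shows "cmod (integral {u..v} (\<lambda>t. q t * exp (w t))) \<le> exp K * L1norm q"
proof (cases "u \<le> v")
  case True
  have i: "(\<lambda>t. q t * exp (w t)) absolutely_integrable_on {0..1}"
    by (intro absint_continuous_mult(2) q continuous_intros w)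
  have "integral {u..v} (\<lambda>t. q t * exp (w t)) = integral_from u (\<lambda>t. q t * exp (w t)) v"
    by (rule integral_from_ge[symmetric, OF i uv(1) True uv(2)])
  also have "cmod \<dots> \<le> exp K * L1norm q"
  proof (rule integral_from_norm_le[OF i q])
    fix t assume "t \<in> closed_segment u v"
    then have t: "t \<in> {0..1}" using uv True by (auto simp: closed_segment_eq_real_ivl)
    have "cmod (exp (w t)) \<le> exp K" using order_trans[OF norm_exp, of "w t" "exp K"] K[OF t] by simp
    then show "cmod (q t * exp (w t)) \<le> exp K * cmod (q t)"
      by (simp add: norm_mult mult.commute[of "cmod (q t)"] mult_right_mono)
  qed (use uv True in auto)
  finally show ?thesis .
next
  case False
  then show ?thesis using L1norm_nonneg[OF q] by simp
qed

lemma exists_exponent_bound: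
  obtains K where "\<And>z s t. s \<in> {0..1} \<Longrightarrow> t \<in> {0..1} \<Longrightarrow> cmod (z * of_real (rho a s - rho a t)) \<le> cmod z * K"
proof -
  have "bounded (rho a ` {0..1})"
    using rho_continuous compact_continuous_image compact_imp_bounded by blast
  then obtain P where "\<forall>y\<in>rho a ` {0..1}. norm y \<le> P"
    unfolding bounded_iff by blast
  then have P: "\<bar>rho a x\<bar> \<le> P" if "x \<in> {0..1}" for x
    using that by simp
  show ?thesis
  proof (rule that[of "2 * P"])
    fix z :: complex and s t :: real assume "s \<in> {0..1}" "t \<in> {0..1}"
    then have "\<bar>rho a s - rho a t\<bar> \<le> 2 * P" using P[of s] P[of t] by linarith
    then show "cmod (z * of_real (rho a s - rho a t)) \<le> cmod z * (2 * P)"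
      unfolding norm_mult norm_of_real by (rule mult_left_mono) simp
  qed
qed

lemma le_SUP_Max4:
  fixes f1 f2 f3 f4 :: "real \<Rightarrow> real \<Rightarrow> real"
  assumes "\<And>s x. s \<in> {0..1} \<Longrightarrow> x \<in> {0..1} \<Longrightarrow> f1 s x \<le> K \<and> f2 s x \<le> K \<and> f3 s x \<le> K \<and> f4 s x \<le> K"
    and sx: "s \<in> {0..1}" "x \<in> {0..1}" and y: "y \<in> {f1 s x, f2 s x, f3 s x, f4 s x}"
  shows "y \<le> (SUP (s, x)\<in>{0..1} \<times> {0..1}. Max {f1 s x, f2 s x, f3 s x, f4 s x})"
proof (rule cSUP_upper2[where x = "(s, x)"])
  have "Max {f1 s x, f2 s x, f3 s x, f4 s x} \<le> K" if "s \<in> {0..1}" "x \<in> {0..1}" for s x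
    using assms(1)[OF that] by simp
  then show "bdd_above ((\<lambda>(s, x). Max {f1 s x, f2 s x, f3 s x, f4 s x}) ` ({0..1} \<times> {0..1}))"
    by (intro bdd_aboveI[of _ K]) auto
  show "y \<le> (case (s, x) of (s, x) \<Rightarrow> Max {f1 s x, f2 s x, f3 s x, f4 s x})"
    unfolding prod.case by (rule Max_ge[OF _ y]) simp
qed (use sx in auto)

lemma le_Upsilon_plus:
  assumes s: "s \<in> {0..1}" and x: "x \<in> {0..1}"
  shows "cmod (v12 a b s x z) \<le> Upsilon_plus a b z" "cmod (v21 a b s x z) \<le> Upsilon_plus a b z"
proof -
  obtain K where K: "\<And>z s t. s \<in> {0..1} \<Longrightarrow> t \<in> {0..1} \<Longrightarrow> cmod (z * of_real (rho a s - rho a t)) \<le> cmod z * K"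
    by (rule exists_exponent_bound) blast
  define C where "C = exp (cmod z * K) * (L1norm (q12 b) + L1norm (q21 b))"
  have L: "exp (cmod z * K) * L1norm (q12 b) \<le> C" "exp (cmod z * K) * L1norm (q21 b) \<le> C"
    unfolding C_def using L1norm_nonneg[OF q_int(1)] L1norm_nonneg[OF q_int(2)] by (auto intro!: mult_left_mono)
  have b1: "cmod (v11 a b s x z) \<le> C \<and> cmod (v12 a b s x z) \<le> C \<and> cmod (v21 a b s x z) \<le> C \<and> cmod (v22 a b s x z) \<le> C"
    if s: "s \<in> {0..1}" and x: "x \<in> {0..1}" for s x
    unfolding v11_def v12_def v21_def v22_def norm_minus_cancel of_real_diff
    using s x K[OF _ s, of _ "-z"] K[OF x, of _ z] K[OF x, of _ "-z"] K[OF _ s, of _ z]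
    by (intro conjI order_trans[OF exponential_integral_bound L(1)] order_trans[OF exponential_integral_bound L(2)]
          q_int continuous_intros rho_continuous) auto
  show "cmod (v12 a b s x z) \<le> Upsilon_plus a b z" "cmod (v21 a b s x z) \<le> Upsilon_plus a b z"
    unfolding Upsilon_plus_def by (rule le_SUP_Max4[OF b1 s x], assumption, assumption, simp)+
qed

lemma le_Upsilon_minus:
  assumes s: "s \<in> {0..1}" and x: "x \<in> {0..1}"
  shows "cmod (integral {max x s..1} (\<lambda>t. q21 b t * exp (- z * of_real (rho a x - rho a t)))) \<le> Upsilon_minus a b z"
    "cmod (integral {0..min x s} (\<lambda>t. q12 b t * exp (z * of_real (rho a x - rho a t)))) \<le> Upsilon_minus a b z"
proof -
  obtain K where K: "\<And>z s t. s \<in> {0..1} \<Longrightarrow> t \<in> {0..1} \<Longrightarrow> cmod (z * of_real (rho a s - rho a t)) \<le> cmod z * K"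
    by (rule exists_exponent_bound) blast
  define C where "C = exp (cmod z * K) * (L1norm (q12 b) + L1norm (q21 b))"
  have L: "exp (cmod z * K) * L1norm (q12 b) \<le> C" "exp (cmod z * K) * L1norm (q21 b) \<le> C"
    unfolding C_def using L1norm_nonneg[OF q_int(1)] L1norm_nonneg[OF q_int(2)] by (auto intro!: mult_left_mono)
  have b1: "cmod (integral {max x s..1} (\<lambda>t. q21 b t * exp (z * of_real (rho a t - rho a s)))) \<le> C \<and>
      cmod (integral {max x s..1} (\<lambda>t. q21 b t * exp (- z * of_real (rho a x - rho a t)))) \<le> C \<and>
      cmod (integral {0..min x s} (\<lambda>t. q12 b t * exp (z * of_real (rho a x - rho a t)))) \<le> C \<and>
      cmod (integral {0..min x s} (\<lambda>t. q12 b t * exp (- z * of_real (rho a t - rho a s)))) \<le> C"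
    if s: "s \<in> {0..1}" and x: "x \<in> {0..1}" for s x
    unfolding of_real_diff
    using s x K[OF _ s, of _ "-z"] K[OF x, of _ z] K[OF x, of _ "-z"] K[OF _ s, of _ z]
    by (intro conjI order_trans[OF exponential_integral_bound L(1)] order_trans[OF exponential_integral_bound L(2)]
          q_int continuous_intros rho_continuous) auto
  show "cmod (integral {max x s..1} (\<lambda>t. q21 b t * exp (- z * of_real (rho a x - rho a t)))) \<le> Upsilon_minus a b z"
    "cmod (integral {0..min x s} (\<lambda>t. q12 b t * exp (z * of_real (rho a x - rho a t)))) \<le> Upsilon_minus a b z"
    unfolding Upsilon_minus_def by (rule le_SUP_Max4[OF b1 s x], assumption, assumption, simp)+
qed

text \<open>
  The first fast component is integrated from 0 and the second one from 1; then all exponentials are of the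
  form \<open>exp (- z \<delta>)\<close> with \<open>\<delta> \<ge> 0\<close> bounded.
\<close>

lemma plus_half_plane:
  "(\<exists>Y R. has_representation a b (half_plane_plus \<kappa>) (Upsilon_plus a b) Y R) \<and>
    (\<forall>n\<ge>1. smooth_coefficients n a b \<longrightarrow>
       (\<exists>Y R. has_representation a b (half_plane_plus \<kappa>) (Upsilon_plus a b) Y R \<and>
              has_expansion a b (half_plane_plus \<kappa>) n R))"
proof -
  define B where "B = exp (\<bar>\<kappa>\<bar> * rho a 1)"
  have op: "open (half_plane_plus \<kappa>)"
    unfolding half_plane_plus_def by (rule open_halfspace_Re_gt)
  have F1: "fast_slow (adiff a) (rho a) 0 \<epsilon> B (half_plane_plus \<kappa>) (q12 b) (q21 b) 1"
  proof (rule fast_slow_col1[OF op])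
    fix z x t assume z: "z \<in> half_plane_plus \<kappa>" and x: "x \<in> {0..1::real}" and t: "t \<in> closed_segment 0 x"
    show "cmod (exp (- z * of_real (rho a x - rho a t))) \<le> B"
      unfolding B_def
      by (rule kernel_bound) (use rho_increment[of t x] z x t in \<open>auto simp: half_plane_plus_def closed_segment_eq_real_ivl\<close>)
  qed simp
  have F2: "fast_slow (\<lambda>x. - adiff a x) (\<lambda>x. - rho a x) 1 \<epsilon> B (half_plane_plus \<kappa>) (q21 b) (q12 b) 0"
  proof (rule fast_slow_col2[OF op])
    fix z x t assume z: "z \<in> half_plane_plus \<kappa>" and x: "x \<in> {0..1::real}" and t: "t \<in> closed_segment 1 x"
    show "cmod (exp (- z * of_real (- rho a x - - rho a t))) \<le> B"
      unfolding B_def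
      by (rule kernel_bound) (use rho_increment[of x t] z x t in \<open>auto simp: half_plane_plus_def closed_segment_eq_real_ivl split: if_splits\<close>)
  qed simp
  interpret C1: fast_slow "adiff a" "rho a" 0 \<epsilon> B "half_plane_plus \<kappa>" "q12 b" "q21 b" 1 by (rule F1)
  interpret C2: fast_slow "\<lambda>x. - adiff a x" "\<lambda>x. - rho a x" 1 \<epsilon> B "half_plane_plus \<kappa>" "q21 b" "q12 b" 0 by (rule F2)
  show ?thesis
  proof (rule half_plane_conclusions[OF F1 F2])
    fix z y assume y: "y \<in> {0..1::real}"
    have "C1.fast z (q21 b) y = - v21 a b 1 y z"
      unfolding C1.fast_def v21_def using y by (simp add: integral_from_def mult.commute)
    then show "cmod (C1.fast z (q21 b) y) \<le> Upsilon_plus a b z"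
      using le_Upsilon_plus(2)[OF _ y, of 1 z] by simp
    have "C2.fast z (q12 b) y = v12 a b 0 y z"
    proof -
      have "(\<lambda>t. exp (- z * of_real (- rho a y - - rho a t)) * q12 b t) absolutely_integrable_on {0..1}"
        by (intro absint_continuous_mult(1) q_int continuous_intros rho_continuous)
      from integral_from_le[OF this, of y 1] y
      have "C2.fast z (q12 b) y = - integral {y..1} (\<lambda>t. exp (- z * of_real (- rho a y - - rho a t)) * q12 b t)"
        unfolding C2.fast_def by simp
      moreover have "- z * of_real (- rho a y - - rho a t) = z * of_real (rho a y - rho a t)" for t
        by (simp add: algebra_simps)
      moreover have "max y 0 = y" using y by simp
      ultimately show ?thesis by (simp only: v12_def mult.commute[of "q12 b _"])
    qed
    then show "cmod (C2.fast z (q12 b) y) \<le> Upsilon_plus a b z"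
      using le_Upsilon_plus(1)[OF _ y, of 0 z] by simp
  qed
qed

text \<open>
  Replacing \<open>z\<close> by \<open>- z\<close> exchanges the ends of the interval from which the kernels are bounded.
\<close>

lemma minus_half_plane:
  "(\<exists>Y R. has_representation a b (half_plane_minus \<kappa>) (Upsilon_minus a b) Y R) \<and>
    (\<forall>n\<ge>1. smooth_coefficients n a b \<longrightarrow>
       (\<exists>Y R. has_representation a b (half_plane_minus \<kappa>) (Upsilon_minus a b) Y R \<and>
              has_expansion a b (half_plane_minus \<kappa>) n R))"
proof -
  define B where "B = exp (\<bar>\<kappa>\<bar> * rho a 1)"
  have op: "open (half_plane_minus \<kappa>)"
    unfolding half_plane_minus_def by (rule open_halfspace_Re_lt)
  have F1: "fast_slow (adiff a) (rho a) 1 \<epsilon> B (half_plane_minus \<kappa>) (q12 b) (q21 b) 1"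
  proof (rule fast_slow_col1[OF op])
    fix z x t assume z: "z \<in> half_plane_minus \<kappa>" and x: "x \<in> {0..1::real}" and t: "t \<in> closed_segment 1 x"
    have "cmod (exp (- (- z) * of_real (rho a t - rho a x))) \<le> B"
      unfolding B_def
      by (rule kernel_bound) (use rho_increment[of x t] z x t in \<open>auto simp: half_plane_minus_def closed_segment_eq_real_ivl split: if_splits\<close>)
    then show "cmod (exp (- z * of_real (rho a x - rho a t))) \<le> B" by (simp add: algebra_simps)
  qed simp
  have F2: "fast_slow (\<lambda>x. - adiff a x) (\<lambda>x. - rho a x) 0 \<epsilon> B (half_plane_minus \<kappa>) (q21 b) (q12 b) 0"
  proof (rule fast_slow_col2[OF op])
    fix z x t assume z: "z \<in> half_plane_minus \<kappa>" and x: "x \<in> {0..1::real}" and t: "t \<in> closed_segment 0 x"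
    have "cmod (exp (- (- z) * of_real (rho a x - rho a t))) \<le> B"
      unfolding B_def
      by (rule kernel_bound) (use rho_increment[of t x] z x t in \<open>auto simp: half_plane_minus_def closed_segment_eq_real_ivl\<close>)
    then show "cmod (exp (- z * of_real (- rho a x - - rho a t))) \<le> B" by (simp add: algebra_simps)
  qed simp
  interpret C1: fast_slow "adiff a" "rho a" 1 \<epsilon> B "half_plane_minus \<kappa>" "q12 b" "q21 b" 1 by (rule F1)
  interpret C2: fast_slow "\<lambda>x. - adiff a x" "\<lambda>x. - rho a x" 0 \<epsilon> B "half_plane_minus \<kappa>" "q21 b" "q12 b" 0 by (rule F2)
  show ?thesis
  proof (rule half_plane_conclusions[OF F1 F2])
    fix z y assume y: "y \<in> {0..1::real}"
    have "C1.fast z (q21 b) y = - integral {max y 0..1} (\<lambda>t. q21 b t * exp (- z * of_real (rho a y - rho a t)))"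
    proof -
      have "(\<lambda>t. exp (- z * of_real (rho a y - rho a t)) * q21 b t) absolutely_integrable_on {0..1}"
        by (intro absint_continuous_mult(1) q_int continuous_intros rho_continuous)
      from integral_from_le[OF this, of y 1] y show ?thesis
        unfolding C1.fast_def by (simp add: mult.commute[of "q21 b _"])
    qed
    then show "cmod (C1.fast z (q21 b) y) \<le> Upsilon_minus a b z"
      using le_Upsilon_minus(1)[OF _ y, of 0 z] by simp
    have "C2.fast z (q12 b) y = integral {0..min y 1} (\<lambda>t. q12 b t * exp (z * of_real (rho a y - rho a t)))"
      unfolding C2.fast_def using y by (simp add: integral_from_def algebra_simps)
    then show "cmod (C2.fast z (q12 b) y) \<le> Upsilon_minus a b z"
      using le_Upsilon_minus(2)[OF _ y, of 1 z] by simp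
  qed
qed

end

theorem mainTheorem1:
  fixes a :: "2 \<Rightarrow> real \<Rightarrow> real" and b :: "2 \<Rightarrow> 2 \<Rightarrow> real \<Rightarrow> complex" and \<epsilon> \<kappa> :: real
  assumes "\<And>i. a i absolutely_integrable_on {0..1}"
    and "\<And>i j. b i j absolutely_integrable_on {0..1}"
    and "\<epsilon> > 0"
    and "\<And>x. x \<in> {0..1} \<Longrightarrow> a 1 x > 0"
    and "\<And>x. x \<in> {0..1} \<Longrightarrow> a 2 x < 0"
    and "\<And>x. x \<in> {0..1} \<Longrightarrow> a 1 x - a 2 x \<ge> \<epsilon>"
  shows
    "(\<exists>Y R. has_representation a b (half_plane_plus \<kappa>) (Upsilon_plus a b) Y R) \<and>
     (\<forall>n\<ge>1. smooth_coefficients n a b \<longrightarrow>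
        (\<exists>Y R. has_representation a b (half_plane_plus \<kappa>) (Upsilon_plus a b) Y R \<and>
               has_expansion a b (half_plane_plus \<kappa>) n R)) \<and>
     (\<exists>Y R. has_representation a b (half_plane_minus \<kappa>) (Upsilon_minus a b) Y R) \<and>
     (\<forall>n\<ge>1. smooth_coefficients n a b \<longrightarrow>
        (\<exists>Y R. has_representation a b (half_plane_minus \<kappa>) (Upsilon_minus a b) Y R \<and>
               has_expansion a b (half_plane_minus \<kappa>) n R))"
proof -
  interpret canonical_system a b \<epsilon>
    by standard (use assms in auto)
  show ?thesis
    using plus_half_plane[of \<kappa>] minus_half_plane[of \<kappa>] by blast
qed

end
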